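(* The QWRP and the BWRP in an arrangement of $n$ lines in the plane, not all parallel, can each be solved exactly in $O(n^7)$ time.
   Context: Let $\mathcal{L}$ be a set of $n$ lines in the plane, not all parallel, so that their union is connected; the lines are truncated within a bounding box enclosing all intersection points of lines, and the domain $P$ is the union of the truncated lines. A route (tour) is a closed polygonal curve contained in $P$. A route sees (visits) a line if it contains at least one point of that line (all of a line can be seen from any point on it). No depot is specified. QWRP in an arrangement of lines: given an integer quota $Q$, find a route contained in $P$ of minimum length that visits at least $Q$ of the lines. BWRP in an arrangement of lines: given a length budget $B$, find a route contained in $P$ of length at most $B$ that visits the maximum number of lines. The model of computation is the real RAM (constant time per arithmetic operation and comparison on real numbers). *)

theory Defs
  imports "HOL-Analysis.Analysis" "HOL-Library.Landau_Symbols"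
begin

section \<open>Real RAM\<close>

text \<open>
  The store consists of finitely many (per program) unbounded arrays of natural numbers and of
  real numbers; an array is named by a constant, while the index of a cell is computed at run time
  (indirect addressing). Programs are finite syntax trees that contain no real constants other than
  those obtained from natural numbers. There is no rounding and no conversion from reals to
  naturals, and no division or bit operation on naturals. Square root is one of the arithmetic
  operations on reals, since Euclidean lengths must be computed exactly.
\<close>

record store =
  nats :: "nat \<Rightarrow> nat \<Rightarrow> nat"
  reals :: "nat \<Rightarrow> nat \<Rightarrow> real"

datatype nexp =
    NConst nat
  | NCell nat nexp
  | NAdd nexp nexp
  | NSub nexp nexp
  | NMul nexp nexp

datatype rexp =
    ROfNat nexp
  | RCell nat nexp
  | RAdd rexp rexp
  | RSub rexp rexp
  | RMul rexp rexp
  | RDiv rexp rexp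
  | RSqrt rexp

datatype bexp =
    NLess nexp nexp
  | NEq nexp nexp
  | RLess rexp rexp
  | REq rexp rexp
  | BNot bexp
  | BAnd bexp bexp

primrec nval :: "nexp \<Rightarrow> store \<Rightarrow> nat" where
  "nval (NConst k) s = k"
| "nval (NCell a i) s = nats s a (nval i s)"
| "nval (NAdd e f) s = nval e s + nval f s"
| "nval (NSub e f) s = nval e s - nval f s"
| "nval (NMul e f) s = nval e s * nval f s"

text \<open>
  Division by zero and square roots of negative numbers follow the conventions of HOL
  (\<open>x / 0 = 0\<close>, \<open>sqrt (- x) = - sqrt x\<close>); a program can simulate them with one extra test, so they
  affect running times only by a constant factor.
\<close>

primrec rval :: "rexp \<Rightarrow> store \<Rightarrow> real" where
  "rval (ROfNat e) s = real (nval e s)"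
| "rval (RCell a i) s = reals s a (nval i s)"
| "rval (RAdd e f) s = rval e s + rval f s"
| "rval (RSub e f) s = rval e s - rval f s"
| "rval (RMul e f) s = rval e s * rval f s"
| "rval (RDiv e f) s = rval e s / rval f s"
| "rval (RSqrt e) s = sqrt (rval e s)"

primrec bval :: "bexp \<Rightarrow> store \<Rightarrow> bool" where
  "bval (NLess e f) s \<longleftrightarrow> nval e s < nval f s"
| "bval (NEq e f) s \<longleftrightarrow> nval e s = nval f s"
| "bval (RLess e f) s \<longleftrightarrow> rval e s < rval f s"
| "bval (REq e f) s \<longleftrightarrow> rval e s = rval f s"
| "bval (BNot b) s \<longleftrightarrow> \<not> bval b s"
| "bval (BAnd b c) s \<longleftrightarrow> bval b s \<and> bval c s"

text \<open>Every constant, memory access, arithmetic operation and comparison costs one time unit.\<close>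

primrec ncost :: "nexp \<Rightarrow> nat" where
  "ncost (NConst k) = 1"
| "ncost (NCell a i) = 1 + ncost i"
| "ncost (NAdd e f) = 1 + ncost e + ncost f"
| "ncost (NSub e f) = 1 + ncost e + ncost f"
| "ncost (NMul e f) = 1 + ncost e + ncost f"

primrec rcost :: "rexp \<Rightarrow> nat" where
  "rcost (ROfNat e) = 1 + ncost e"
| "rcost (RCell a i) = 1 + ncost i"
| "rcost (RAdd e f) = 1 + rcost e + rcost f"
| "rcost (RSub e f) = 1 + rcost e + rcost f"
| "rcost (RMul e f) = 1 + rcost e + rcost f"
| "rcost (RDiv e f) = 1 + rcost e + rcost f"
| "rcost (RSqrt e) = 1 + rcost e"

primrec bcost :: "bexp \<Rightarrow> nat" where
  "bcost (NLess e f) = 1 + ncost e + ncost f"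
| "bcost (NEq e f) = 1 + ncost e + ncost f"
| "bcost (RLess e f) = 1 + rcost e + rcost f"
| "bcost (REq e f) = 1 + rcost e + rcost f"
| "bcost (BNot b) = 1 + bcost b"
| "bcost (BAnd b c) = 1 + bcost b + bcost c"

datatype prog =
    Skip
  | NAssign nat nexp nexp
  | RAssign nat nexp rexp
  | Seq prog prog
  | Cond bexp prog prog
  | While bexp prog

definition nwrite :: "nat \<Rightarrow> nat \<Rightarrow> nat \<Rightarrow> store \<Rightarrow> store" where
  "nwrite a i v s = s\<lparr>nats := (nats s)(a := (nats s a)(i := v))\<rparr>"

definition rwrite :: "nat \<Rightarrow> nat \<Rightarrow> real \<Rightarrow> store \<Rightarrow> store" where
  "rwrite a i v s = s\<lparr>reals := (reals s)(a := (reals s a)(i := v))\<rparr>"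

text \<open>\<open>exec p s t s'\<close>: started in store \<open>s\<close>, program \<open>p\<close> halts after \<open>t\<close> time units in store \<open>s'\<close>.\<close>

inductive exec :: "prog \<Rightarrow> store \<Rightarrow> nat \<Rightarrow> store \<Rightarrow> bool" where
  Skip: "exec Skip s 1 s"
| NAssign: "exec (NAssign a i e) s (1 + ncost i + ncost e) (nwrite a (nval i s) (nval e s) s)"
| RAssign: "exec (RAssign a i e) s (1 + ncost i + rcost e) (rwrite a (nval i s) (rval e s) s)"
| Seq: "exec p s t s' \<Longrightarrow> exec q s' u s'' \<Longrightarrow> exec (Seq p q) s (t + u) s''"
| IfTrue: "bval b s \<Longrightarrow> exec p s t s' \<Longrightarrow> exec (Cond b p q) s (1 + bcost b + t) s'"
| IfFalse: "\<not> bval b s \<Longrightarrow> exec q s t s' \<Longrightarrow> exec (Cond b p q) s (1 + bcost b + t) s'"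
| WhileFalse: "\<not> bval b s \<Longrightarrow> exec (While b p) s (1 + bcost b) s"
| WhileTrue: "bval b s \<Longrightarrow> exec p s t s' \<Longrightarrow> exec (While b p) s' u s''
    \<Longrightarrow> exec (While b p) s (1 + bcost b + t + u) s''"

inductive_cases SkipE: "exec Skip s t s'"
inductive_cases NAssignE: "exec (NAssign a i e) s t s'"
inductive_cases RAssignE: "exec (RAssign a i e) s t s'"
inductive_cases SeqE: "exec (Seq p q) s t s'"
inductive_cases IfE: "exec (Cond b p q) s t s'"
inductive_cases WhileE: "exec (While b p) s t s'"

lemma exec_deterministic:
  "exec p s t s' \<Longrightarrow> exec p s u s'' \<Longrightarrow> u = t \<and> s'' = s'"
proof (induction arbitrary: u s'' rule: exec.induct)
  case (Skip s)
  then show ?case by (elim SkipE) simp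
next
  case (NAssign a i e s)
  then show ?case by (elim NAssignE) simp
next
  case (RAssign a i e s)
  then show ?case by (elim RAssignE) simp
next
  case (Seq p s t s1 q t' s2)
  from Seq.prems obtain v r w where "exec p s v r" "exec q r w s''" "u = v + w"
    by (elim SeqE) simp
  with Seq.IH(1)[of v r] Seq.IH(2)[of w s''] show ?case by simp
next
  case (IfTrue b s p t s1 q)
  from IfTrue.prems IfTrue.hyps obtain v where "exec p s v s''" "u = 1 + bcost b + v"
    by (elim IfE) simp_all
  with IfTrue.IH[of v s''] show ?case by simp
next
  case (IfFalse b s q t s1 p)
  from IfFalse.prems IfFalse.hyps obtain v where "exec q s v s''" "u = 1 + bcost b + v"
    by (elim IfE) simp_all
  with IfFalse.IH[of v s''] show ?case by simp
next
  case (WhileFalse b s p)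
  from WhileFalse.prems WhileFalse.hyps show ?case by - (erule WhileE, simp_all)
next
  case (WhileTrue b s p t s1 t' s2)
  from WhileTrue.prems WhileTrue.hyps obtain v r w
    where "exec p s v r" "exec (While b p) r w s''" "u = 1 + bcost b + v + w"
    by - (erule WhileE, simp_all)
  with WhileTrue.IH(1)[of v r] WhileTrue.IH(2)[of w s''] show ?case by simp
qed

text \<open>The input is stored in the arrays number 0; all other cells are initially 0.\<close>

definition cells :: "'a::zero list \<Rightarrow> nat \<Rightarrow> 'a" where
  "cells xs i = (if i < length xs then xs ! i else 0)"

definition initial :: "nat list \<Rightarrow> real list \<Rightarrow> store" where
  "initial ns rs = \<lparr>nats = (\<lambda>_ _. 0)(0 := cells ns), reals = (\<lambda>_ _. 0)(0 := cells rs)\<rparr>"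

text \<open>
  The output is a list of points of the plane: its length is in cell 0 of natural array 1, the
  coordinates of the \<open>j\<close>-th point are in cells \<open>2 * j\<close> and \<open>2 * j + 1\<close> of real array 1.
\<close>

definition answer :: "store \<Rightarrow> (real \<times> real) list" where
  "answer s = map (\<lambda>j. (reals s 1 (2 * j), reals s 1 (2 * j + 1))) [0..<nats s 1 0]"


section \<open>Routes in an arrangement of lines\<close>

definition line_of :: "real \<times> real \<times> real \<Rightarrow> (real \<times> real) set" where
  "line_of = (\<lambda>(a, b, c). {(x, y). a * x + b * y = c})"

text \<open>
  \<open>line_arrangement ls lo hi\<close>: the coefficient triples \<open>ls\<close> describe, without repetition, a set of
  lines that are not all parallel, and the box with corners \<open>lo\<close> and \<open>hi\<close> contains all
  intersection points.
\<close>

definition line_arrangement ::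
  "(real \<times> real \<times> real) list \<Rightarrow> real \<times> real \<Rightarrow> real \<times> real \<Rightarrow> bool" where
  "line_arrangement ls lo hi \<longleftrightarrow>
     (\<forall>(a, b, c) \<in> set ls. (a, b) \<noteq> (0, 0)) \<and>
     distinct (map line_of ls) \<and>
     \<not> (\<forall>l \<in> set ls. \<forall>m \<in> set ls. affine_parallel (line_of l) (line_of m)) \<and>
     (\<forall>l \<in> set ls. \<forall>m \<in> set ls. line_of l \<noteq> line_of m \<longrightarrow> line_of l \<inter> line_of m \<subseteq> cbox lo hi)"

definition lines :: "(real \<times> real \<times> real) list \<Rightarrow> (real \<times> real) set set" where
  "lines ls = line_of ` set ls"

definition truncated_union :: "(real \<times> real) set set \<Rightarrow> real \<times> real \<Rightarrow> real \<times> real \<Rightarrow> (real \<times> real) set" where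
  "truncated_union \<L> lo hi = (\<Union>L\<in>\<L>. L \<inter> cbox lo hi)"

text \<open>
  A closed polygonal curve is given by the nonempty cyclic sequence of its vertices. A single vertex
  stands for the constant curve: it is the optimal tour when all lines to be visited share a point.
\<close>

definition edges :: "(real \<times> real) list \<Rightarrow> ((real \<times> real) \<times> (real \<times> real)) list" where
  "edges ps = zip ps (rotate1 ps)"

definition curve :: "(real \<times> real) list \<Rightarrow> (real \<times> real) set" where
  "curve ps = (\<Union>(p, q) \<in> set (edges ps). closed_segment p q)"

definition route_length :: "(real \<times> real) list \<Rightarrow> real" where
  "route_length ps = (\<Sum>(p, q) \<leftarrow> edges ps. dist p q)"

definition is_route :: "(real \<times> real) set \<Rightarrow> (real \<times> real) list \<Rightarrow> bool" where
  "is_route P ps \<longleftrightarrow> ps \<noteq> [] \<and> curve ps \<subseteq> P"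

definition num_visited :: "(real \<times> real) set set \<Rightarrow> (real \<times> real) list \<Rightarrow> nat" where
  "num_visited \<L> ps = card {L \<in> \<L>. L \<inter> curve ps \<noteq> {}}"

definition qwrp_feasible ::
  "(real \<times> real) set set \<Rightarrow> (real \<times> real) set \<Rightarrow> nat \<Rightarrow> (real \<times> real) list \<Rightarrow> bool" where
  "qwrp_feasible \<L> P Q ps \<longleftrightarrow> is_route P ps \<and> Q \<le> num_visited \<L> ps"

definition qwrp_optimal ::
  "(real \<times> real) set set \<Rightarrow> (real \<times> real) set \<Rightarrow> nat \<Rightarrow> (real \<times> real) list \<Rightarrow> bool" where
  "qwrp_optimal \<L> P Q ps \<longleftrightarrow> qwrp_feasible \<L> P Q ps \<and>
     (\<forall>qs. qwrp_feasible \<L> P Q qs \<longrightarrow> route_length ps \<le> route_length qs)"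

definition bwrp_feasible ::
  "(real \<times> real) set \<Rightarrow> real \<Rightarrow> (real \<times> real) list \<Rightarrow> bool" where
  "bwrp_feasible P B ps \<longleftrightarrow> is_route P ps \<and> route_length ps \<le> B"

definition bwrp_optimal ::
  "(real \<times> real) set set \<Rightarrow> (real \<times> real) set \<Rightarrow> real \<Rightarrow> (real \<times> real) list \<Rightarrow> bool" where
  "bwrp_optimal \<L> P B ps \<longleftrightarrow> bwrp_feasible P B ps \<and>
     (\<forall>qs. bwrp_feasible P B qs \<longrightarrow> num_visited \<L> qs \<le> num_visited \<L> ps)"

text \<open>
  A correct answer is an optimal route, or the empty list if no route is feasible
  (\<open>Q > n\<close> respectively \<open>B < 0\<close>).
\<close>

definition qwrp_answer ::
  "(real \<times> real) set set \<Rightarrow> (real \<times> real) set \<Rightarrow> nat \<Rightarrow> (real \<times> real) list \<Rightarrow> bool" where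
  "qwrp_answer \<L> P Q ps \<longleftrightarrow>
     (if \<exists>qs. qwrp_feasible \<L> P Q qs then qwrp_optimal \<L> P Q ps else ps = [])"

definition bwrp_answer ::
  "(real \<times> real) set set \<Rightarrow> (real \<times> real) set \<Rightarrow> real \<Rightarrow> (real \<times> real) list \<Rightarrow> bool" where
  "bwrp_answer \<L> P B ps \<longleftrightarrow>
     (if \<exists>qs. bwrp_feasible P B qs then bwrp_optimal \<L> P B ps else ps = [])"


section \<open>Running time\<close>

definition coeffs :: "(real \<times> real \<times> real) list \<Rightarrow> real list" where
  "coeffs ls = concat (map (\<lambda>(a, b, c). [a, b, c]) ls)"

definition qwrp_input ::
  "(real \<times> real \<times> real) list \<Rightarrow> real \<times> real \<Rightarrow> real \<times> real \<Rightarrow> nat \<Rightarrow> store" where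
  "qwrp_input ls lo hi Q =
     initial [length ls, Q] ([fst lo, snd lo, fst hi, snd hi] @ coeffs ls)"

definition bwrp_input ::
  "(real \<times> real \<times> real) list \<Rightarrow> real \<times> real \<Rightarrow> real \<times> real \<Rightarrow> real \<Rightarrow> store" where
  "bwrp_input ls lo hi B =
     initial [length ls] ([B, fst lo, snd lo, fst hi, snd hi] @ coeffs ls)"

definition solves_qwrp_in_time :: "prog \<Rightarrow> (nat \<Rightarrow> nat) \<Rightarrow> bool" where
  "solves_qwrp_in_time p T \<longleftrightarrow>
     (\<forall>ls lo hi Q. line_arrangement ls lo hi \<longrightarrow>
        (\<exists>t s. exec p (qwrp_input ls lo hi Q) t s \<and> t \<le> T (length ls) \<and>
           qwrp_answer (lines ls) (truncated_union (lines ls) lo hi) Q (answer s)))"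

definition solves_bwrp_in_time :: "prog \<Rightarrow> (nat \<Rightarrow> nat) \<Rightarrow> bool" where
  "solves_bwrp_in_time p T \<longleftrightarrow>
     (\<forall>ls lo hi B. line_arrangement ls lo hi \<longrightarrow>
        (\<exists>t s. exec p (bwrp_input ls lo hi B) t s \<and> t \<le> T (length ls) \<and>
           bwrp_answer (lines ls) (truncated_union (lines ls) lo hi) B (answer s)))"

end

theory Submission
  imports Defs "HOL-Library.Sublist"
begin

text \<open>
  Turn a direction through a full revolution past the \<open>2n\<close> oriented normals of the lines. For a closed
  curve, follow the vertex that is extreme in the current direction: a line is missed exactly if its two
  oriented versions show an extreme vertex on the wrong side, so the number of missed lines is read off
  the extreme vertices alone, and for an arbitrary closed sequence of \<open>2n\<close> vertices the same count never
  underestimates the missed lines. Conversely the extreme vertices of an optimal route can be visited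
  in angular order without making it longer: paths between interleaved boundary points
  cross, which yields a Kalmanson inequality for distances within the arrangement.

  The dynamic program runs over the \<open>2n\<close> events. The extreme vertex changes from \<open>v\<close> to \<open>w\<close> only at the
  unique event at which \<open>w - v\<close> turns positive, so there are \<open>O(n\<^sup>4)\<close> transitions in total. Multiplied by the
  \<open>O(n\<^sup>2)\<close> start vertices and the \<open>O(n)\<close> numbers of missed lines this gives \<open>O(n\<^sup>7)\<close>, which also dominates
  Floyd--Warshall on the \<open>O(n\<^sup>2)\<close> vertices.
\<close>

section \<open>Programs with counting loops\<close>

text \<open>Whether a line is visited depends on the whole tour, so a naive dynamic program over
  vertices would have to remember sets of lines. The sweep replaces this by a sum of 0/1 terms, one
  per event, each depending on a single vertex. One-sided estimates suffice: every route has a table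
  cell that is at most as long and has at most as many misses, and every cell can be printed as a
  route at least as good as its entry. The rearrangement uses distances inside the convex hull of
  the tour, because only there do extreme points confine the connecting paths and force them to
  cross. The tables use unrestricted distances, which are no longer, so nothing is lost. Programs
  are written with loops whose bounds are polynomials in the number of lines. They terminate by
  construction, have a functional semantics, and their running time is bounded by recursion on the
  syntax.\<close>

datatype fprog =
    FN nat nexp nexp
  | FR nat nexp rexp
  | FSeq fprog fprog (infixr \<open>;;\<close> 60)
  | FIf bexp fprog fprog
  | FFor nat nexp fprog

abbreviation V :: "nat \<Rightarrow> nexp" where "V x \<equiv> NCell x (NConst 0)"
abbreviation RV :: "nat \<Rightarrow> rexp" where "RV x \<equiv> RCell x (NConst 0)"

primrec compile :: "fprog \<Rightarrow> prog" where
  "compile (FN a i e) = NAssign a i e"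
| "compile (FR a i e) = RAssign a i e"
| "compile (c ;; d) = Seq (compile c) (compile d)"
| "compile (FIf b c d) = Cond b (compile c) (compile d)"
| "compile (FFor x e c) = Seq (NAssign x (NConst 0) (NConst 0))
     (While (NLess (V x) e) (Seq (compile c) (NAssign x (NConst 0) (NAdd (V x) (NConst 1)))))"

primrec run :: "fprog \<Rightarrow> store \<Rightarrow> store" where
  "run (FN a i e) s = nwrite a (nval i s) (nval e s) s"
| "run (FR a i e) s = rwrite a (nval i s) (rval e s) s"
| "run (c ;; d) s = run d (run c s)"
| "run (FIf b c d) s = (if bval b s then run c s else run d s)"
| "run (FFor x e c) s =
     nwrite x 0 (nval e s) (fold (\<lambda>k t. run c (nwrite x 0 k t)) [0..<nval e s] s)"

primrec nmods :: "fprog \<Rightarrow> nat set" where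
  "nmods (FN a i e) = {a}"
| "nmods (FR a i e) = {}"
| "nmods (c ;; d) = nmods c \<union> nmods d"
| "nmods (FIf b c d) = nmods c \<union> nmods d"
| "nmods (FFor x e c) = insert x (nmods c)"

primrec rmods :: "fprog \<Rightarrow> nat set" where
  "rmods (FN a i e) = {}"
| "rmods (FR a i e) = {a}"
| "rmods (c ;; d) = rmods c \<union> rmods d"
| "rmods (FIf b c d) = rmods c \<union> rmods d"
| "rmods (FFor x e c) = rmods c"

text \<open>Loop bounds are polynomials in the input size, which is kept in cell 0 of array 0.\<close>

primrec bound_exp :: "nexp \<Rightarrow> bool" where
  "bound_exp (NConst k) \<longleftrightarrow> True"
| "bound_exp (NCell a i) \<longleftrightarrow> a = 0 \<and> i = NConst 0"
| "bound_exp (NAdd e f) \<longleftrightarrow> bound_exp e \<and> bound_exp f"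
| "bound_exp (NSub e f) \<longleftrightarrow> False"
| "bound_exp (NMul e f) \<longleftrightarrow> bound_exp e \<and> bound_exp f"

primrec bound_val :: "nat \<Rightarrow> nexp \<Rightarrow> nat" where
  "bound_val n (NConst k) = k"
| "bound_val n (NCell a i) = n"
| "bound_val n (NAdd e f) = bound_val n e + bound_val n f"
| "bound_val n (NSub e f) = 0"
| "bound_val n (NMul e f) = bound_val n e * bound_val n f"

text \<open>The compiled loop tests its bound anew before every round, whereas \<open>run\<close>
  evaluates it once. Both agree because bounds read only the input size, natural array 0 is never
  assigned, and the body leaves the counter alone.\<close>

primrec wf_prog :: "fprog \<Rightarrow> bool" where
  "wf_prog (FN a i e) \<longleftrightarrow> a \<noteq> 0"
| "wf_prog (FR a i e) \<longleftrightarrow> True"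
| "wf_prog (c ;; d) \<longleftrightarrow> wf_prog c \<and> wf_prog d"
| "wf_prog (FIf b c d) \<longleftrightarrow> wf_prog c \<and> wf_prog d"
| "wf_prog (FFor x e c) \<longleftrightarrow> x \<noteq> 0 \<and> bound_exp e \<and> x \<notin> nmods c \<and> wf_prog c"

text \<open>A conditional is charged for both branches, so that the bound depends on
  \<open>n\<close> alone. In a loop, 7 + \<open>ncost e\<close> pays for the initial assignment and
  the failing last test; each round pays \<open>ncost e\<close> + 4 for the test and 6 for the
  increment.\<close>

primrec time_bound :: "nat \<Rightarrow> fprog \<Rightarrow> nat" where
  "time_bound n (FN a i e) = 1 + ncost i + ncost e"
| "time_bound n (FR a i e) = 1 + ncost i + rcost e"
| "time_bound n (c ;; d) = time_bound n c + time_bound n d"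
| "time_bound n (FIf b c d) = 1 + bcost b + (time_bound n c + time_bound n d)"
| "time_bound n (FFor x e c) = 7 + ncost e + bound_val n e * (time_bound n c + ncost e + 10)"

lemma nats_nwrite [simp]:
  "nats (nwrite a i v s) b j = (if b = a \<and> j = i then v else nats s b j)"
  "nats (rwrite a i w s) = nats s"
  by (auto simp: nwrite_def rwrite_def)

lemma reals_rwrite [simp]:
  "reals (rwrite a i w s) b j = (if b = a \<and> j = i then w else reals s b j)"
  "reals (nwrite a i v s) = reals s"
  by (auto simp: nwrite_def rwrite_def)

lemma nats_nwrite_other: "b \<noteq> a \<Longrightarrow> nats (nwrite a i v s) b = nats s b"
  by (simp add: nwrite_def)

lemma reals_rwrite_other: "b \<noteq> a \<Longrightarrow> reals (rwrite a i v s) b = reals s b"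
  by (simp add: rwrite_def)

lemma fold_invariant_upt:
  assumes "P 0 s" "\<And>k t. k < K \<Longrightarrow> P k t \<Longrightarrow> P (Suc k) (f k t)"
  shows "P K (fold f [0..<K] s)"
  using assms by (induction K) auto

lemma run_frame:
  "(\<forall>a. a \<notin> nmods p \<longrightarrow> nats (run p s) a = nats s a) \<and>
   (\<forall>a. a \<notin> rmods p \<longrightarrow> reals (run p s) a = reals s a)"
proof (induction p arbitrary: s)
  case (FFor x e c)
  have "(\<forall>a. a \<notin> insert x (nmods c) \<longrightarrow> nats (fold (\<lambda>k t. run c (nwrite x 0 k t)) [0..<nval e s] s) a = nats s a) \<and>
   (\<forall>a. a \<notin> rmods c \<longrightarrow> reals (fold (\<lambda>k t. run c (nwrite x 0 k t)) [0..<nval e s] s) a = reals s a)"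
    by (rule fold_invariant_upt[where P="\<lambda>k t. (\<forall>a. a \<notin> insert x (nmods c) \<longrightarrow> nats t a = nats s a) \<and>
       (\<forall>a. a \<notin> rmods c \<longrightarrow> reals t a = reals s a)"]) (auto simp: FFor.IH nats_nwrite_other)
  then show ?case by (auto simp: nats_nwrite_other)
qed (auto simp: nats_nwrite_other reals_rwrite_other)

lemma run_nats: "a \<notin> nmods p \<Longrightarrow> nats (run p s) a = nats s a"
  and run_reals: "a \<notin> rmods p \<Longrightarrow> reals (run p s) a = reals s a"
  using run_frame by blast+

lemma wf_prog_input: "wf_prog p \<Longrightarrow> 0 \<notin> nmods p"
  by (induction p) auto

lemma nval_bound: "bound_exp e \<Longrightarrow> nval e s = bound_val (nats s 0 0) e"
  by (induction e) auto

lemma exec_compile: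
  "wf_prog p \<Longrightarrow> \<exists>t \<le> time_bound (nats s 0 0) p. exec (compile p) s t (run p s)"
proof (induction p arbitrary: s)
  case (FN a i e)
  then show ?case using exec.NAssign[of a i e s] by auto
next
  case (FR a i e)
  then show ?case using exec.RAssign[of a i e s] by auto
next
  case (FSeq c d)
  have n: "nats (run c s) 0 0 = nats s 0 0" using FSeq.prems wf_prog_input run_nats by simp
  obtain t u where "t \<le> time_bound (nats s 0 0) c" "exec (compile c) s t (run c s)"
    "u \<le> time_bound (nats s 0 0) d" "exec (compile d) (run c s) u (run d (run c s))"
    using FSeq.IH(1)[of s] FSeq.IH(2)[of "run c s"] FSeq.prems n by auto
  then have "exec (compile (c ;; d)) s (t + u) (run (c ;; d) s)" "t + u \<le> time_bound (nats s 0 0) (c ;; d)"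
    by (auto intro: exec.Seq)
  then show ?case by blast
next
  case (FIf b c d)
  then obtain t u where t: "t \<le> time_bound (nats s 0 0) c" "exec (compile c) s t (run c s)"
    "u \<le> time_bound (nats s 0 0) d" "exec (compile d) s u (run d s)"
    by (meson wf_prog.simps(4))
  show ?case
  proof (cases "bval b s")
    case True
    then have "exec (compile (FIf b c d)) s (1 + bcost b + t) (run (FIf b c d) s)"
      using exec.IfTrue[OF True t(2)] by simp
    moreover have "1 + bcost b + t \<le> time_bound (nats s 0 0) (FIf b c d)" using t by simp
    ultimately show ?thesis by blast
  next
    case False
    then have "exec (compile (FIf b c d)) s (1 + bcost b + u) (run (FIf b c d) s)"
      using exec.IfFalse[OF False t(4)] by simp
    moreover have "1 + bcost b + u \<le> time_bound (nats s 0 0) (FIf b c d)" using t by simp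
    ultimately show ?thesis by blast
  qed
next
  case (FFor x e c)
  define n where "n = nats s 0 0"
  define K where "K = bound_val n e"
  define st where "st k = fold (\<lambda>k t. run c (nwrite x 0 k t)) [0..<k] s" for k
  have wf: "x \<noteq> 0" "bound_exp e" "x \<notin> nmods c" "wf_prog c" using FFor.prems by auto
  have c0: "0 \<notin> nmods c" using wf wf_prog_input by blast
  have st_Suc: "st (Suc k) = run c (nwrite x 0 k (st k))" for k by (simp add: st_def)
  have stn: "nats (st k) 0 0 = n" for k
    by (induction k) (simp_all add: st_Suc run_nats[OF c0] wf(1), simp add: st_def n_def)
  define B where "B = time_bound n c"
  let ?b = "NLess (V x) e"
  let ?q = "Seq (compile c) (NAssign x (NConst 0) (NAdd (V x) (NConst 1)))"
  \<comment> \<open>Induction on the number \<open>j\<close> of remaining rounds, since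
    \<open>WhileTrue\<close> unfolds a loop from the front.\<close>
  have loop: "\<exists>t \<le> j * (B + ncost e + 10) + (ncost e + 4).
     exec (While ?b ?q) (nwrite x 0 (K - j) (st (K - j))) t (nwrite x 0 K (st K))" if "j \<le> K" for j
    using that
  proof (induction j)
    case 0
    have "\<not> bval ?b (nwrite x 0 K (st K))"
      using nval_bound[OF wf(2)] stn wf(1) by (simp add: K_def)
    from exec.WhileFalse[OF this, of ?q]
    have "exec (While ?b ?q) (nwrite x 0 K (st K)) (1 + bcost ?b) (nwrite x 0 K (st K))" .
    then show ?case by (intro exI[of _ "1 + bcost ?b"]) simp
  next
    case (Suc j)
    define k where "k = K - Suc j"
    have k: "k < K" "K - j = Suc k" "K - Suc j = k" using Suc.prems by (auto simp: k_def)
    let ?t = "nwrite x 0 k (st k)"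
    have b: "bval ?b ?t" using nval_bound[OF wf(2)] stn wf(1) k(1) by (simp add: K_def)
    have "nats ?t 0 0 = n" using stn wf(1) by simp
    then obtain t where t: "t \<le> B" "exec (compile c) ?t t (st (Suc k))"
      using FFor.IH[OF wf(4), of ?t] by (auto simp: B_def st_Suc)
    have x: "nats (st (Suc k)) x 0 = k" by (simp add: st_Suc run_nats[OF wf(3)])
    have "exec (NAssign x (NConst 0) (NAdd (V x) (NConst 1))) (st (Suc k)) 6
        (nwrite x 0 (Suc k) (st (Suc k)))"
      using exec.NAssign[of x "NConst 0" "NAdd (V x) (NConst 1)" "st (Suc k)"] x
      by (simp add: eval_nat_numeral)
    from exec.Seq[OF t(2) this] have body: "exec ?q ?t (t + 6) (nwrite x 0 (Suc k) (st (Suc k)))" .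
    obtain u where u: "u \<le> j * (B + ncost e + 10) + (ncost e + 4)"
      "exec (While ?b ?q) (nwrite x 0 (Suc k) (st (Suc k))) u (nwrite x 0 K (st K))"
      using Suc.IH Suc.prems k(2) by auto
    from exec.WhileTrue[OF b body u(2)]
    have "exec (While ?b ?q) ?t (1 + bcost ?b + (t + 6) + u) (nwrite x 0 K (st K))" .
    moreover have "1 + bcost ?b + (t + 6) + u \<le> Suc j * (B + ncost e + 10) + (ncost e + 4)"
      using t(1) u(1) by simp
    ultimately show ?case using k(3) by metis
  qed
  have st0: "st 0 = s" by (simp add: st_def)
  from loop[of K] obtain t where t: "t \<le> K * (B + ncost e + 10) + (ncost e + 4)"
    "exec (While ?b ?q) (nwrite x 0 0 s) t (nwrite x 0 K (st K))" by (auto simp: st0)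
  have "exec (NAssign x (NConst 0) (NConst 0)) s 3 (nwrite x 0 0 s)"
    using exec.NAssign[of x "NConst 0" "NConst 0" s] by (simp add: eval_nat_numeral)
  from exec.Seq[OF this t(2)] have "exec (compile (FFor x e c)) s (3 + t) (nwrite x 0 K (st K))" by simp
  moreover have "nwrite x 0 K (st K) = run (FFor x e c) s"
    using nval_bound[OF wf(2), of s] by (simp add: st_def K_def n_def)
  moreover have "3 + t \<le> time_bound (nats s 0 0) (FFor x e c)"
    using t(1) by (simp add: B_def n_def K_def)
  ultimately show ?case by metis
qed

section \<open>Polynomial degrees of running times\<close>

primrec bound_deg :: "nexp \<Rightarrow> nat" where
  "bound_deg (NConst k) = 0"
| "bound_deg (NCell a i) = 1"
| "bound_deg (NAdd e f) = max (bound_deg e) (bound_deg f)"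
| "bound_deg (NSub e f) = 0"
| "bound_deg (NMul e f) = bound_deg e + bound_deg f"

primrec deg :: "fprog \<Rightarrow> nat" where
  "deg (FN a i e) = 0"
| "deg (FR a i e) = 0"
| "deg (c ;; d) = max (deg c) (deg d)"
| "deg (FIf b c d) = max (deg c) (deg d)"
| "deg (FFor x e c) = bound_deg e + deg c"

text \<open>For \<open>n \<ge> 1\<close> powers grow with the exponent, so the constant of the
  higher power absorbs the lower one.\<close>

lemma power_sum_le_max:
  fixes n :: nat
  assumes "n \<ge> 1" "x \<le> C * n ^ k" "y \<le> D * n ^ l"
  shows "x + y \<le> (C + D) * n ^ max k l"
proof -
  have "n ^ k \<le> n ^ max k l" "n ^ l \<le> n ^ max k l" using assms by (auto intro: power_increasing)
  then have "C * n ^ k \<le> C * n ^ max k l" "D * n ^ l \<le> D * n ^ max k l" by (simp_all only: mult_le_mono2)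
  then show ?thesis using assms(2,3) unfolding add_mult_distrib by linarith
qed

lemma bound_val_le: "\<exists>C. \<forall>n\<ge>1. bound_val n e \<le> C * n ^ bound_deg e"
proof (induction e)
  case (NConst k)
  then show ?case by (intro exI[of _ k]) simp
next
  case (NCell a i)
  then show ?case by (intro exI[of _ 1]) simp
next
  case (NAdd e f)
  then obtain C D where "\<forall>n\<ge>1. bound_val n e \<le> C * n ^ bound_deg e" "\<forall>n\<ge>1. bound_val n f \<le> D * n ^ bound_deg f"
    by auto
  then show ?case by (intro exI[of _ "C + D"]) (auto intro!: power_sum_le_max)
next
  case (NMul e f)
  then obtain C D where "\<forall>n\<ge>1. bound_val n e \<le> C * n ^ bound_deg e" "\<forall>n\<ge>1. bound_val n f \<le> D * n ^ bound_deg f"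
    by auto
  then have "\<forall>n\<ge>1. bound_val n e * bound_val n f \<le> (C * n ^ bound_deg e) * (D * n ^ bound_deg f)"
    by (auto intro: mult_mono)
  then show ?case by (intro exI[of _ "C * D"]) (auto simp: power_add algebra_simps)
qed auto

lemma time_bound_le: "\<exists>C. \<forall>n\<ge>1. time_bound n p \<le> C * n ^ deg p"
proof (induction p)
  case (FSeq c d)
  then obtain C D where "\<forall>n\<ge>1. time_bound n c \<le> C * n ^ deg c" "\<forall>n\<ge>1. time_bound n d \<le> D * n ^ deg d"
    by auto
  then show ?case by (intro exI[of _ "C + D"]) (auto intro!: power_sum_le_max)
next
  case (FIf b c d)
  then obtain C D where CD: "\<forall>n\<ge>1. time_bound n c \<le> C * n ^ deg c" "\<forall>n\<ge>1. time_bound n d \<le> D * n ^ deg d"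
    by auto
  have "time_bound n (FIf b c d) \<le> ((1 + bcost b) + (C + D)) * n ^ max 0 (max (deg c) (deg d))" if "n \<ge> 1" for n
    unfolding time_bound.simps using that CD by (intro power_sum_le_max) auto
  then show ?case unfolding deg.simps max_0L by blast
next
  case (FFor x e c)
  then obtain C D where C: "\<forall>n\<ge>1. time_bound n c \<le> C * n ^ deg c" and D: "\<forall>n\<ge>1. bound_val n e \<le> D * n ^ bound_deg e"
    using bound_val_le by meson
  let ?k = "ncost e"
  have "time_bound n (FFor x e c) \<le> ((7 + ?k) + D * (C + (?k + 10))) * n ^ max 0 (bound_deg e + deg c)" if n: "n \<ge> 1" for n
  proof -
    have "time_bound n c + (?k + 10) \<le> (C + (?k + 10)) * n ^ max (deg c) 0"
      using n C by (intro power_sum_le_max) auto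
    then have "bound_val n e * (time_bound n c + (?k + 10)) \<le> (D * n ^ bound_deg e) * ((C + (?k + 10)) * n ^ deg c)"
      using D n by (intro mult_mono) auto
    then show ?thesis unfolding time_bound.simps using n
      by (intro power_sum_le_max) (auto simp: power_add algebra_simps)
  qed
  then show ?case unfolding deg.simps max_0L by blast
next
  case (FN a i e)
  show ?case by (intro exI[of _ "1 + ncost i + ncost e"]) simp
next
  case (FR a i e)
  show ?case by (intro exI[of _ "1 + ncost i + rcost e"]) simp
qed

lemma time_bound_bigo:
  assumes "deg p \<le> k"
  shows "(\<lambda>n. real (time_bound n p)) \<in> O(\<lambda>n. real n ^ k)"
proof -
  obtain C where C: "\<forall>n\<ge>1. time_bound n p \<le> C * n ^ deg p" using time_bound_le by blast
  have "norm (real (time_bound n p)) \<le> real C * norm (real n ^ k)" if "n \<ge> 1" for n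
  proof -
    have "time_bound n p \<le> C * n ^ k"
      using C that assms by (meson le_trans mult_le_mono2 power_increasing)
    then show ?thesis by (simp flip: of_nat_power of_nat_mult)
  qed
  then show ?thesis by (intro bigoI[of _ "real C"]) (auto simp: eventually_at_top_linorder)
qed

text \<open>Two-dimensional arrays are indexed by a pairing function that needs no division.\<close>

definition pr :: "nat \<Rightarrow> nat \<Rightarrow> nat" where
  "pr p q = (p + q) * (p + q) + q"

text \<open>The value lies between the square of \<open>p + q\<close> and the next square, so it
  determines \<open>p + q\<close>, and \<open>q\<close> is what remains.\<close>

lemma pr_eq_iff [simp]: "pr p q = pr p' q' \<longleftrightarrow> p = p' \<and> q = q'"
proof -
  have *: "pr p q < pr p' q'" if "p + q < p' + q'" for p q p' q'
  proof -
    have "pr p q < Suc (p + q) * Suc (p + q)" by (simp add: pr_def)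
    also have "\<dots> \<le> (p' + q') * (p' + q')" using that by (intro mult_mono) auto
    also have "\<dots> \<le> pr p' q'" by (simp add: pr_def)
    finally show ?thesis .
  qed
  show ?thesis
  proof
    assume eq: "pr p q = pr p' q'"
    then have "p + q = p' + q'" using *[of p q p' q'] *[of p' q' p q] by (metis less_irrefl linorder_less_linear)
    then show "p = p' \<and> q = q'" using eq by (simp add: pr_def)
  qed simp
qed

definition NPr :: "nexp \<Rightarrow> nexp \<Rightarrow> nexp" where
  "NPr e f = NAdd (NMul (NAdd e f) (NAdd e f)) f"

lemma nval_NPr [simp]: "nval (NPr e f) s = pr (nval e s) (nval f s)"
  by (simp add: NPr_def pr_def)

text \<open>The arrays that a body can change are read off its syntax, so the frame conditions come
  for free and an invariant need only mention what the loop writes. It is stated for the store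
  before the counter is set.\<close>

lemma run_For:
  assumes "I 0 s"
    and "\<And>k t. k < nval e s \<Longrightarrow> (\<And>a. a \<notin> insert x (nmods c) \<Longrightarrow> nats t a = nats s a) \<Longrightarrow>
      (\<And>a. a \<notin> rmods c \<Longrightarrow> reals t a = reals s a) \<Longrightarrow> I k t \<Longrightarrow> I (Suc k) (run c (nwrite x 0 k t))"
    and "\<And>t. I (nval e s) t \<Longrightarrow> Q (nwrite x 0 (nval e s) t)"
  shows "Q (run (FFor x e c) s)"
proof -
  let ?P = "\<lambda>k t. (\<forall>a. a \<notin> insert x (nmods c) \<longrightarrow> nats t a = nats s a) \<and>
      (\<forall>a. a \<notin> rmods c \<longrightarrow> reals t a = reals s a) \<and> I k t"
  have "?P (nval e s) (fold (\<lambda>k t. run c (nwrite x 0 k t)) [0..<nval e s] s)"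
    by (rule fold_invariant_upt[where P="?P"]) (use assms(1,2) in \<open>auto simp: run_nats run_reals nats_nwrite_other\<close>)
  then show ?thesis using assms(3) by simp
qed

section \<open>Polygonal chains in an arrangement\<close>

text \<open>The distance is a parameter because the same sum serves for Euclidean length, for
  distances inside a hull and for weights on vertex numbers.\<close>

fun dsum :: "('a \<Rightarrow> 'a \<Rightarrow> real) \<Rightarrow> 'a list \<Rightarrow> real" where
  "dsum d (x # y # zs) = d x y + dsum d (y # zs)"
| "dsum d _ = 0"

abbreviation plen :: "'a::metric_space list \<Rightarrow> real" where
  "plen \<equiv> dsum dist"

fun pcurve :: "'a::real_vector list \<Rightarrow> 'a set" where
  "pcurve [] = {}"
| "pcurve [x] = {x}"
| "pcurve (x # y # zs) = closed_segment x y \<union> pcurve (y # zs)"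

lemma plen_nonneg: "0 \<le> plen xs"
  by (induction xs rule: induct_list012) auto

lemma dsum_append: "dsum d (xs @ x # ys) = dsum d (xs @ [x]) + dsum d (x # ys)"
proof (induction xs rule: induct_list012)
  case (2 v)
  then show ?case by (cases ys) auto
qed auto

lemma dsum_snoc: "xs \<noteq> [] \<Longrightarrow> dsum d (xs @ [x]) = dsum d xs + d (last xs) x"
  by (induction xs rule: induct_list012) auto

lemma dsum_Cons: "xs \<noteq> [] \<Longrightarrow> dsum d (x # xs) = d x (hd xs) + dsum d xs"
  by (cases xs) auto

lemma plen_rev: "plen (rev xs) = plen xs"
proof (induction xs rule: induct_list012)
  case (3 x y zs)
  have "plen (rev (x # y # zs)) = plen (rev zs @ y # [x])" by simp
  also have "\<dots> = plen (rev zs @ [y]) + dist y x" by (subst dsum_append) simp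
  finally show ?case using 3(2) by (simp add: dist_commute)
qed auto

definition cyc :: "('a \<Rightarrow> 'a \<Rightarrow> real) \<Rightarrow> 'a list \<Rightarrow> real" where
  "cyc d xs = dsum d (xs @ [hd xs])"

lemma cyc_rotate: "cyc d (xs @ ys) = cyc d (ys @ xs)"
proof (cases "xs = [] \<or> ys = []")
  case False
  then obtain a as b bs where "xs = a # as" "ys = b # bs" by (meson neq_Nil_conv)
  moreover have "dsum d ((a # as) @ b # (bs @ [a])) = dsum d ((b # bs) @ a # (as @ [b]))"
    by (subst (1 2) dsum_append) simp
  ultimately show ?thesis by (simp add: cyc_def)
qed auto

lemma route_length_eq: "ps \<noteq> [] \<Longrightarrow> route_length ps = cyc dist ps"
proof -
  have "(\<Sum>(p, q) \<leftarrow> zip (x # xs) (xs @ [z]). dist p q) = plen (x # xs @ [z])" for x z :: "real \<times> real" and xs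
    by (induction xs arbitrary: x) auto
  then show "ps \<noteq> [] \<Longrightarrow> route_length ps = cyc dist ps"
    by (cases ps) (simp_all add: route_length_def edges_def cyc_def)
qed

lemma curve_eq: "ps \<noteq> [] \<Longrightarrow> curve ps = pcurve (ps @ [hd ps])"
proof -
  have "(\<Union>(p, q) \<in> set (zip (x # xs) (xs @ [z])). closed_segment p q) = pcurve (x # xs @ [z])"
    for x z :: "real \<times> real" and xs
    by (induction xs arbitrary: x) auto
  then show "ps \<noteq> [] \<Longrightarrow> curve ps = pcurve (ps @ [hd ps])"
    by (cases ps) (simp_all add: curve_def edges_def)
qed

lemma set_subset_pcurve: "set xs \<subseteq> pcurve xs"
  by (induction xs rule: pcurve.induct) auto

lemma pcurve_subset_convex: "convex H \<Longrightarrow> set xs \<subseteq> H \<Longrightarrow> pcurve xs \<subseteq> H"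
  proof (induction xs rule: pcurve.induct)
  case (3 x y zs)
  then show ?case using closed_segment_subset[of x H y] by simp
qed auto

lemma path_connected_pcurve:
  fixes xs :: "'a::real_normed_vector list"
  shows "path_connected (pcurve xs)"
proof (induction xs rule: pcurve.induct)
  case (3 x y zs)
  have "y \<in> closed_segment x y \<inter> pcurve (y # zs)" using set_subset_pcurve[of "y # zs"] by auto
  then show ?case using 3 unfolding pcurve.simps
    by (intro path_connected_Un) (auto simp: convex_imp_path_connected)
qed auto

lemma pcurve_rev: "pcurve (rev xs) = pcurve xs"
proof -
  have app: "pcurve (xs @ [y, x]) = pcurve (xs @ [y]) \<union> closed_segment y x" for xs and x y :: 'a
  proof (induction xs rule: pcurve.induct)
    case 1
    then show ?case by auto
  next
    case (2 x)
    then show ?case by auto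
  qed auto
  show ?thesis
  proof (induction xs rule: pcurve.induct)
    case (3 x y zs)
    have "pcurve (rev (x # y # zs)) = pcurve (rev zs @ [y, x])" by simp
    also have "\<dots> = pcurve (rev zs @ [y]) \<union> closed_segment y x" by (rule app)
    finally show ?case using 3 by (simp add: closed_segment_commute Un_commute)
  qed auto
qed

text \<open>Two points that can be joined along one line. Lists with this relation between
  neighbours are the combinatorial form of polygonal curves that stay in the union of the
  lines.\<close>

definition share :: "'a set set \<Rightarrow> 'a \<Rightarrow> 'a \<Rightarrow> bool" where
  "share \<L> x y \<longleftrightarrow> (\<exists>L\<in>\<L>. x \<in> L \<and> y \<in> L)"

lemma share_commute: "share \<L> x y \<longleftrightarrow> share \<L> y x"
  by (auto simp: share_def)

abbreviation chain :: "'a set set \<Rightarrow> 'a list \<Rightarrow> bool" where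
  "chain \<L> \<equiv> successively (share \<L>)"

lemma chain_rev: "chain \<L> (rev xs) \<longleftrightarrow> chain \<L> xs"
  unfolding successively_rev by (rule successively_cong) (simp_all add: share_commute)

definition vertices :: "'a set set \<Rightarrow> 'a set" where
  "vertices \<L> = {z. \<exists>L\<in>\<L>. \<exists>M\<in>\<L>. L \<noteq> M \<and> z \<in> L \<and> z \<in> M}"

lemma chain_append_last:
  "chain \<L> (xs @ x # ys) \<longleftrightarrow> chain \<L> (xs @ [x]) \<and> chain \<L> (x # ys)"
  by (cases xs rule: rev_cases) (auto simp: successively_append_iff)

text \<open>Splitting a segment at one of its points keeps length, curve and ends, and by convexity
  both halves stay on the line. Thus any point of a curve may be assumed to be one of its
  vertices.\<close>

lemma chain_insert:
  fixes xs :: "'a::euclidean_space list"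
  assumes "\<forall>L\<in>\<L>. convex L" "chain \<L> xs" "z \<in> pcurve xs"
  shows "\<exists>us vs. chain \<L> (us @ z # vs) \<and> plen (us @ z # vs) = plen xs \<and>
    pcurve (us @ z # vs) = pcurve xs \<and> hd (us @ z # vs) = hd xs \<and> last (us @ z # vs) = last xs \<and>
    set (us @ z # vs) = insert z (set xs)"
  using assms(2,3)
proof (induction xs rule: pcurve.induct)
  case (2 x)
  then show ?case by (intro exI[of _ "[]"] exI[of _ "[]"]) auto
next
  case (3 x y zs)
  show ?case
  proof (cases "z \<in> closed_segment x y")
    case True
    obtain L where L: "L \<in> \<L>" "x \<in> L" "y \<in> L" using "3.prems"(1) by (auto simp: share_def)
    then have "z \<in> L" using True assms(1) by (meson closed_segment_subset subset_iff)
    then have "share \<L> x z" "share \<L> z y" using L by (auto simp: share_def)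
    moreover have "dist x z + dist z y = dist x y"
      using True by (metis between between_mem_segment)
    moreover have "closed_segment x z \<union> closed_segment z y = closed_segment x y"
      using True by (rule Un_closed_segment)
    ultimately have "chain \<L> ([x] @ z # y # zs) \<and> plen ([x] @ z # y # zs) = plen (x # y # zs) \<and>
      pcurve ([x] @ z # y # zs) = pcurve (x # y # zs)"
      using "3.prems"(1) by (simp flip: Un_assoc)
    moreover have "hd ([x] @ z # y # zs) = hd (x # y # zs)" "last ([x] @ z # y # zs) = last (x # y # zs)"
      "set ([x] @ z # y # zs) = insert z (set (x # y # zs))" by auto
    ultimately show ?thesis by blast
  next
    case False
    then have "z \<in> pcurve (y # zs)" "chain \<L> (y # zs)" using "3.prems" by simp_all
    then obtain us vs where IH: "chain \<L> (us @ z # vs)" "plen (us @ z # vs) = plen (y # zs)"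
      "pcurve (us @ z # vs) = pcurve (y # zs)" "hd (us @ z # vs) = y" "last (us @ z # vs) = last (y # zs)"
      "set (us @ z # vs) = insert z (set (y # zs))"
      using "3.IH" by auto
    obtain w ws where w: "us @ z # vs = w # ws" by (cases us) auto
    have "w = y" using IH(4) w by simp
    then have "chain \<L> (x # us @ z # vs) \<and> plen (x # us @ z # vs) = plen (x # y # zs) \<and>
      pcurve (x # us @ z # vs) = pcurve (x # y # zs)"
      using IH(1-3) "3.prems"(1) unfolding w by simp
    moreover have "last (x # us @ z # vs) = last (x # y # zs)" using IH(5) by simp
    moreover have "set (x # us @ z # vs) = insert z (set (x # y # zs))" using IH(6) by auto
    ultimately show ?thesis by (intro exI[of _ "x # us"] exI[of _ vs]) (simp only: append_Cons list.sel(1) simp_thms)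
  qed
qed auto

lemma chain_insert_set:
  fixes xs :: "'a::euclidean_space list"
  assumes "\<forall>L\<in>\<L>. convex L" "chain \<L> xs" "finite S" "S \<subseteq> pcurve xs"
  shows "\<exists>ys. chain \<L> ys \<and> plen ys = plen xs \<and> pcurve ys = pcurve xs \<and> hd ys = hd xs \<and>
    last ys = last xs \<and> set ys = S \<union> set xs"
  using assms(3,4)
proof (induction S)
  case empty
  then show ?case using assms(2) by (intro exI[of _ xs]) auto
next
  case (insert z S)
  then obtain ys where ys: "chain \<L> ys" "plen ys = plen xs" "pcurve ys = pcurve xs" "hd ys = hd xs"
    "last ys = last xs" "set ys = S \<union> set xs" by auto
  have "z \<in> pcurve ys" using insert.prems ys(3) by auto
  from chain_insert[OF assms(1) ys(1) this] obtain us vs where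
    "chain \<L> (us @ z # vs) \<and> plen (us @ z # vs) = plen ys \<and> pcurve (us @ z # vs) = pcurve ys \<and>
     hd (us @ z # vs) = hd ys \<and> last (us @ z # vs) = last ys \<and> set (us @ z # vs) = insert z (set ys)" by blast
  then show ?case using ys(2-6) by (intro exI[of _ "us @ z # vs"]) (simp only: Un_insert_left simp_thms)
qed

text \<open>Only one line passes through a point that is not a crossing, so both neighbours lie on
  it and the point can be bypassed.\<close>

lemma share_trans_nonvertex:
  assumes "a \<notin> vertices \<L>" "share \<L> x a" "share \<L> a y"
  shows "share \<L> x y"
proof -
  obtain L M where "L \<in> \<L>" "x \<in> L" "a \<in> L" "M \<in> \<L>" "a \<in> M" "y \<in> M"
    using assms(2,3) by (auto simp: share_def)
  moreover from this have "L = M" using assms(1) by (auto simp: vertices_def)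
  ultimately show ?thesis by (auto simp: share_def)
qed

text \<open>Each point that is not a crossing is bypassed on its own line, which by the triangle
  inequality is no detour. The end must be a crossing so that every removed point has a successor.
  The induction is on length because a removal leaves a list that is not a tail of the old
  one.\<close>

lemma chain_filter_vertices:
  fixes xs :: "'a::metric_space list"
  assumes "chain \<L> (x # xs)" "last (x # xs) \<in> vertices \<L>"
  shows "chain \<L> (x # filter (\<lambda>z. z \<in> vertices \<L>) xs) \<and>
    plen (x # filter (\<lambda>z. z \<in> vertices \<L>) xs) \<le> plen (x # xs)"
  using assms
proof (induction "length xs" arbitrary: x xs rule: less_induct)
  case less
  show ?case
  proof (cases xs)
    case Nil
    then show ?thesis by simp
  next
    case (Cons y zs)
    show ?thesis
    proof (cases "y \<in> vertices \<L>")
      case True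
      have "share \<L> x y" "chain \<L> (y # zs)" "last (y # zs) \<in> vertices \<L>"
        using less.prems Cons by simp_all
      then show ?thesis using less.hyps[of zs y] Cons True by simp
    next
      case False
      then obtain z zs' where zs: "zs = z # zs'" using less.prems(2) Cons by (cases zs) auto
      have "share \<L> x z" using less.prems(1) Cons zs False share_trans_nonvertex[of y \<L> x z] by simp
      then have "chain \<L> (x # filter (\<lambda>z. z \<in> vertices \<L>) zs) \<and>
        plen (x # filter (\<lambda>z. z \<in> vertices \<L>) zs) \<le> plen (x # zs)"
        using less.prems Cons zs by (intro less.hyps) simp_all
      moreover have "plen (x # zs) \<le> plen (x # xs)"
        using Cons zs dist_triangle[of x z y] by simp
      ultimately show ?thesis using Cons False by simp
    qed
  qed
qed

lemma nonvertex_line_unique: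
  assumes "a \<notin> vertices \<L>" "a \<in> L" "L \<in> \<L>" "share \<L> a b"
  shows "b \<in> L"
  using assms unfolding share_def vertices_def by blast

lemma chain_nonvertex_line:
  assumes "chain \<L> (a # xs)" "set (a # xs) \<inter> vertices \<L> = {}" "a \<in> L" "L \<in> \<L>"
  shows "set (a # xs) \<subseteq> L"
  using assms
proof (induction xs arbitrary: a)
  case (Cons b xs)
  have "b \<in> L" using nonvertex_line_unique[of a \<L> L b] Cons.prems by simp
  then show ?case using Cons.IH[of b] Cons.prems by simp
qed simp

text \<open>A chain can leave the line on which it starts only at a crossing, so the first crossing
  that it meets still lies on that line.\<close>

lemma chain_vertex_on_line:
  assumes "chain \<L> (a # xs)" "set (a # xs) \<inter> vertices \<L> \<noteq> {}" "a \<in> L" "L \<in> \<L>"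
  shows "\<exists>z\<in>set (a # xs). z \<in> vertices \<L> \<and> z \<in> L"
  using assms
proof (induction xs arbitrary: a)
  case (Cons b xs)
  show ?case
  proof (cases "a \<in> vertices \<L>")
    case True
    then show ?thesis using Cons.prems(3) by simp
  next
    case False
    then have "b \<in> L" using nonvertex_line_unique[of a \<L> L b] Cons.prems by simp
    moreover have "set (b # xs) \<inter> vertices \<L> \<noteq> {}" using Cons.prems(2) False by simp
    ultimately show ?thesis using Cons.IH[of b] Cons.prems by simp
  qed
qed simp

text \<open>Pigeonhole: an infinite segment covered by finitely many affine sets meets one of them
  in two points, and that set then contains the whole line through the segment.\<close>

lemma segment_in_finite_union_affine:
  fixes x y :: "'a::euclidean_space"
  assumes "finite \<L>" "\<forall>L\<in>\<L>. affine L" "closed_segment x y \<subseteq> \<Union>\<L>"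
  shows "share \<L> x y"
proof (cases "x = y")
  case True
  then show ?thesis using assms(3) by (auto simp: share_def)
next
  case False
  then have "infinite (closed_segment x y)" by (simp add: finite_closed_segment)
  moreover have "closed_segment x y = (\<Union>L\<in>\<L>. closed_segment x y \<inter> L)" using assms(3) by auto
  ultimately obtain L where L: "L \<in> \<L>" "infinite (closed_segment x y \<inter> L)"
    using assms(1) finite_UN_I[of \<L> "\<lambda>L. closed_segment x y \<inter> L"] by fastforce
  then obtain p where p: "p \<in> closed_segment x y" "p \<in> L" using infinite_imp_nonempty by blast
  obtain q where q: "q \<in> closed_segment x y" "q \<in> L" "q \<noteq> p"
  proof -
    have "\<not> closed_segment x y \<inter> L \<subseteq> {p}" using L(2) finite_subset by blast
    then show ?thesis using that by blast
  qed
  obtain s where s: "p = x + s *\<^sub>R (y - x)" using p by (auto simp: in_segment algebra_simps)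
  obtain t where t: "q = x + t *\<^sub>R (y - x)" using q by (auto simp: in_segment algebra_simps)
  have st: "t \<noteq> s" using s t q by auto
  have line: "x + r *\<^sub>R (y - x) \<in> L" for r
  proof -
    define k where "k = (r - s) / (t - s)"
    have "(1 - k) *\<^sub>R p + k *\<^sub>R q \<in> L" using assms(2) L(1) p q mem_affine[of L p q "1 - k" k] by simp
    moreover have "(1 - k) *\<^sub>R p + k *\<^sub>R q = x + (s + k * (t - s)) *\<^sub>R (y - x)"
      by (simp add: s t algebra_simps)
    moreover have "s + k * (t - s) = r" using st by (simp add: k_def)
    ultimately show ?thesis by metis
  qed
  have "x \<in> L" "y \<in> L" using line[of 0] line[of 1] by auto
  then show ?thesis using L(1) by (auto simp: share_def)
qed

lemma chain_of_pcurve: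
  fixes xs :: "'a::euclidean_space list"
  assumes "finite \<L>" "\<forall>L\<in>\<L>. affine L" "pcurve xs \<subseteq> \<Union>\<L>"
  shows "chain \<L> xs"
  using assms(3) by (induction xs rule: pcurve.induct)
    (auto intro: segment_in_finite_union_affine[OF assms(1,2)])

section \<open>Extreme points in sorted directions\<close>

definition crs :: "real \<times> real \<Rightarrow> real \<times> real \<Rightarrow> real" where
  "crs p q = fst p * snd q - snd p * fst q"

definition orient :: "real \<times> real \<Rightarrow> real \<times> real \<Rightarrow> real \<times> real \<Rightarrow> real" where
  "orient p q r = crs (q - p) (r - p)"

definition dir :: "real \<Rightarrow> real \<times> real" where
  "dir t = (cos t, sin t)"

lemma crs_dir: "crs (dir s) (dir t) = sin (t - s)"
  by (simp add: crs_def dir_def sin_diff algebra_simps)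

lemma dir_add_2pi [simp]: "dir (t + 2 * pi) = dir t"
  by (simp add: dir_def)

text \<open>With the middle one of three points as origin, \<open>h1\<close> and \<open>h3\<close>
  are depths below it and \<open>x1\<close>, \<open>x3\<close> horizontal positions; the claim
  compares the slopes \<open>x1 / h1\<close> and \<open>x3 / h3\<close>. Under the contrary
  assumption one of these slopes, taken as \<open>r\<close>, violates an inequality on the
  difference of the two points.\<close>

lemma slope_compare:
  fixes x1 :: real
  assumes h: "h1 > 0" "h3 > 0"
    and "x1 > k1 * h1" "x3 < k3 * h3" "x1 - x3 > k1 * (h1 - h3)" "x1 - x3 > k3 * (h1 - h3)"
  shows "x1 * h3 > x3 * h1"
proof (rule ccontr)
  assume "\<not> x1 * h3 > x3 * h1"
  then have le: "x1 * h3 \<le> x3 * h1" by simp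
  show False
  proof (cases "h1 \<ge> h3")
    case True
    define r where "r = x3 / h3"
    have r: "x3 = r * h3" "x1 \<le> r * h1" using h le by (auto simp: r_def field_simps)
    have "r < k3" using assms(4) h r(1) by simp
    then have "r * (h1 - h3) \<le> k3 * (h1 - h3)" using True by (intro mult_right_mono) auto
    moreover have "x1 - x3 \<le> r * (h1 - h3)" using r by (simp add: algebra_simps)
    ultimately show False using assms(6) by linarith
  next
    case False
    define r where "r = x1 / h1"
    have r: "x1 = r * h1" "x3 \<ge> r * h3" using h le by (auto simp: r_def field_simps)
    have "r > k1" using assms(3) h r(1) by simp
    then have "r * (h1 - h3) \<le> k1 * (h1 - h3)" using False by (intro mult_right_mono_neg) auto
    moreover have "x1 - x3 \<le> r * (h1 - h3)" using r by (simp add: algebra_simps)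
    ultimately show False using assms(5) by linarith
  qed
qed

text \<open>Coordinates are taken along \<open>u2\<close> and its clockwise normal \<open>e\<close>,
  with origin \<open>v2\<close>. Resolving \<open>u1\<close> and \<open>u3\<close> in this basis
  turns the extremality conditions into the hypotheses of \<open>slope_compare\<close>, whose
  conclusion is the sign of the orientation scaled by \<open>N\<close>.\<close>

lemma orient_extreme_points_half:
  assumes c: "crs u1 u2 > 0" "crs u2 u3 > 0"
    and u1: "u1 \<bullet> (v1 - v2) > 0" "u1 \<bullet> (v1 - v3) > 0"
    and u2: "u2 \<bullet> (v2 - v1) > 0" "u2 \<bullet> (v2 - v3) > 0"
    and u3: "u3 \<bullet> (v3 - v1) > 0" "u3 \<bullet> (v3 - v2) > 0"
  shows "orient v1 v2 v3 > 0"
proof -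
  define N where "N = u2 \<bullet> u2"
  have "u2 \<noteq> 0" using u2 by auto
  then have N: "N > 0" by (simp add: N_def)
  define e where "e = (snd u2, - fst u2)"
  define h1 h3 x1 x3 where "h1 = u2 \<bullet> (v2 - v1)" and "h3 = u2 \<bullet> (v2 - v3)"
    and "x1 = e \<bullet> (v1 - v2)" and "x3 = e \<bullet> (v3 - v2)"
  define b1 b3 where "b1 = crs u1 u2" and "b3 = crs u2 u3"
  define k1 k3 where "k1 = (u1 \<bullet> u2) / b1" and "k3 = - (u3 \<bullet> u2) / b3"
  have b: "b1 > 0" "b3 > 0" using c by (auto simp: b1_def b3_def)
  have k: "k1 * b1 = u1 \<bullet> u2" "k3 * b3 = - (u3 \<bullet> u2)" using b by (auto simp: k1_def k3_def)
  have e1: "N * (u1 \<bullet> (v1 - v2)) = b1 * (x1 - k1 * h1)"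
    and e2: "N * (u3 \<bullet> (v3 - v2)) = b3 * (k3 * h3 - x3)"
    and e3: "N * (u1 \<bullet> (v1 - v3)) = b1 * ((x1 - x3) - k1 * (h1 - h3))"
    and e4: "N * (u3 \<bullet> (v3 - v1)) = b3 * ((x1 - x3) - k3 * (h1 - h3))"
    by (simp_all add: right_diff_distrib mult.assoc[symmetric] mult.commute[of b1 k1] mult.commute[of b3 k3] k)
      (simp_all add: N_def b1_def b3_def x1_def x3_def h1_def h3_def e_def crs_def inner_prod_def algebra_simps)
  have "h1 > 0" "h3 > 0" using u2 by (auto simp: h1_def h3_def)
  moreover have "x1 > k1 * h1" "x3 < k3 * h3" "x1 - x3 > k1 * (h1 - h3)" "x1 - x3 > k3 * (h1 - h3)"
    using u1 u3 N b e1 e2 e3 e4 by (metis mult_pos_pos zero_less_mult_pos diff_gt_0_iff_gt)+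
  ultimately have "x1 * h3 > x3 * h1" by (rule slope_compare)
  moreover have "N * orient v1 v2 v3 = x1 * h3 - x3 * h1"
    by (simp add: orient_def N_def x1_def x3_def h1_def h3_def e_def crs_def inner_prod_def algebra_simps)
  ultimately show ?thesis using N by (metis diff_gt_0_iff_gt zero_less_mult_pos)
qed

lemma orient_rotate: "orient p q r = orient q r p"
  by (simp add: orient_def crs_def algebra_simps)

text \<open>The three gaps are positive and add up to \<open>2 * pi\<close>, so at least two of them
  are below \<open>pi\<close>. After a rotation of the triple these two are consecutive, and the
  previous lemma on two gaps applies.\<close>

lemma orient_extreme_points:
  assumes t: "t1 < t2" "t2 < t3" "t3 < t1 + 2 * pi"
    and u1: "dir t1 \<bullet> (v1 - v2) > 0" "dir t1 \<bullet> (v1 - v3) > 0"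
    and u2: "dir t2 \<bullet> (v2 - v1) > 0" "dir t2 \<bullet> (v2 - v3) > 0"
    and u3: "dir t3 \<bullet> (v3 - v1) > 0" "dir t3 \<bullet> (v3 - v2) > 0"
  shows "orient v1 v2 v3 > 0"
proof -
  have s12: "crs (dir t1) (dir t2) > 0" if "t2 - t1 < pi" using t that by (simp add: crs_dir sin_gt_zero)
  have s23: "crs (dir t2) (dir t3) > 0" if "t3 - t2 < pi" using t that by (simp add: crs_dir sin_gt_zero)
  have s31: "crs (dir t3) (dir t1) > 0" if "t1 + 2 * pi - t3 < pi"
  proof -
    have "crs (dir t3) (dir (t1 + 2 * pi)) > 0" unfolding crs_dir using t that by (intro sin_gt_zero) auto
    then show ?thesis by simp
  qed
  consider "t2 - t1 < pi" "t3 - t2 < pi" | "t3 - t2 < pi" "t1 + 2 * pi - t3 < pi"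
    | "t1 + 2 * pi - t3 < pi" "t2 - t1 < pi" using t by linarith
  then show ?thesis
  proof cases
    case 1
    then show ?thesis using orient_extreme_points_half[OF s12 s23] assms by blast
  next
    case 2
    then show ?thesis using orient_extreme_points_half[OF s23 s31] assms orient_rotate by metis
  next
    case 3
    then show ?thesis using orient_extreme_points_half[OF s31 s12] assms orient_rotate by metis
  qed
qed

text \<open>On an arc shorter than \<open>pi\<close>, an intermediate direction is a combination of
  the two ends with positive sine coefficients.\<close>

lemma dir_between:
  assumes "t1 \<le> t2" "t2 \<le> t3" "t3 - t1 < pi" "dir t1 \<bullet> w > 0" "dir t3 \<bullet> w > 0"
  shows "dir t2 \<bullet> w > 0"
proof (cases "t1 = t2 \<or> t2 = t3")
  case True
  then show ?thesis using assms by auto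
next
  case False
  have "sin (t3 - t1) *\<^sub>R dir t2 = sin (t3 - t2) *\<^sub>R dir t1 + sin (t2 - t1) *\<^sub>R dir t3"
  proof -
    define a b where "a = t3 - t2" and "b = t2 - t1"
    have t: "t3 - t1 = a + b" "t1 = t2 - b" "t3 = t2 + a" by (auto simp: a_def b_def)
    show ?thesis
      by (simp add: dir_def t(1) a_def[symmetric] b_def[symmetric])
        (simp add: t(2,3) sin_add cos_add sin_diff cos_diff algebra_simps)
  qed
  then have "sin (t3 - t1) * (dir t2 \<bullet> w) = sin (t3 - t2) * (dir t1 \<bullet> w) + sin (t2 - t1) * (dir t3 \<bullet> w)"
    by (metis inner_add_left inner_scaleR_left)
  moreover have "sin (t3 - t2) > 0" "sin (t2 - t1) > 0" "sin (t3 - t1) > 0"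
    using assms False by (auto intro!: sin_gt_zero)
  ultimately show ?thesis using assms(4,5) by (metis add_pos_pos mult_pos_pos zero_less_mult_pos)
qed

text \<open>One of the two arcs between \<open>t1\<close> and \<open>t3\<close> is shorter than
  \<open>pi\<close>, and along it \<open>a\<close> keeps its advantage over the point that should
  win there. If both arcs equal \<open>pi\<close>, the directions are opposite and cannot both
  prefer \<open>a\<close>. This excludes coinciding points in opposite positions of a cyclic
  order.\<close>

lemma extreme_points_convex_order:
  assumes t: "t1 \<le> t2" "t2 \<le> t3" "t3 \<le> t4" "t4 \<le> t1 + 2 * pi"
    and d1: "dir t1 \<bullet> (a - b) > 0" "dir t1 \<bullet> (a - d) > 0"
    and d2: "dir t2 \<bullet> (b - a) > 0"
    and d3: "dir t3 \<bullet> (a - b) > 0" "dir t3 \<bullet> (a - d) > 0"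
    and d4: "dir t4 \<bullet> (d - a) > 0"
  shows False
proof -
  have *: "dir s \<bullet> (x - y) = - (dir s \<bullet> (y - x))" for s x y by (simp add: inner_diff_right)
  consider "t3 - t1 < pi" | "t3 = t1 + pi" | "t1 + 2 * pi - t3 < pi" by linarith
  then show False
  proof cases
    case 1
    then show False using dir_between[of t1 t2 t3 "a - b"] assms *[of t2 a b] by simp
  next
    case 2
    then have "dir t3 = - dir t1" by (simp add: dir_def)
    then show False using d1 d3 by simp
  next
    case 3
    then show False using dir_between[of t3 t4 "t1 + 2 * pi" "a - d"] assms *[of t4 a d] by simp
  qed
qed

section \<open>Crossing paths\<close>

lemma ray_point:
  assumes "z \<in> closed_segment a (a + t *\<^sub>R (a - c))" "t \<ge> 0"
  shows "\<exists>s. 0 \<le> s \<and> s \<le> t \<and> z = a + s *\<^sub>R (a - c :: 'a::real_vector)"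
proof -
  obtain u where u: "0 \<le> u" "u \<le> 1" "z = (1 - u) *\<^sub>R a + u *\<^sub>R (a + t *\<^sub>R (a - c))"
    using assms(1) by (auto simp: in_segment)
  have "z = a + (u * t) *\<^sub>R (a - c)" using u(3) by (simp add: algebra_simps)
  moreover have "u * t \<le> t" using u assms(2) by (simp add: mult_left_le_one_le)
  ultimately show ?thesis using u assms(2) by (intro exI[of _ "u * t"]) auto
qed

text \<open>
  Both paths are prolonged along the lines through their end points. Each prolongation leaves the
  half-plane that contains the other path, and the crossing of the two lines lies inside both
  segments; hence the crossing provided by the Fashoda theorem lies on the original paths.
\<close>

lemma crossing_paths:
  fixes a b c d :: "real \<times> real"
  assumes F: "path_connected F" "a \<in> F" "c \<in> F" and G: "path_connected G" "b \<in> G" "d \<in> G"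
    and Gac: "\<And>z. z \<in> G \<Longrightarrow> u1 \<bullet> z \<le> u1 \<bullet> a" "\<And>z. z \<in> G \<Longrightarrow> u3 \<bullet> z \<le> u3 \<bullet> c"
    and Fbd: "\<And>z. z \<in> F \<Longrightarrow> u2 \<bullet> z \<le> u2 \<bullet> b" "\<And>z. z \<in> F \<Longrightarrow> u4 \<bullet> z \<le> u4 \<bullet> d"
    and u: "u1 \<bullet> (a - c) > 0" "u3 \<bullet> (c - a) > 0" "u2 \<bullet> (b - d) > 0" "u4 \<bullet> (d - b) > 0"
    and o: "orient a b c > 0" "orient b c d > 0" "orient c d a > 0" "orient d a b > 0"
  shows "F \<inter> G \<noteq> {}"
proof -
  obtain f where f: "path f" "path_image f \<subseteq> F" "pathstart f = a" "pathfinish f = c"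
    using F unfolding path_connected_def by blast
  obtain g where g: "path g" "path_image g \<subseteq> G" "pathstart g = b" "pathfinish g = d"
    using G unfolding path_connected_def by blast
  \<comment> \<open>Affine coordinates adapted to the two diagonals: \<open>X\<close> vanishes on
    the line through \<open>b\<close> and \<open>d\<close>, \<open>Y\<close> on the line through
    \<open>a\<close> and \<open>c\<close>. So \<open>a\<close>, \<open>c\<close> lie on one axis and
    \<open>b\<close>, \<open>d\<close> on the other.\<close>
  define X where "X = orient d b"
  define Y where "Y = orient a c"
  have Xa: "X a < 0" using o(4) by (simp add: X_def orient_def crs_def algebra_simps)
  have Xc: "X c > 0" using o(2) by (simp add: X_def orient_def crs_def algebra_simps)
  have Yb: "Y b < 0" using o(1) by (simp add: Y_def orient_def crs_def algebra_simps)
  have Yd: "Y d > 0" using o(3) by (simp add: Y_def orient_def crs_def algebra_simps)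
  have Xline: "X (p + s *\<^sub>R (p - q)) = X p + s * (X p - X q)" for p q s
    by (simp add: X_def orient_def crs_def algebra_simps)
  have Yline: "Y (p + s *\<^sub>R (p - q)) = Y p + s * (Y p - Y q)" for p q s
    by (simp add: Y_def orient_def crs_def algebra_simps)
  have zero: "X b = 0" "X d = 0" "Y a = 0" "Y c = 0" by (simp_all add: X_def Y_def orient_def crs_def)
  have contX: "continuous_on A X" and contY: "continuous_on A Y" for A
    unfolding X_def Y_def orient_def crs_def by (intro continuous_intros)+
  have "bounded (X ` (path_image f \<union> path_image g))" "bounded (Y ` (path_image f \<union> path_image g))"
    using f(1) g(1) by (auto intro!: compact_imp_bounded compact_continuous_image contX contY compact_Un compact_path_image)
  then obtain R1 R2 where R12: "\<And>z. z \<in> path_image f \<union> path_image g \<Longrightarrow> \<bar>X z\<bar> \<le> R1"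
      "\<And>z. z \<in> path_image f \<union> path_image g \<Longrightarrow> \<bar>Y z\<bar> \<le> R2"
    unfolding bounded_iff by (metis (no_types) imageI real_norm_def)
  define R where "R = max R1 R2"
  have R: "\<bar>X z\<bar> \<le> R \<and> \<bar>Y z\<bar> \<le> R" if "z \<in> path_image f \<union> path_image g" for z
    using R12[OF that] by (simp add: R_def le_max_iff_disj)
  have ends: "a \<in> path_image f" "c \<in> path_image f" "b \<in> path_image g" "d \<in> path_image g"
    using f(3,4) g(3,4) pathstart_in_path_image[of f] pathfinish_in_path_image[of f]
      pathstart_in_path_image[of g] pathfinish_in_path_image[of g] by simp_all
  have Rends: "- R \<le> X a" "X c \<le> R" "- R \<le> Y b" "Y d \<le> R" 
    using R[of a] R[of b] R[of c] R[of d] ends by (simp_all add: abs_le_iff)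
  \<comment> \<open>The prolongations end where the relevant coordinate reaches \<open>- R\<close>
    or \<open>R\<close>, so that the extended paths join opposite sides of one square.\<close>
  define ta tc tb td where "ta = (R + X a) / (X c - X a)" and "tc = (R - X c) / (X c - X a)"
    and "tb = (R + Y b) / (Y d - Y b)" and "td = (R - Y d) / (Y d - Y b)"
  have t0: "ta \<ge> 0" "tc \<ge> 0" "tb \<ge> 0" "td \<ge> 0" using Rends Xa Xc Yb Yd
    by (auto simp: ta_def tc_def tb_def td_def)
  define A0 C0 B0 D0 where "A0 = a + ta *\<^sub>R (a - c)" and "C0 = c + tc *\<^sub>R (c - a)"
    and "B0 = b + tb *\<^sub>R (b - d)" and "D0 = d + td *\<^sub>R (d - b)"
  have XA0: "X A0 = - R" and XC0: "X C0 = R" using Xa Xc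
    by (simp_all add: A0_def C0_def Xline ta_def tc_def divide_simps) (simp_all add: algebra_simps)
  have YB0: "Y B0 = - R" and YD0: "Y D0 = R" using Yb Yd
    by (simp_all add: B0_def D0_def Yline tb_def td_def divide_simps) (simp_all add: algebra_simps)
  define f' where "f' = linepath A0 a +++ f +++ linepath c C0"
  define g' where "g' = linepath B0 b +++ g +++ linepath d D0"
  have f': "path f'" "pathstart f' = A0" "pathfinish f' = C0"
    "path_image f' = closed_segment a A0 \<union> path_image f \<union> closed_segment c C0"
    using f by (auto simp: f'_def path_image_join closed_segment_commute)
  have g': "path g'" "pathstart g' = B0" "pathfinish g' = D0"
    "path_image g' = closed_segment b B0 \<union> path_image g \<union> closed_segment d D0"
    using g by (auto simp: g'_def path_image_join closed_segment_commute)
  have raya: "Y z = 0 \<and> X z \<le> X a \<and> - R \<le> X z \<and> (u1 \<bullet> z \<le> u1 \<bullet> a \<longrightarrow> z = a)" if z: "z \<in> closed_segment a A0" for z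
  proof -
    obtain s where s: "0 \<le> s" "s \<le> ta" "z = a + s *\<^sub>R (a - c)" using ray_point[OF z[unfolded A0_def]] t0 by blast
    have "s * (X a - X c) \<le> 0" "ta * (X a - X c) \<le> s * (X a - X c)"
      using s Xa Xc by (auto simp: mult_nonneg_nonpos intro!: mult_right_mono_neg)
    moreover have "z = a" if "u1 \<bullet> z \<le> u1 \<bullet> a"
    proof -
      have "s * (u1 \<bullet> (a - c)) \<le> 0" using that s(3) by (simp add: inner_add_right)
      then have "s = 0" using s(1) u(1) by (simp add: mult_le_0_iff)
      then show ?thesis using s(3) by simp
    qed
    ultimately show ?thesis using s(3) XA0 by (simp add: Xline Yline zero A0_def)
  qed
  have rayc: "Y z = 0 \<and> X z \<ge> X c \<and> X z \<le> R \<and> (u3 \<bullet> z \<le> u3 \<bullet> c \<longrightarrow> z = c)" if z: "z \<in> closed_segment c C0" for z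
  proof -
    obtain s where s: "0 \<le> s" "s \<le> tc" "z = c + s *\<^sub>R (c - a)" using ray_point[OF z[unfolded C0_def]] t0 by blast
    have "s * (X c - X a) \<ge> 0" "tc * (X c - X a) \<ge> s * (X c - X a)"
      using s Xa Xc by (auto intro!: mult_right_mono)
    moreover have "z = c" if "u3 \<bullet> z \<le> u3 \<bullet> c"
    proof -
      have "s * (u3 \<bullet> (c - a)) \<le> 0" using that s(3) by (simp add: inner_add_right)
      then have "s = 0" using s(1) u(2) by (simp add: mult_le_0_iff)
      then show ?thesis using s(3) by simp
    qed
    ultimately show ?thesis using s(3) XC0 by (simp add: Xline Yline zero C0_def)
  qed
  have rayb: "X z = 0 \<and> Y z \<le> Y b \<and> - R \<le> Y z \<and> (u2 \<bullet> z \<le> u2 \<bullet> b \<longrightarrow> z = b)" if z: "z \<in> closed_segment b B0" for z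
  proof -
    obtain s where s: "0 \<le> s" "s \<le> tb" "z = b + s *\<^sub>R (b - d)" using ray_point[OF z[unfolded B0_def]] t0 by blast
    have "s * (Y b - Y d) \<le> 0" "tb * (Y b - Y d) \<le> s * (Y b - Y d)"
      using s Yb Yd by (auto simp: mult_nonneg_nonpos intro!: mult_right_mono_neg)
    moreover have "z = b" if "u2 \<bullet> z \<le> u2 \<bullet> b"
    proof -
      have "s * (u2 \<bullet> (b - d)) \<le> 0" using that s(3) by (simp add: inner_add_right)
      then have "s = 0" using s(1) u(3) by (simp add: mult_le_0_iff)
      then show ?thesis using s(3) by simp
    qed
    ultimately show ?thesis using s(3) YB0 by (simp add: Xline Yline zero B0_def)
  qed
  have rayd: "X z = 0 \<and> Y z \<ge> Y d \<and> Y z \<le> R \<and> (u4 \<bullet> z \<le> u4 \<bullet> d \<longrightarrow> z = d)" if z: "z \<in> closed_segment d D0" for z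
  proof -
    obtain s where s: "0 \<le> s" "s \<le> td" "z = d + s *\<^sub>R (d - b)" using ray_point[OF z[unfolded D0_def]] t0 by blast
    have "s * (Y d - Y b) \<ge> 0" "td * (Y d - Y b) \<ge> s * (Y d - Y b)"
      using s Yb Yd by (auto intro!: mult_right_mono)
    moreover have "z = d" if "u4 \<bullet> z \<le> u4 \<bullet> d"
    proof -
      have "s * (u4 \<bullet> (d - b)) \<le> 0" using that s(3) by (simp add: inner_add_right)
      then have "s = 0" using s(1) u(4) by (simp add: mult_le_0_iff)
      then show ?thesis using s(3) by simp
    qed
    ultimately show ?thesis using s(3) YD0 by (simp add: Xline Yline zero D0_def)
  qed
  define T :: "real \<times> real \<Rightarrow> real^2" where "T z = (\<chi> i. if i = 1 then X z else Y z)" for z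
  have T: "T z $ 1 = X z" "T z $ 2 = Y z" for z by (simp_all add: T_def)
  have contT: "continuous_on A T" for A
    unfolding T_def
  proof (rule continuous_on_vec_lambda)
    show "continuous_on A (\<lambda>z. if i = 1 then X z else Y z)" for i :: 2
      using contX contY by (cases "i = 1") simp_all
  qed
  have box: "T z \<in> cbox (\<chi> i. - R) (\<chi> i. R)" if "\<bar>X z\<bar> \<le> R" "\<bar>Y z\<bar> \<le> R" for z
    using that by (auto simp: mem_box_cart forall_2 T)
  have R0: "R \<ge> 0" using Rends Xa by linarith
  have "T z \<in> cbox (\<chi> i. - R) (\<chi> i. R)" if z: "z \<in> path_image f'" for z
  proof (rule box)
    consider "z \<in> closed_segment a A0" | "z \<in> path_image f" | "z \<in> closed_segment c C0"
      using z unfolding f'(4) by blast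
    then have "\<bar>X z\<bar> \<le> R \<and> \<bar>Y z\<bar> \<le> R"
    proof cases
      case 1
      from raya[OF this] R0 Xa show ?thesis unfolding abs_le_iff by linarith
    next
      case 2
      then show ?thesis using R[of z] by simp
    next
      case 3
      from rayc[OF this] R0 Xc show ?thesis unfolding abs_le_iff by linarith
    qed
    then show "\<bar>X z\<bar> \<le> R" "\<bar>Y z\<bar> \<le> R" by blast+
  qed
  then have "path_image (T \<circ> f') \<subseteq> cbox (\<chi> i. - R) (\<chi> i. R)"
    unfolding path_image_compose by blast
  moreover have "T z \<in> cbox (\<chi> i. - R) (\<chi> i. R)" if z: "z \<in> path_image g'" for z
  proof (rule box)
    consider "z \<in> closed_segment b B0" | "z \<in> path_image g" | "z \<in> closed_segment d D0"
      using z unfolding g'(4) by blast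
    then have "\<bar>X z\<bar> \<le> R \<and> \<bar>Y z\<bar> \<le> R"
    proof cases
      case 1
      from rayb[OF this] R0 Yb show ?thesis unfolding abs_le_iff by linarith
    next
      case 2
      then show ?thesis using R[of z] by simp
    next
      case 3
      from rayd[OF this] R0 Yd show ?thesis unfolding abs_le_iff by linarith
    qed
    then show "\<bar>X z\<bar> \<le> R" "\<bar>Y z\<bar> \<le> R" by blast+
  qed
  then have "path_image (T \<circ> g') \<subseteq> cbox (\<chi> i. - R) (\<chi> i. R)"
    unfolding path_image_compose by blast
  moreover have "path (T \<circ> f')" "path (T \<circ> g')" using f'(1) g'(1) by (auto intro: path_continuous_image contT)
  moreover have "pathstart (T \<circ> f') $ 1 = - R" "pathfinish (T \<circ> f') $ 1 = R"
    "pathstart (T \<circ> g') $ 2 = - R" "pathfinish (T \<circ> g') $ 2 = R"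
    using f'(2,3) g'(2,3) XA0 XC0 YB0 YD0 by (simp_all only: T pathstart_compose pathfinish_compose)
  ultimately obtain w where "w \<in> path_image (T \<circ> f')" "w \<in> path_image (T \<circ> g')"
    using fashoda[of "T \<circ> f'" "T \<circ> g'" "\<chi> i. - R" "\<chi> i. R"] unfolding vec_lambda_beta by blast
  then obtain z z' where zz: "z \<in> path_image f'" "z' \<in> path_image g'" "T z = T z'"
    unfolding path_image_compose by blast
  \<comment> \<open>The coordinate map is injective, since its determinant is
    \<open>X c - X a\<close>, which is positive.\<close>
  have "z = z'"
  proof -
    have XY: "X z = X z'" "Y z = Y z'" using T[of z] T[of z'] zz(3) by simp_all
    define w where "w = z - z'"
    have k: "X c - X a = crs (b - d) (c - a)" by (simp add: X_def orient_def crs_def algebra_simps)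
    have 1: "crs (b - d) w = 0" using XY(1) by (simp add: X_def orient_def crs_def w_def algebra_simps)
    have 2: "crs (c - a) w = 0" using XY(2) by (simp add: Y_def orient_def crs_def w_def algebra_simps)
    have "crs (b - d) (c - a) * fst w = fst (c - a) * crs (b - d) w - fst (b - d) * crs (c - a) w"
      "crs (b - d) (c - a) * snd w = snd (c - a) * crs (b - d) w - snd (b - d) * crs (c - a) w"
      by (simp_all add: crs_def algebra_simps)
    then have "crs (b - d) (c - a) * fst w = 0" "crs (b - d) (c - a) * snd w = 0" using 1 2 by simp_all
    then have "w = 0" using k Xa Xc by (simp add: prod_eq_iff)
    then show ?thesis by (simp add: w_def)
  qed
  then have "z \<in> path_image f'" "z \<in> path_image g'" using zz(1,2) by simp_all
  then have zF: "z \<in> closed_segment a A0 \<or> z \<in> F \<or> z \<in> closed_segment c C0"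
    and zG: "z \<in> closed_segment b B0 \<or> z \<in> G \<or> z \<in> closed_segment d D0"
    unfolding f'(4) g'(4) Un_iff using subsetD[OF f(2), of z] subsetD[OF g(2), of z] by argo+
  \<comment> \<open>\<open>X\<close> is nonzero on the prolongations of the first path and zero on
    those of the second, so the crossing lies on a prolongation of at most one path. There the
    half-plane containing the other path leaves only the end point itself.\<close>
  have "\<not> (z \<in> closed_segment a A0 \<or> z \<in> closed_segment c C0) \<or>
      \<not> (z \<in> closed_segment b B0 \<or> z \<in> closed_segment d D0)"
  proof -
    have "X z \<noteq> 0" if "z \<in> closed_segment a A0 \<or> z \<in> closed_segment c C0"
      using that raya[of z] rayc[of z] Xa Xc by (elim disjE) simp_all
    moreover have "X z = 0" if "z \<in> closed_segment b B0 \<or> z \<in> closed_segment d D0"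
      using that rayb[of z] rayd[of z] by (elim disjE) simp_all
    ultimately show ?thesis by argo
  qed
  moreover have "z \<in> F" if "z \<in> G" "z \<in> closed_segment a A0 \<or> z \<in> closed_segment c C0"
    using that raya[of z] rayc[of z] Gac[of z] F by blast
  moreover have "z \<in> G" if "z \<in> F" "z \<in> closed_segment b B0 \<or> z \<in> closed_segment d D0"
    using that rayb[of z] rayd[of z] Fbd[of z] G by blast
  ultimately have "z \<in> F \<and> z \<in> G" using zF zG by argo
  then show ?thesis by blast
qed

section \<open>Tours through extreme points\<close>

lemma dsum_subseq:
  assumes tri: "\<And>x y z. x \<in> A \<Longrightarrow> y \<in> A \<Longrightarrow> z \<in> A \<Longrightarrow> d x z \<le> d x y + d y z"
  shows "subseq xs ys \<Longrightarrow> x \<in> A \<Longrightarrow> z \<in> A \<Longrightarrow> set ys \<subseteq> A \<Longrightarrow> dsum d (x # xs @ [z]) \<le> dsum d (x # ys @ [z])"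
proof (induction ys arbitrary: xs x)
  case Nil
  then have "xs = []" by (cases xs) auto
  then show ?case by simp
next
  case (Cons y ys)
  have yA: "y \<in> A" "set ys \<subseteq> A" using Cons.prems by auto
  have skip: "subseq xs ys \<Longrightarrow> dsum d (x # xs @ [z]) \<le> dsum d (x # (y # ys) @ [z])"
  proof -
    assume s: "subseq xs ys"
    have "set xs \<subseteq> set ys" using s by (induction rule: list_emb.induct) auto
    then have "set xs \<subseteq> A" using yA(2) by simp
    then have "hd (xs @ [z]) \<in> A" using Cons.prems(3) by (cases xs) simp_all
    then have "d x (hd (xs @ [z])) \<le> d x y + d y (hd (xs @ [z]))"
      by (rule tri[OF Cons.prems(2) yA(1)])
    then have "dsum d (x # xs @ [z]) \<le> d x y + dsum d (y # xs @ [z])"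
      using dsum_Cons[of "xs @ [z]" d x] dsum_Cons[of "xs @ [z]" d y] by simp
    then show ?thesis using Cons.IH[OF s yA(1) Cons.prems(3) yA(2)] by simp
  qed
  show ?case
  proof (cases "xs = []")
    case True
    then show ?thesis by (intro skip) simp
  next
    case False
    then obtain a as where xs: "xs = a # as" by (meson neq_Nil_conv)
    have s: "if a = y then subseq as ys else subseq (a # as) ys"
      using Cons.prems(1) unfolding xs by (simp only: subseq_Cons2_iff)
    show ?thesis
    proof (cases "a = y")
      case True
      then have "subseq as ys" using s by (simp only: if_True)
      from Cons.IH[OF this yA(1) Cons.prems(3) yA(2)] show ?thesis by (simp add: True xs)
    next
      case False
      then have "subseq xs ys" unfolding xs using s by (simp only: if_False)
      then show ?thesis by (rule skip)
    qed
  qed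
qed

lemma cyc_subseq:
  assumes tri: "\<And>x y z. x \<in> A \<Longrightarrow> y \<in> A \<Longrightarrow> z \<in> A \<Longrightarrow> d x z \<le> d x y + d y z"
    and "subseq xs ys" "xs \<noteq> []" "set ys \<subseteq> A"
  shows "cyc d xs \<le> cyc d ys"
proof -
  obtain x xs' where xs: "xs = x # xs'" using assms(3) by (meson neq_Nil_conv)
  then obtain us vs where ys: "ys = us @ x # vs" "subseq xs' vs"
    using list_emb_ConsD[OF assms(2)[unfolded xs]] by auto
  have "subseq xs' (vs @ us)" using list_emb_append_mono[OF ys(2) list_emb_Nil[of _ us]] by simp
  then have "dsum d (x # xs' @ [x]) \<le> dsum d (x # (vs @ us) @ [x])"
    using assms(4) ys(1) by (intro dsum_subseq[OF tri]) auto
  then have "cyc d xs \<le> cyc d ((x # vs) @ us)" by (simp add: cyc_def xs)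
  then show ?thesis by (simp only: cyc_rotate[of d "x # vs" us] ys(1))
qed

lemma subseq_remdups: "subseq (remdups xs) xs"
  by (induction xs) auto

text \<open>
  Under the Kalmanson inequalities the identity is an optimal tour: the cost of inserting the last
  point between two others is smallest between its two neighbours.
\<close>

lemma kalmanson_tour:
  fixes d :: "'a \<Rightarrow> 'a \<Rightarrow> real" and v :: "nat \<Rightarrow> 'a"
  assumes sym: "\<And>x y. d x y = d y x"
    and refl: "\<And>x. x \<in> A \<Longrightarrow> d x x = 0"
    and tri: "\<And>x y z. x \<in> A \<Longrightarrow> y \<in> A \<Longrightarrow> z \<in> A \<Longrightarrow> d x z \<le> d x y + d y z"
    and v: "\<And>i. i < m \<Longrightarrow> v i \<in> A"
    and K1: "\<And>i j k l. i < j \<Longrightarrow> j < k \<Longrightarrow> k < l \<Longrightarrow> l < m \<Longrightarrow>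
      d (v i) (v j) + d (v k) (v l) \<le> d (v i) (v k) + d (v j) (v l)"
    and K2: "\<And>i j k l. i < j \<Longrightarrow> j < k \<Longrightarrow> k < l \<Longrightarrow> l < m \<Longrightarrow>
      d (v i) (v l) + d (v j) (v k) \<le> d (v i) (v k) + d (v j) (v l)"
  shows "k < m \<Longrightarrow> distinct ys \<Longrightarrow> set ys = v ` {..k} \<Longrightarrow>
    (\<Sum>i<k. d (v i) (v (Suc i))) + d (v k) (v 0) \<le> cyc d ys"
proof (induction k arbitrary: ys)
  case 0
  then have "ys = [v 0]" by (cases ys) (auto simp: distinct_singleton subset_singleton_iff)
  then show ?case by (simp add: cyc_def)
next
  case (Suc k)
  define w where "w = v (Suc k)"
  have km: "Suc k < m" by fact
  have wA: "w \<in> A" using v[OF km] by (simp add: w_def)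
  have vA: "v a \<in> A" if "a \<le> k" for a using v[of a] that km by simp
  \<comment> \<open>Each Kalmanson inequality is used once: the first moves the neighbour
    \<open>v b\<close> out to \<open>v k\<close>, the second moves \<open>v a\<close> back to
    \<open>v 0\<close>, and neither move makes the insertion of \<open>w\<close> dearer.\<close>
  have ins1: "d (v k) w + d w (v 0) - d (v k) (v 0) \<le> d (v a) w + d w (v b) - d (v a) (v b)"
    if ab: "a \<le> b" "b \<le> k" for a b
  proof -
    have "d (v k) w - d (v a) (v k) \<le> d (v b) w - d (v a) (v b)"
    proof -
      consider "b = k" | "a = b" | "a < b" "b < k" using ab by linarith
      then show ?thesis
      proof cases
        case 2
        have "d (v k) w \<le> d (v k) (v a) + d (v a) w" using tri vA wA ab 2 by simp
        then show ?thesis using 2 refl[OF vA[of a]] sym[of "v k" "v a"] ab by simp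
      next
        case 3
        then show ?thesis using K1[of a b k "Suc k"] km by (simp add: w_def)
      qed simp
    qed
    moreover have "d w (v 0) - d (v k) (v 0) \<le> d (v a) w - d (v a) (v k)"
    proof -
      consider "a = 0" | "a = k" | "0 < a" "a < k" using ab by linarith
      then show ?thesis
      proof cases
        case 1
        then show ?thesis by (simp add: sym)
      next
        case 2
        have "d w (v 0) \<le> d w (v k) + d (v k) (v 0)" using tri vA wA by simp
        then show ?thesis using 2 refl[OF vA[of k]] sym[of w "v k"] by simp
      next
        case 3
        then show ?thesis using K2[of 0 a k "Suc k"] km sym[of w "v 0"] sym[of "v k" "v 0"] by (simp add: w_def)
      qed
    qed
    ultimately show ?thesis using sym[of w "v b"] by simp
  qed
  have ins: "d (v k) w + d w (v 0) - d (v k) (v 0) \<le> d (v a) w + d w (v b) - d (v a) (v b)"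
    if "a \<le> k" "b \<le> k" for a b
  proof (cases "a \<le> b")
    case True
    then show ?thesis using ins1 that by blast
  next
    case False
    then show ?thesis using ins1[of b a] that sym[of w "v a"] sym[of w "v b"] sym[of "v a" "v b"] by simp
  qed
  have vset: "v ` {..Suc k} = insert w (v ` {..k})" by (simp add: atMost_Suc w_def)
  show ?case
  proof (cases "w \<in> v ` {..k}")
    case True
    then obtain j where j: "j \<le> k" "w = v j" by auto
    have "set ys = v ` {..k}" using Suc.prems(3) vset True by auto
    then have "(\<Sum>i<k. d (v i) (v (Suc i))) + d (v k) (v 0) \<le> cyc d ys"
      using Suc.IH[of ys] Suc.prems(1,2) by simp
    \<comment> \<open>Inserting \<open>w\<close> next to its own copy \<open>v j\<close> is free,
      hence inserting it between \<open>v k\<close> and \<open>v 0\<close> costs nothing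
      either.\<close>
    moreover have "d (v k) w + d w (v 0) \<le> d (v k) (v 0)" using ins[of j j] j refl[OF vA[of j]] by simp
    ultimately show ?thesis by (simp add: w_def)
  next
    case False
    have "w \<in> set ys" using Suc.prems(3) vset by simp
    then obtain us vs where ys: "ys = us @ w # vs" by (meson split_list)
    define zs where "zs = vs @ us"
    have zs: "distinct zs" "set zs = v ` {..k}"
    proof -
      show "distinct zs" using Suc.prems(2) by (auto simp: ys zs_def)
      have "w \<notin> set zs" using Suc.prems(2) by (auto simp: ys zs_def)
      moreover have "insert w (set zs) = insert w (v ` {..k})" using Suc.prems(3) vset by (auto simp: ys zs_def)
      ultimately show "set zs = v ` {..k}" using False by (metis insert_ident)
    qed
    then have ne: "zs \<noteq> []" by auto
    have "hd zs \<in> v ` {..k}" "last zs \<in> v ` {..k}" using zs(2) ne hd_in_set last_in_set by blast+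
    then obtain a b where ab: "a \<le> k" "b \<le> k" "last zs = v a" "hd zs = v b" by auto
    have "cyc d ys = cyc d (w # zs)" using cyc_rotate[of d us "w # vs"] by (simp add: ys zs_def)
    also have "\<dots> = dsum d (w # (zs @ [w]))" by (simp add: cyc_def)
    also have "\<dots> = d w (hd zs) + dsum d zs + d (last zs) w"
      using ne by (subst dsum_Cons) (simp_all add: dsum_snoc)
    finally have 1: "cyc d ys = d w (v b) + dsum d zs + d (v a) w" by (simp add: ab)
    have 2: "cyc d zs = dsum d zs + d (v a) (v b)" using ne by (simp add: cyc_def dsum_snoc ab)
    have "(\<Sum>i<k. d (v i) (v (Suc i))) + d (v k) (v 0) \<le> cyc d zs"
      using Suc.IH[of zs] zs Suc.prems(1) by simp
    then show ?thesis using 1 2 ins[OF ab(1,2)] by (simp add: w_def)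
  qed
qed

section \<open>Distances along lines within a convex region\<close>

definition walks :: "'a::metric_space set set \<Rightarrow> 'a set \<Rightarrow> 'a \<Rightarrow> 'a \<Rightarrow> 'a list set" where
  "walks \<L> H x y = {xs. xs \<noteq> [] \<and> hd xs = x \<and> last xs = y \<and> set xs \<subseteq> H \<and> chain \<L> xs}"

text \<open>An infimum rather than a minimum: it is only ever compared with single walks, so no
  shortest walk has to exist. The region \<open>H\<close> will be the hull of a tour.\<close>

definition gdist :: "'a::metric_space set set \<Rightarrow> 'a set \<Rightarrow> 'a \<Rightarrow> 'a \<Rightarrow> real" where
  "gdist \<L> H x y = Inf (plen ` walks \<L> H x y)"

lemma walks_rev: "xs \<in> walks \<L> H x y \<Longrightarrow> rev xs \<in> walks \<L> H y x"
  using chain_rev[of \<L> xs] by (auto simp: walks_def hd_rev last_rev)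

lemma walks_append_iff:
  "us @ z # vs \<in> walks \<L> H x y \<longleftrightarrow> us @ [z] \<in> walks \<L> H x z \<and> z # vs \<in> walks \<L> H z y"
proof -
  have "chain \<L> (us @ z # vs) \<longleftrightarrow> chain \<L> (us @ [z]) \<and> chain \<L> (z # vs)" by (rule chain_append_last)
  moreover have "hd (us @ z # vs) = hd (us @ [z])" by (simp add: hd_append)
  moreover have "last (us @ z # vs) = last (z # vs)" by simp
  moreover have "set (us @ z # vs) \<subseteq> H \<longleftrightarrow> set (us @ [z]) \<subseteq> H \<and> set (z # vs) \<subseteq> H"
    unfolding set_append by auto
  moreover have "us @ z # vs \<noteq> []" "us @ [z] \<noteq> []" "z # vs \<noteq> []" "last (us @ [z]) = z" "hd (z # vs) = z" by simp_all
  ultimately show ?thesis unfolding walks_def mem_Collect_eq by metis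
qed

lemmas walks_join = walks_append_iff[THEN iffD2, OF conjI]
lemmas walks_split = walks_append_iff[THEN iffD1]

lemma gdist_commute: "gdist \<L> H x y = gdist \<L> H y x"
proof -
  have "plen ` walks \<L> H x y \<subseteq> plen ` walks \<L> H y x" for x y
  proof
    fix r assume "r \<in> plen ` walks \<L> H x y"
    then obtain xs where "xs \<in> walks \<L> H x y" "r = plen xs" by blast
    then show "r \<in> plen ` walks \<L> H y x" using walks_rev[of xs] plen_rev[of xs] by (metis imageI)
  qed
  then show ?thesis unfolding gdist_def by (metis subset_antisym)
qed

lemma gdist_le: "xs \<in> walks \<L> H x y \<Longrightarrow> gdist \<L> H x y \<le> plen xs"
  unfolding gdist_def by (intro cInf_lower bdd_belowI2[of _ 0] imageI) (simp_all add: plen_nonneg)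

lemma gdist_ge:
  assumes "walks \<L> H x y \<noteq> {}" "\<And>xs. xs \<in> walks \<L> H x y \<Longrightarrow> r \<le> plen xs"
  shows "r \<le> gdist \<L> H x y"
  unfolding gdist_def using assms by (intro cInf_greatest) auto

lemma gdist_refl: "x \<in> H \<Longrightarrow> gdist \<L> H x x = 0"
proof -
  assume "x \<in> H"
  then have "[x] \<in> walks \<L> H x x" by (simp add: walks_def)
  then have "gdist \<L> H x x \<le> 0" "walks \<L> H x x \<noteq> {}" using gdist_le[of "[x]" \<L> H x x] by auto
  moreover from this(2) have "0 \<le> gdist \<L> H x x" by (rule gdist_ge) (rule plen_nonneg)
  ultimately show ?thesis by simp
qed

text \<open>A bound valid for all pairs of walks passes to the two infima, taken one after the
  other.\<close>

lemma gdist_add_ge: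
  assumes "walks \<L> H x y \<noteq> {}" "walks \<L> H x' y' \<noteq> {}"
    and "\<And>f g. f \<in> walks \<L> H x y \<Longrightarrow> g \<in> walks \<L> H x' y' \<Longrightarrow> r \<le> plen f + plen g"
  shows "r \<le> gdist \<L> H x y + gdist \<L> H x' y'"
proof -
  have "r - gdist \<L> H x y \<le> gdist \<L> H x' y'"
  proof (rule gdist_ge[OF assms(2)])
    fix g assume g: "g \<in> walks \<L> H x' y'"
    have "r - plen g \<le> gdist \<L> H x y"
    proof (rule gdist_ge[OF assms(1)])
      fix f assume "f \<in> walks \<L> H x y"
      from assms(3)[OF this g] show "r - plen g \<le> plen f" by simp
    qed
    then show "r - gdist \<L> H x y \<le> plen g" by simp
  qed
  then show ?thesis by simp
qed

lemma gdist_triangle: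
  assumes "walks \<L> H x y \<noteq> {}" "walks \<L> H y z \<noteq> {}"
  shows "gdist \<L> H x z \<le> gdist \<L> H x y + gdist \<L> H y z"
proof (rule gdist_add_ge[OF assms])
  fix f g assume fg: "f \<in> walks \<L> H x y" "g \<in> walks \<L> H y z"
  obtain us where f: "f = us @ [y]" using fg(1) by (cases f rule: rev_cases) (auto simp: walks_def)
  obtain vs where g: "g = y # vs" using fg(2) by (cases g) (auto simp: walks_def)
  show "gdist \<L> H x z \<le> plen f + plen g"
    using walks_join[OF fg[unfolded f g]] gdist_le[of "us @ y # vs" \<L> H x z] dsum_append[of dist us y vs]
    by (simp add: f g)
qed

lemma walks_nonempty:
  assumes "chain \<L> xs" "set xs \<subseteq> H" "x \<in> set xs" "y \<in> set xs"
  shows "walks \<L> H x y \<noteq> {}"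
proof -
  have *: "walks \<L> H x y \<noteq> {}" if c: "chain \<L> xs" "set xs \<subseteq> H" "xs = us @ x # vs" "y \<in> set (x # vs)" for xs us vs
  proof -
    obtain ps qs where pq: "x # vs = ps @ y # qs" using c(4) by (meson split_list)
    have "chain \<L> (ps @ y # qs)" using c(1,3) chain_append_last[of \<L> us x vs] pq by simp
    then have "chain \<L> (ps @ [y])" using chain_append_last[of \<L> ps y qs] by simp
    moreover have "hd (ps @ [y]) = x" using pq by (cases ps) auto
    moreover have "set (ps @ [y]) \<subseteq> H" using c(2,3) pq by auto
    ultimately have "ps @ [y] \<in> walks \<L> H x y" by (simp add: walks_def)
    then show ?thesis by blast
  qed
  obtain us vs where xs: "xs = us @ x # vs" using assms(3) by (meson split_list)
  show ?thesis
  proof (cases "y \<in> set (x # vs)")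
    case True
    then show ?thesis using *[OF assms(1,2) xs] by blast
  next
    case False
    then have "y \<in> set (x # rev us)" using assms(4) xs by simp
    then show ?thesis using *[of "rev xs" "rev vs" "rev us"] assms(1,2) xs chain_rev[of \<L> xs] by simp
  qed
qed

text \<open>Exchanging tails at the common point \<open>z\<close> turns the two walks into one from
  \<open>a\<close> to \<open>b\<close> and one from \<open>c\<close> to \<open>d\<close> with the
  same total length. Convexity of \<open>H\<close> keeps \<open>z\<close> in the region.\<close>

lemma gdist_exchange:
  fixes f :: "'a::euclidean_space list"
  assumes L: "\<forall>L\<in>\<L>. convex L" and H: "convex H"
    and f: "f \<in> walks \<L> H a c" and g: "g \<in> walks \<L> H b d" and z: "z \<in> pcurve f" "z \<in> pcurve g"
  shows "gdist \<L> H a b + gdist \<L> H c d \<le> plen f + plen g"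
proof -
  have split: "\<exists>us vs. us @ [z] \<in> walks \<L> H x z \<and> z # vs \<in> walks \<L> H z y \<and> plen h = plen (us @ [z]) + plen (z # vs)"
    if h: "h \<in> walks \<L> H x y" "z \<in> pcurve h" for h x y
  proof -
    have hh: "h \<noteq> []" "hd h = x" "last h = y" "set h \<subseteq> H" "chain \<L> h" using h(1) by (auto simp: walks_def)
    obtain us vs where uv: "chain \<L> (us @ z # vs)" "plen (us @ z # vs) = plen h"
      "hd (us @ z # vs) = hd h" "last (us @ z # vs) = last h" "set (us @ z # vs) = insert z (set h)"
      using chain_insert[OF L hh(5) h(2)] by blast
    have "z \<in> H" using pcurve_subset_convex[OF H hh(4)] h(2) by blast
    then have "us @ z # vs \<in> walks \<L> H x y" using uv hh by (simp add: walks_def)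
    then show ?thesis using walks_split[of us z vs \<L> H x y] dsum_append[of dist us z vs] uv(2) by metis
  qed
  obtain fu fv where ff: "fu @ [z] \<in> walks \<L> H a z" "z # fv \<in> walks \<L> H z c" "plen f = plen (fu @ [z]) + plen (z # fv)"
    using split[OF f z(1)] by blast
  obtain gu gv where gg: "gu @ [z] \<in> walks \<L> H b z" "z # gv \<in> walks \<L> H z d" "plen g = plen (gu @ [z]) + plen (z # gv)"
    using split[OF g z(2)] by blast
  have "gdist \<L> H a b \<le> plen (fu @ [z]) + plen (gu @ [z])"
  proof -
    have "z # rev gu \<in> walks \<L> H z b" using walks_rev[OF gg(1)] by simp
    then have "gdist \<L> H a b \<le> plen (fu @ [z]) + plen (z # rev gu)"
      using walks_join[OF ff(1)] gdist_le[of "fu @ z # rev gu" \<L> H a b] dsum_append[of dist fu z "rev gu"] by simp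
    then show ?thesis using plen_rev[of "gu @ [z]"] by simp
  qed
  moreover have "gdist \<L> H c d \<le> plen (z # fv) + plen (z # gv)"
  proof -
    have "rev fv @ [z] \<in> walks \<L> H c z" using walks_rev[OF ff(2)] by simp
    then have "gdist \<L> H c d \<le> plen (rev fv @ [z]) + plen (z # gv)"
      using walks_join[OF _ gg(2)] gdist_le[of "rev fv @ z # gv" \<L> H c d] dsum_append[of dist "rev fv" z gv] by simp
    then show ?thesis using plen_rev[of "z # fv"] by simp
  qed
  ultimately show ?thesis using ff(3) gg(3) by simp
qed

definition unique_max :: "(real \<times> real) set \<Rightarrow> real \<Rightarrow> real \<times> real \<Rightarrow> bool" where
  "unique_max S t x \<longleftrightarrow> x \<in> S \<and> (\<forall>p\<in>S. p \<noteq> x \<longrightarrow> dir t \<bullet> (x - p) > 0)"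

lemma unique_max_unique: "unique_max S t x \<Longrightarrow> unique_max S t y \<Longrightarrow> x = y"
proof (rule ccontr)
  assume "unique_max S t x" "unique_max S t y" "x \<noteq> y"
  then have "dir t \<bullet> (x - y) > 0" "dir t \<bullet> (y - x) > 0" by (simp_all add: unique_max_def)
  then show False by (simp add: inner_diff_right)
qed

lemma unique_max_hull:
  assumes "unique_max S t x" "z \<in> convex hull S"
  shows "dir t \<bullet> z \<le> dir t \<bullet> x"
proof -
  have "S \<subseteq> {z. dir t \<bullet> z \<le> dir t \<bullet> x}"
    using assms(1) by (force simp: unique_max_def inner_diff_right)
  then have "convex hull S \<subseteq> {z. dir t \<bullet> z \<le> dir t \<bullet> x}"
    by (intro hull_minimal convex_halfspace_le)
  then show ?thesis using assms(2) by blast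
qed

text \<open>If cyclic neighbours coincide, the triangle inequality suffices; otherwise opposite
  points cannot coincide, by \<open>extreme_points_convex_order\<close>. Four distinct points are in
  convex position in the given order, so any two walks along the diagonals cross. Exchanging tails
  gives the first inequality, and with one walk reversed the second.\<close>

lemma kalmanson_gdist:
  assumes L: "\<forall>L\<in>\<L>. convex L" and H: "H = convex hull S"
    and conn: "\<And>x y. x \<in> S \<Longrightarrow> y \<in> S \<Longrightarrow> walks \<L> H x y \<noteq> {}"
    and m: "unique_max S t1 a" "unique_max S t2 b" "unique_max S t3 c" "unique_max S t4 d"
    and t: "t1 \<le> t2" "t2 \<le> t3" "t3 \<le> t4" "t4 \<le> t1 + 2 * pi"
  shows "gdist \<L> H a b + gdist \<L> H c d \<le> gdist \<L> H a c + gdist \<L> H b d \<and>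
    gdist \<L> H a d + gdist \<L> H b c \<le> gdist \<L> H a c + gdist \<L> H b d"
proof -
  let ?d = "gdist \<L> H"
  have S: "a \<in> S" "b \<in> S" "c \<in> S" "d \<in> S" using m by (auto simp: unique_max_def)
  have SH: "S \<subseteq> H" unfolding H by (rule hull_subset)
  have tri: "?d x z \<le> ?d x y + ?d y z" if "x \<in> S" "y \<in> S" "z \<in> S" for x y z
    using that by (intro gdist_triangle conn)
  have refl: "?d x x = 0" if "x \<in> S" for x using gdist_refl SH that by blast
  have max: "dir t1 \<bullet> (a - p) > 0" if "p \<in> S" "p \<noteq> a" for p using m(1) that by (simp add: unique_max_def)
  have mbx: "dir t2 \<bullet> (b - p) > 0" if "p \<in> S" "p \<noteq> b" for p using m(2) that by (simp add: unique_max_def)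
  have mcx: "dir t3 \<bullet> (c - p) > 0" if "p \<in> S" "p \<noteq> c" for p using m(3) that by (simp add: unique_max_def)
  have mdx: "dir t4 \<bullet> (d - p) > 0" if "p \<in> S" "p \<noteq> d" for p using m(4) that by (simp add: unique_max_def)
  consider "a = b" | "b = c" | "c = d" | "d = a" | "a = c" "a \<noteq> b" "a \<noteq> d" | "b = d" "b \<noteq> a" "b \<noteq> c"
    | "a \<noteq> b" "b \<noteq> c" "c \<noteq> d" "d \<noteq> a" "a \<noteq> c" "b \<noteq> d" by blast
  then show ?thesis
  proof cases
    case 1
    then show ?thesis using tri[of c a d] S refl[of a] gdist_commute[of \<L> H c a] by simp
  next
    case 2
    then show ?thesis using tri[of a b d] S refl[of b] by simp
  next
    case 3
    then show ?thesis using tri[of a c b] S refl[of c] gdist_commute[of \<L> H c b] by simp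
  next
    case 4
    then show ?thesis using tri[of b a c] S refl[of a] gdist_commute[of \<L> H b a] gdist_commute[of \<L> H c a] by simp
  next
    case 5
    then have False
      using extreme_points_convex_order[OF t max[of b] max[of d] mbx[of a]] mcx[of b] mcx[of d] mdx[of a] S by simp
    then show ?thesis ..
  next
    case 6
    have "t1 + 2 * pi \<le> t2 + 2 * pi" using t by simp
    from extreme_points_convex_order[OF t(2,3,4) this, of b c a] 6 have False
      using mbx[of c] mbx[of a] mcx[of b] mdx[of c] mdx[of a] max[of b] S by simp
    then show ?thesis ..
  next
    case 7
    have neq: "t \<noteq> t'" if "unique_max S t x" "unique_max S t' y" "x \<noteq> y" for t t' x y
      using unique_max_unique that by blast
    \<comment> \<open>The direction of \<open>t4\<close> is also that of \<open>t4 - 2 * pi\<close>,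
      so \<open>a \<noteq> d\<close> makes the last inequality strict.\<close>
    have d4: "unique_max S (t4 - 2 * pi) d" using m(4) dir_add_2pi[of "t4 - 2 * pi"] by (simp add: unique_max_def)
    have "t1 \<noteq> t4 - 2 * pi" using neq[OF m(1) d4] 7 by blast
    moreover have "t1 \<noteq> t2" "t2 \<noteq> t3" "t3 \<noteq> t4" using neq m 7 by blast+
    ultimately have st: "t1 < t2" "t2 < t3" "t3 < t4" "t4 < t1 + 2 * pi" using t by auto
    note mm = max[of b] max[of c] max[of d] mbx[of a] mbx[of c] mbx[of d] mcx[of a] mcx[of b] mcx[of d]
      mdx[of a] mdx[of b] mdx[of c]
    have o: "orient a b c > 0" "orient b c d > 0" "orient a c d > 0" "orient a b d > 0"
    proof -
      show "orient a b c > 0" by (rule orient_extreme_points[of t1 t2 t3]) (use st mm S 7 in auto)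
      show "orient b c d > 0" by (rule orient_extreme_points[of t2 t3 t4]) (use st mm S 7 in auto)
      show "orient a c d > 0" by (rule orient_extreme_points[of t1 t3 t4]) (use st mm S 7 in auto)
      show "orient a b d > 0" by (rule orient_extreme_points[of t1 t2 t4]) (use st mm S 7 in auto)
    qed
    have "orient c d a > 0" "orient d a b > 0" using o orient_rotate by metis+
    have meet: "pcurve f \<inter> pcurve g \<noteq> {}" if f: "f \<in> walks \<L> H a c" and g: "g \<in> walks \<L> H b d" for f g
    proof -
      have fs: "f \<noteq> []" "hd f = a" "last f = c" "set f \<subseteq> H" using f by (auto simp: walks_def)
      have gs: "g \<noteq> []" "hd g = b" "last g = d" "set g \<subseteq> H" using g by (auto simp: walks_def)
      have "convex H" by (simp add: H)
      then have fg: "pcurve f \<subseteq> H" "pcurve g \<subseteq> H" using pcurve_subset_convex fs gs by blast+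
      have ends: "a \<in> pcurve f" "c \<in> pcurve f" "b \<in> pcurve g" "d \<in> pcurve g"
        using set_subset_pcurve[of f] set_subset_pcurve[of g] hd_in_set[OF fs(1)] last_in_set[OF fs(1)]
          hd_in_set[OF gs(1)] last_in_set[OF gs(1)] fs(2,3) gs(2,3) by (simp_all add: subsetD)
      have h: "dir t1 \<bullet> z \<le> dir t1 \<bullet> a" "dir t2 \<bullet> z \<le> dir t2 \<bullet> b" "dir t3 \<bullet> z \<le> dir t3 \<bullet> c" "dir t4 \<bullet> z \<le> dir t4 \<bullet> d"
        if "z \<in> H" for z using m[THEN unique_max_hull] that unfolding H by simp_all
      have hf: "dir t2 \<bullet> z \<le> dir t2 \<bullet> b" "dir t4 \<bullet> z \<le> dir t4 \<bullet> d" if "z \<in> pcurve f" for z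
        using h[of z] fg(1) that by blast+
      have hg: "dir t1 \<bullet> z \<le> dir t1 \<bullet> a" "dir t3 \<bullet> z \<le> dir t3 \<bullet> c" if "z \<in> pcurve g" for z
        using h[of z] fg(2) that by blast+
      show ?thesis
        by (rule crossing_paths[of _ a c _ b d "dir t1" "dir t3" "dir t2" "dir t4"])
          (fact path_connected_pcurve ends hf hg o(1,2) \<open>orient c d a > 0\<close> \<open>orient d a b > 0\<close>
            mm(2)[OF S(3) 7(5)[THEN not_sym]] mm(7)[OF S(1) 7(5)] mm(6)[OF S(4) 7(6)[THEN not_sym]] mm(11)[OF S(2) 7(6)])+
    qed
    have convH: "convex H" by (simp add: H)
    have "?d a b + ?d c d \<le> ?d a c + ?d b d"
    proof (rule gdist_add_ge[OF conn conn])
      fix f g assume fg: "f \<in> walks \<L> H a c" "g \<in> walks \<L> H b d"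
      from meet[OF this] obtain z where "z \<in> pcurve f" "z \<in> pcurve g" by blast
      from gdist_exchange[OF L convH fg this] show "?d a b + ?d c d \<le> plen f + plen g" .
    qed (use S in auto)
    moreover have "?d a d + ?d b c \<le> ?d a c + ?d b d"
    proof (rule gdist_add_ge[OF conn conn])
      fix f g assume fg: "f \<in> walks \<L> H a c" "g \<in> walks \<L> H b d"
      from meet[OF this] obtain z where "z \<in> pcurve f" "z \<in> pcurve (rev g)" by (auto simp: pcurve_rev)
      from gdist_exchange[OF L convH fg(1) walks_rev[OF fg(2)] this]
      show "?d a d + ?d b c \<le> plen f + plen g" by (simp add: plen_rev gdist_commute[of \<L> H c b])
    qed (use S in auto)
    ultimately show ?thesis by blast
  qed
qed

section \<open>Perturbed directions and the angular tour\<close>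

lemma dir_diff: "dir (t - e) \<bullet> w = cos e * (dir t \<bullet> w) - sin e * (dir (t + pi / 2) \<bullet> w)"
  by (simp add: dir_def cos_diff sin_diff cos_add sin_add inner_prod_def algebra_simps)

lemma dir_zero: "dir t \<bullet> w = 0 \<Longrightarrow> dir (t + pi / 2) \<bullet> w = 0 \<Longrightarrow> w = 0"
proof -
  assume 0: "dir t \<bullet> w = 0" "dir (t + pi / 2) \<bullet> w = 0"
  have "w = (cos t * (dir t \<bullet> w) - sin t * (dir (t + pi / 2) \<bullet> w), sin t * (dir t \<bullet> w) + cos t * (dir (t + pi / 2) \<bullet> w))"
  proof -
    have c: "cos t * (cos t * x) + sin t * (sin t * x) = x" for x
      using sin_cos_squared_add2[of t] by (simp add: power2_eq_square flip: mult.assoc distrib_right)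
    show ?thesis using c[of "fst w"] c[of "snd w"]
      by (simp add: dir_def cos_add sin_add inner_prod_def prod_eq_iff algebra_simps)
  qed
  then show ?thesis using 0 by (simp add: zero_prod_def)
qed

text \<open>A strict sign survives a small turn by continuity. If \<open>w\<close> is orthogonal to
  \<open>dir t\<close>, its component along the perpendicular direction is nonzero and decides the
  sign after the turn.\<close>

lemma dir_perturb:
  assumes "w \<noteq> 0"
  shows "\<forall>\<^sub>F e in at_right 0. dir (t - e) \<bullet> w \<noteq> 0 \<and> (dir t \<bullet> w > 0 \<longrightarrow> dir (t - e) \<bullet> w > 0)"
proof -
  have lim: "((\<lambda>e. dir (t - e) \<bullet> w) \<longlongrightarrow> dir (t - 0) \<bullet> w) (at_right 0)"
    unfolding dir_def by (intro tendsto_intros)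
  consider "dir t \<bullet> w > 0" | "dir t \<bullet> w < 0" | "dir t \<bullet> w = 0" by linarith
  then show ?thesis
  proof cases
    case 1
    then have "\<forall>\<^sub>F e in at_right 0. dir (t - e) \<bullet> w > 0" using order_tendstoD(1)[OF lim, of 0] by simp
    then show ?thesis by (rule eventually_mono) simp
  next
    case 2
    then have "\<forall>\<^sub>F e in at_right 0. dir (t - e) \<bullet> w < 0" using order_tendstoD(2)[OF lim, of 0] by simp
    then show ?thesis by (rule eventually_mono) (use 2 in simp)
  next
    case 3
    then have nz: "dir (t + pi / 2) \<bullet> w \<noteq> 0" using dir_zero assms by blast
    have "\<forall>\<^sub>F e in at_right (0::real). 0 < e \<and> e < pi"
      by (intro eventually_conj eventually_at_right_less eventually_at_right_real[THEN eventually_mono, of 0 pi]) auto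
    then show ?thesis
    proof (rule eventually_mono)
      fix e :: real assume "0 < e \<and> e < pi"
      then have "sin e > 0" by (intro sin_gt_zero) auto
      then show "dir (t - e) \<bullet> w \<noteq> 0 \<and> (dir t \<bullet> w > 0 \<longrightarrow> dir (t - e) \<bullet> w > 0)"
        using nz 3 by (simp add: dir_diff)
    qed
  qed
qed

text \<open>
  Ties between extreme points are broken by turning all directions clockwise by a small angle, so
  that maxima become unique and the sequence of maxima moves only at its own direction.
\<close>

theorem direction_tour:
  fixes ys :: "(real \<times> real) list"
  assumes L: "\<forall>L\<in>\<L>. convex L" and ys: "ys \<noteq> []" "chain \<L> (ys @ [hd ys])"
    and m: "m > 0" and mono: "\<And>i j. i \<le> j \<Longrightarrow> j \<le> m \<Longrightarrow> \<theta> i \<le> \<theta> j"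
    and per: "\<theta> m = \<theta> 0 + 2 * pi" and gap: "\<And>i. i < m \<Longrightarrow> \<theta> (Suc i) - \<theta> i < pi"
  obtains v where "\<And>i. i \<le> m \<Longrightarrow> v i \<in> set ys"
    "\<And>i p. i \<le> m \<Longrightarrow> p \<in> set ys \<Longrightarrow> dir (\<theta> i) \<bullet> p \<le> dir (\<theta> i) \<bullet> v i"
    "v m = v 0"
    "\<And>i. i < m \<Longrightarrow> v (Suc i) = v i \<or>
       dir (\<theta> i) \<bullet> (v (Suc i) - v i) \<le> 0 \<and> 0 < dir (\<theta> (Suc i)) \<bullet> (v (Suc i) - v i)"
    "(\<Sum>i<m. gdist \<L> (convex hull (set ys)) (v i) (v (Suc i))) \<le> cyc dist ys"
proof -
  define S where "S = set ys"
  \<comment> \<open>Differences of distinct tour points. Since these and the directions are finite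
    in number, one small angle \<open>e\<close> breaks all ties at once.\<close>
  define W where "W = (\<lambda>(p, q). p - q) ` (S \<times> S) - {0}"
  have fin: "finite S" "finite W" by (auto simp: S_def W_def)
  have "\<forall>\<^sub>F e in at_right 0. \<forall>i\<in>{..m}. \<forall>w\<in>W. dir (\<theta> i - e) \<bullet> w \<noteq> 0 \<and> (dir (\<theta> i) \<bullet> w > 0 \<longrightarrow> dir (\<theta> i - e) \<bullet> w > 0)"
    by (intro eventually_ball_finite ballI fin dir_perturb) (auto simp: W_def)
  moreover have "\<forall>\<^sub>F e in at_right (0::real). 0 < e \<and> e < pi"
    by (intro eventually_conj eventually_at_right_less eventually_at_right_real[THEN eventually_mono, of 0 pi]) auto
  ultimately have "\<forall>\<^sub>F e in at_right 0. (\<forall>i\<in>{..m}. \<forall>w\<in>W. dir (\<theta> i - e) \<bullet> w \<noteq> 0 \<and> (dir (\<theta> i) \<bullet> w > 0 \<longrightarrow> dir (\<theta> i - e) \<bullet> w > 0)) \<and> 0 < e \<and> e < pi"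
    by (rule eventually_conj)
  from eventually_happens'[OF trivial_limit_at_right_real this] obtain e where
    e: "\<And>i w. i \<le> m \<Longrightarrow> w \<in> W \<Longrightarrow> dir (\<theta> i - e) \<bullet> w \<noteq> 0"
      "\<And>i w. i \<le> m \<Longrightarrow> w \<in> W \<Longrightarrow> dir (\<theta> i) \<bullet> w > 0 \<Longrightarrow> dir (\<theta> i - e) \<bullet> w > 0" "0 < e" "e < pi"
    by (metis atMost_iff)
  have sin_e: "sin e > 0" using e(3,4) by (rule sin_gt_zero)
  have SW: "p - q \<in> W" if "p \<in> S" "q \<in> S" "p \<noteq> q" for p q using that by (force simp: W_def)
  have ex: "\<exists>x. unique_max S (\<theta> i - e) x" if i: "i \<le> m" for i
  proof -
    let ?f = "\<lambda>p. dir (\<theta> i - e) \<bullet> p"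
    have "Max (?f ` S) \<in> ?f ` S" using fin ys(1) by (intro Max_in) (auto simp: S_def)
    then obtain x where x: "x \<in> S" "?f x = Max (?f ` S)" by auto
    have "?f (x - p) > 0" if p: "p \<in> S" "p \<noteq> x" for p
    proof -
      have "?f p \<le> ?f x" using x(2) p fin by simp
      then show ?thesis using e(1)[OF i SW[of x p]] x(1) p by (simp add: inner_diff_right)
    qed
    then show ?thesis using x(1) unfolding unique_max_def by blast
  qed
  define v where "v i = (SOME x. unique_max S (\<theta> i - e) x)" for i
  have v: "unique_max S (\<theta> i - e) (v i)" if "i \<le> m" for i unfolding v_def using ex[OF that] by (rule someI_ex)
  have vS: "v i \<in> S" if "i \<le> m" for i using v[OF that] by (simp add: unique_max_def)
  have vmax: "dir (\<theta> i) \<bullet> p \<le> dir (\<theta> i) \<bullet> v i" if "i \<le> m" "p \<in> S" for i p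
  proof (rule ccontr)
    assume "\<not> ?thesis"
    then have 1: "dir (\<theta> i) \<bullet> (p - v i) > 0" by (simp add: inner_diff_right)
    then have "p \<noteq> v i" by auto
    then have "dir (\<theta> i - e) \<bullet> (p - v i) > 0" "dir (\<theta> i - e) \<bullet> (v i - p) > 0"
      using e(2)[OF that(1) SW 1] v[OF that(1)] vS that by (auto simp: unique_max_def)
    then show False by (simp add: inner_diff_right)
  qed
  have per': "v m = v 0"
  proof -
    have "dir (\<theta> m - e) = dir (\<theta> 0 - e)" using dir_add_2pi[of "\<theta> 0 - e"] per by (simp add: algebra_simps)
    then show ?thesis by (simp add: v_def unique_max_def)
  qed
  have step: "v (Suc i) = v i \<or>
       dir (\<theta> i) \<bullet> (v (Suc i) - v i) \<le> 0 \<and> 0 < dir (\<theta> (Suc i)) \<bullet> (v (Suc i) - v i)" if i: "i < m" for i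
  proof (rule disjCI, rule ccontr)
    assume 1: "\<not> (dir (\<theta> i) \<bullet> (v (Suc i) - v i) \<le> 0 \<and> 0 < dir (\<theta> (Suc i)) \<bullet> (v (Suc i) - v i))"
      and ne: "v (Suc i) \<noteq> v i"
    define w where "w = v (Suc i) - v i"
    define g where "g = \<theta> (Suc i) - \<theta> i"
    have g: "0 \<le> g" "g < pi" using mono[of i "Suc i"] gap[of i] i by (auto simp: g_def)
    have a: "dir (\<theta> i) \<bullet> w \<le> 0" using vmax[of i "v (Suc i)"] vS[of "Suc i"] i by (simp add: w_def inner_diff_right)
    have "dir (\<theta> (Suc i)) \<bullet> w \<ge> 0" using vmax[of "Suc i" "v i"] vS[of i] i by (simp add: w_def inner_diff_right)
    \<comment> \<open>A tie at event \<open>i + 1\<close> was decided by the clockwise turn alone,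
      so \<open>w\<close> has a negative component a quarter turn ahead. Together with
      \<open>a\<close> this forces the gap \<open>g\<close> to vanish, and then both maxima belong
      to the same direction.\<close>
    then have b: "dir (\<theta> (Suc i)) \<bullet> w = 0" using 1 a by (simp add: w_def)
    have "dir (\<theta> (Suc i) - e) \<bullet> w > 0" using v[of "Suc i"] vS[of i] ne i by (simp add: unique_max_def w_def)
    then have "sin e * (dir (\<theta> (Suc i) + pi / 2) \<bullet> w) < 0" using b by (simp add: dir_diff)
    then have c: "dir (\<theta> (Suc i) + pi / 2) \<bullet> w < 0" using sin_e by (simp add: mult_less_0_iff)
    have "\<theta> i = \<theta> (Suc i) - g" by (simp add: g_def)
    then have "dir (\<theta> i) \<bullet> w = - sin g * (dir (\<theta> (Suc i) + pi / 2) \<bullet> w)" using b dir_diff[of "\<theta> (Suc i)" g w] by simp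
    then have "sin g \<le> 0" using a c by (simp add: mult_le_0_iff zero_le_mult_iff)
    then have "g = 0" using sin_gt_zero[of g] g by fastforce
    then have "v (Suc i) = v i" by (simp add: v_def g_def)
    then show False using ne by simp
  qed
  let ?H = "convex hull S" and ?d = "gdist \<L> (convex hull S)"
  have SH: "S \<subseteq> ?H" by (rule hull_subset)
  have "set (ys @ [hd ys]) \<subseteq> ?H" using SH ys(1) by (auto simp: S_def)
  then have conn: "walks \<L> ?H x y \<noteq> {}" if "x \<in> S" "y \<in> S" for x y
    using walks_nonempty[OF ys(2)] that by (simp add: S_def)
  have refl: "?d x x = 0" if "x \<in> S" for x using gdist_refl[of x ?H] SH that by blast
  have tri: "?d x z \<le> ?d x y + ?d y z" if "x \<in> S" "y \<in> S" "z \<in> S" for x y z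
    using that by (intro gdist_triangle conn)
  have K: "?d (v i) (v j) + ?d (v k) (v l) \<le> ?d (v i) (v k) + ?d (v j) (v l) \<and>
     ?d (v i) (v l) + ?d (v j) (v k) \<le> ?d (v i) (v k) + ?d (v j) (v l)"
    if "i < j" "j < k" "k < l" "l < m" for i j k l
  proof (rule kalmanson_gdist[where ?t1.0="\<theta> i - e" and ?t2.0="\<theta> j - e" and ?t3.0="\<theta> k - e" and ?t4.0="\<theta> l - e",
        OF L HOL.refl conn])
    have "\<theta> l \<le> \<theta> i + 2 * pi" using mono[of l m] mono[of 0 i] per that by simp
    then show "\<theta> l - e \<le> \<theta> i - e + 2 * pi" by simp
  qed (use that v mono in auto)
  \<comment> \<open>The maxima in the order in which the original tour meets them.
    \<open>kalmanson_tour\<close> compares them with the angular order, shortcutting with the whole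
    tour. Indices stop at \<open>m - 1\<close> because \<open>v m = v 0\<close>.\<close>
  define zs where "zs = remdups (filter (\<lambda>y. y \<in> v ` {..m - 1}) ys)"
  have zs: "distinct zs" "set zs = v ` {..m - 1}" "subseq zs ys"
  proof -
    have "v ` {..m - 1} \<subseteq> set ys" using vS by (auto simp: S_def)
    then show "set zs = v ` {..m - 1}" by (auto simp: zs_def)
    show "subseq zs ys" unfolding zs_def using subseq_remdups subseq_filter_left subseq_order.order_trans by blast
  qed (simp add: zs_def)
  have "(\<Sum>i<m - 1. ?d (v i) (v (Suc i))) + ?d (v (m - 1)) (v 0) \<le> cyc ?d zs"
  proof (rule kalmanson_tour[where A=S and m=m])
    show "?d x y = ?d y x" for x y by (rule gdist_commute)
    show "?d (v i) (v j) + ?d (v k) (v l) \<le> ?d (v i) (v k) + ?d (v j) (v l)"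
      if "i < j" "j < k" "k < l" "l < m" for i j k l using K[OF that] by blast
    show "?d (v i) (v l) + ?d (v j) (v k) \<le> ?d (v i) (v k) + ?d (v j) (v l)"
      if "i < j" "j < k" "k < l" "l < m" for i j k l using K[OF that] by blast
    show "v i \<in> S" if "i < m" for i using vS[of i] that by simp
  qed (fact refl tri zs | use m in simp)+
  moreover have "(\<Sum>i<m - 1. ?d (v i) (v (Suc i))) + ?d (v (m - 1)) (v 0) = (\<Sum>i<m. ?d (v i) (v (Suc i)))"
    using m per' by (cases m) simp_all
  moreover have "cyc ?d zs \<le> cyc ?d ys"
  proof (rule cyc_subseq[where A=S])
    show "zs \<noteq> []" using zs(2) by auto
  qed (fact tri zs | simp add: S_def)+
  moreover have "cyc ?d ys \<le> cyc dist ys"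
  proof -
    have "dsum ?d xs \<le> dsum dist xs" if "chain \<L> xs" "set xs \<subseteq> ?H" for xs
      using that
    proof (induction xs rule: induct_list012)
      case (3 x y zs)
      have "[x, y] \<in> walks \<L> ?H x y" using 3(3,4) by (simp add: walks_def)
      from gdist_le[OF this] have "?d x y \<le> dist x y" by simp
      then show ?case using 3(2-4) by simp
    qed simp_all
    then show ?thesis unfolding cyc_def using ys(2) \<open>set (ys @ [hd ys]) \<subseteq> ?H\<close> by blast
  qed
  ultimately have "(\<Sum>i<m. ?d (v i) (v (Suc i))) \<le> cyc dist ys" by linarith
  then show thesis using that[of v] vS vmax per' step by (simp add: S_def)
qed

section \<open>Routes and sequences of vertices\<close>

lemma chain_rotate:
  assumes "chain \<L> ((us @ x # vs) @ [hd (us @ x # vs)])"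
  shows "chain \<L> (x # vs @ us @ [x])"
proof (cases us)
  case Nil
  then show ?thesis using assms by simp
next
  case (Cons a us')
  have "chain \<L> ((a # us') @ x # (vs @ [a]))" using assms Cons by simp
  then have "chain \<L> (a # us' @ [x])" "chain \<L> ((x # vs) @ [a])"
    using chain_append_last[of \<L> "a # us'" x "vs @ [a]"] by simp_all
  then have "chain \<L> ((x # vs) @ a # (us' @ [x]))"
    using chain_append_last[of \<L> "x # vs" a "us' @ [x]"] by simp
  then show ?thesis using Cons by simp
qed

text \<open>A curve through no crossing stays on one line, and any single crossing serves as well.
  Otherwise every visited line has a crossing on the curve, namely the first one on the way from a
  visited point to \<open>v0\<close>. These crossings are made vertices of the curve, and all points
  that are not crossings are bypassed.\<close>

lemma vertex_tour_of_route:
  fixes qs :: "(real \<times> real) list"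
  assumes fin: "finite \<L>" and aff: "\<forall>L\<in>\<L>. affine L" and V: "vertices \<L> \<noteq> {}"
    and qs: "qs \<noteq> []" "curve qs \<subseteq> \<Union>\<L>"
  obtains ys where "ys \<noteq> []" "set ys \<subseteq> vertices \<L>" "chain \<L> (ys @ [hd ys])"
    "cyc dist ys \<le> route_length qs" "num_visited \<L> qs \<le> card {L\<in>\<L>. L \<inter> set ys \<noteq> {}}"
proof -
  define cs where "cs = qs @ [hd qs]"
  have conv: "\<forall>L\<in>\<L>. convex L" using aff by (simp add: affine_imp_convex)
  have cv: "curve qs = pcurve cs" using qs(1) by (simp add: curve_eq cs_def)
  have ch: "chain \<L> cs" using chain_of_pcurve[OF fin aff] qs(2) cv by simp
  show ?thesis
  proof (cases "vertices \<L> \<inter> curve qs = {}")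
    case True
    obtain z where z: "z \<in> vertices \<L>" using V by blast
    then obtain L1 L2 where L12: "L1 \<in> \<L>" "L2 \<in> \<L>" "L1 \<noteq> L2" "z \<in> L1" "z \<in> L2" by (auto simp: vertices_def)
    have uniq: "L = M" if LM: "L \<in> \<L>" "M \<in> \<L>" "L \<inter> curve qs \<noteq> {}" "M \<inter> curve qs \<noteq> {}" for L M
    proof -
      obtain p q where pq: "p \<in> L" "q \<in> M" "p \<in> curve qs" "q \<in> curve qs" using LM by blast
      obtain cs' where cs': "chain \<L> cs'" "pcurve cs' = pcurve cs" "set cs' = {p, q} \<union> set cs"
        using chain_insert_set[OF conv ch, of "{p, q}"] pq cv by auto
      obtain us vs where uv: "cs' = us @ p # vs" using cs'(3) by (metis UnI1 insertI1 split_list)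
      have nv: "set cs' \<inter> vertices \<L> = {}" using set_subset_pcurve[of cs'] cs'(2) cv True by blast
      have "set (p # vs) \<subseteq> L"
        by (rule chain_nonvertex_line[OF _ _ pq(1) LM(1)])
          (use cs'(1) chain_append_last[of \<L> us p vs] nv in \<open>auto simp: uv\<close>)
      moreover have "set (p # rev us) \<subseteq> L"
      proof (rule chain_nonvertex_line[OF _ _ pq(1) LM(1)])
        have "chain \<L> (us @ [p])" using cs'(1) chain_append_last[of \<L> us p vs] by (simp add: uv)
        then show "chain \<L> (p # rev us)" using chain_rev[of \<L> "us @ [p]"] by simp
        show "set (p # rev us) \<inter> vertices \<L> = {}" using nv by (auto simp: uv)
      qed
      ultimately have "q \<in> L" using cs'(3) uv by auto
      moreover have "q \<notin> vertices \<L>" using True pq by blast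
      ultimately show ?thesis using pq LM by (auto simp: vertices_def)
    qed
    have "num_visited \<L> qs \<le> 1"
      unfolding num_visited_def by (rule card_le_Suc0_iff_eq[THEN iffD2, unfolded One_nat_def[symmetric]])
        (use fin uniq in auto)
    also have "1 \<le> card {L\<in>\<L>. L \<inter> set [z] \<noteq> {}}"
    proof -
      have "L1 \<in> {L\<in>\<L>. L \<inter> set [z] \<noteq> {}}" using L12 by auto
      then have "card {L\<in>\<L>. L \<inter> set [z] \<noteq> {}} > 0" using fin by (subst card_gt_0_iff) auto
      then show ?thesis by simp
    qed
    finally show ?thesis
    proof (intro that[of "[z]"])
      show "chain \<L> ([z] @ [hd [z]])" using L12 by (auto simp: share_def)
      show "cyc dist [z] \<le> route_length qs" using route_length_eq[OF qs(1)] plen_nonneg by (simp add: cyc_def)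
    qed (use z in simp_all)
  next
    case False
    then obtain v0 where v0: "v0 \<in> vertices \<L>" "v0 \<in> curve qs" by blast
    have "\<exists>z. z \<in> L \<and> z \<in> vertices \<L> \<and> z \<in> curve qs" if L: "L \<in> \<L>" "L \<inter> curve qs \<noteq> {}" for L
    proof -
      obtain p where p: "p \<in> L" "p \<in> curve qs" using L(2) by blast
      obtain cs' where cs': "chain \<L> cs'" "pcurve cs' = pcurve cs" "set cs' = {p, v0} \<union> set cs"
        using chain_insert_set[OF conv ch, of "{p, v0}"] p v0 cv by auto
      obtain us vs where uv: "cs' = us @ p # vs" using cs'(3) by (metis UnI1 insertI1 split_list)
      have c1: "chain \<L> (p # vs)" using cs'(1) chain_append_last[of \<L> us p vs] by (simp add: uv)
      have "chain \<L> (us @ [p])" using cs'(1) chain_append_last[of \<L> us p vs] by (simp add: uv)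
      then have c2: "chain \<L> (p # rev us)" using chain_rev[of \<L> "us @ [p]"] by simp
      have "v0 \<in> set (p # vs) \<or> v0 \<in> set (p # rev us)" using cs'(3) uv by auto
      then have "\<exists>z\<in>set (p # vs) \<union> set (p # rev us). z \<in> vertices \<L> \<and> z \<in> L"
        using chain_vertex_on_line[OF c1 _ p(1) L(1)] chain_vertex_on_line[OF c2 _ p(1) L(1)] v0(1) by blast
      moreover have "set (p # vs) \<union> set (p # rev us) \<subseteq> curve qs"
        using set_subset_pcurve[of cs'] cs'(2) cv by (auto simp: uv)
      ultimately show ?thesis by blast
    qed
    then obtain f where f: "\<And>L. L \<in> \<L> \<Longrightarrow> L \<inter> curve qs \<noteq> {} \<Longrightarrow> f L \<in> L \<and> f L \<in> vertices \<L> \<and> f L \<in> curve qs"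
      by metis
    define S where "S = insert v0 (f ` {L\<in>\<L>. L \<inter> curve qs \<noteq> {}})"
    have Sc: "S \<subseteq> curve qs" "S \<subseteq> vertices \<L>" unfolding S_def using f v0 by blast+
    have S: "finite S" "S \<subseteq> pcurve cs" "S \<subseteq> vertices \<L>" using Sc fin cv by (simp_all add: S_def)
    obtain cs' where cs': "chain \<L> cs'" "plen cs' = plen cs" "hd cs' = hd cs" "last cs' = last cs" "set cs' = S \<union> set cs"
      using chain_insert_set[OF conv ch S(1,2)] by blast
    have hl: "hd cs' = last cs'" using cs'(3,4) qs(1) by (simp add: cs_def)
    have "cs' \<noteq> []" using cs'(5) by (auto simp: cs_def)
    then obtain us where us: "cs' = us @ [hd cs']" using hl by (metis append_butlast_last_id)
    show ?thesis
    proof (cases "us = []")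
      case True
      then have "set cs' = {hd cs'}" using us by (metis append_Nil empty_set list.simps(15))
      then have "S \<subseteq> {hd cs'}" using cs'(5) by blast
      moreover have "v0 \<in> S" by (simp add: S_def)
      ultimately have "S = {v0}" by blast
      then have fv: "f L = v0" if "L \<in> \<L>" "L \<inter> curve qs \<noteq> {}" for L using that by (simp add: S_def) blast
      show ?thesis
      proof (rule that[of "[v0]"])
        show "chain \<L> ([v0] @ [hd [v0]])" using v0(1) by (auto simp: share_def vertices_def)
        show "cyc dist [v0] \<le> route_length qs" using route_length_eq[OF qs(1)] plen_nonneg by (simp add: cyc_def)
        show "num_visited \<L> qs \<le> card {L\<in>\<L>. L \<inter> set [v0] \<noteq> {}}"
          unfolding num_visited_def
        proof (intro card_mono)
          show "{L\<in>\<L>. L \<inter> curve qs \<noteq> {}} \<subseteq> {L\<in>\<L>. L \<inter> set [v0] \<noteq> {}}"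
            using f fv by fastforce
        qed (use fin in simp)
      qed (use v0 in simp_all)
    next
      case False
      then have us_hd: "cs' = us @ [hd us]" using us by (metis hd_append2)
      have "set cs' = insert (hd us) (set us)" by (subst us_hd) simp
      then have set_us: "set us = S \<union> set cs" using cs'(5) hd_in_set[OF False] by (simp add: insert_absorb)
      have "v0 \<in> set us" unfolding set_us S_def by simp
      then obtain ls rs where lr: "us = ls @ v0 # rs" by (meson split_list)
      \<comment> \<open>The tour is opened at \<open>v0\<close> so that it ends in a crossing, as
        \<open>chain_filter_vertices\<close> requires.\<close>
      have chr: "chain \<L> (v0 # (rs @ ls @ [v0]))" using chain_rotate[of \<L> ls v0 rs] cs'(1) us_hd lr by simp
      define ys where "ys = v0 # filter (\<lambda>z. z \<in> vertices \<L>) (rs @ ls)"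
      have fil: "v0 # filter (\<lambda>z. z \<in> vertices \<L>) (rs @ ls @ [v0]) = ys @ [hd ys]" using v0 by (simp add: ys_def)
      have A: "chain \<L> (ys @ [hd ys])" "plen (ys @ [hd ys]) \<le> plen (v0 # (rs @ ls @ [v0]))"
        using chain_filter_vertices[OF chr] v0(1) unfolding fil by simp_all
      show ?thesis
      proof (rule that[of ys])
        show "ys \<noteq> []" by (simp add: ys_def)
        show "set ys \<subseteq> vertices \<L>" using v0 by (auto simp: ys_def)
        show "chain \<L> (ys @ [hd ys])" by (rule A)
        have "plen (v0 # (rs @ ls @ [v0])) = cyc dist ((v0 # rs) @ ls)" by (simp add: cyc_def)
        also have "\<dots> = cyc dist us" by (simp only: cyc_rotate[of dist "v0 # rs" ls] lr)
        also have "\<dots> = route_length qs" using cs'(2) us_hd route_length_eq[OF qs(1)] by (simp add: cyc_def cs_def)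
        finally show "cyc dist ys \<le> route_length qs" using A(2) by (simp add: cyc_def)
        have "S \<subseteq> set ys" using set_us S(3) lr by (auto simp: ys_def)
        moreover have "f L \<in> S" if "L \<in> \<L>" "L \<inter> curve qs \<noteq> {}" for L unfolding S_def using that by blast
        ultimately have "L \<inter> set ys \<noteq> {}" if "L \<in> \<L>" "L \<inter> curve qs \<noteq> {}" for L
          using f[OF that] that by blast
        then show "num_visited \<L> qs \<le> card {L\<in>\<L>. L \<inter> set ys \<noteq> {}}"
          unfolding num_visited_def using fin by (intro card_mono) auto
      qed
    qed
  qed
qed

text \<open>\<open>\<theta>\<close> lists the angles of the oriented normals over a full turn and
  \<open>c\<close> their offsets. Indices \<open>i\<close> and \<open>i + n\<close> are the two
  orientations of one line, and index \<open>2 * n\<close> repeats index 0. Gaps below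
  \<open>pi\<close> reflect that the lines are not all parallel.\<close>

locale sorted_lines =
  fixes \<L> :: "(real \<times> real) set set" and n :: nat and \<theta> c :: "nat \<Rightarrow> real"
  assumes angle_mono: "i \<le> j \<Longrightarrow> j \<le> 2 * n \<Longrightarrow> \<theta> i \<le> \<theta> j"
    and angle_half: "i \<le> n \<Longrightarrow> \<theta> (i + n) = \<theta> i + pi"
    and offset_half: "i \<le> n \<Longrightarrow> c (i + n) = - c i"
    and lines_bij: "bij_betw (\<lambda>i. {z. dir (\<theta> i) \<bullet> z = c i}) {..<n} \<L>"
    and angle_gap: "i < 2 * n \<Longrightarrow> \<theta> (Suc i) - \<theta> i < pi"
    and vertices_nonempty: "vertices \<L> \<noteq> {}"
begin

definition line :: "nat \<Rightarrow> (real \<times> real) set" where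
  "line i = {z. dir (\<theta> i) \<bullet> z = c i}"

text \<open>If \<open>z\<close> is extreme in direction \<open>\<theta> i\<close>, the value 1 means
  that the whole tour lies strictly behind line \<open>i\<close>.\<close>

definition miss :: "nat \<Rightarrow> real \<times> real \<Rightarrow> nat" where
  "miss i z = (if dir (\<theta> i) \<bullet> z < c i then 1 else 0)"

lemma bij_line: "bij_betw line {..<n} \<L>"
proof -
  have "line = (\<lambda>i. {z. dir (\<theta> i) \<bullet> z = c i})" by (simp add: fun_eq_iff line_def)
  then show ?thesis using lines_bij by simp
qed

lemma finite_lines: "finite \<L>"
  using bij_line bij_betw_finite by blast

lemma card_lines: "card \<L> = n"
  using bij_betw_same_card[OF bij_line] by simp

lemma n_pos: "n > 0"
proof -
  have "\<L> \<noteq> {}" using vertices_nonempty unfolding vertices_def by blast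
  then have "card \<L> > 0" using finite_lines by (simp add: card_gt_0_iff)
  then show ?thesis using card_lines by simp
qed

lemma angle_period: "\<theta> (2 * n) = \<theta> 0 + 2 * pi"
proof -
  have "\<theta> (0 + n) = \<theta> 0 + pi" "\<theta> (n + n) = \<theta> n + pi" by (intro angle_half; simp)+
  then show ?thesis unfolding mult_2 by simp
qed

lemma dir_half: "i \<le> n \<Longrightarrow> dir (\<theta> (i + n)) = - dir (\<theta> i)"
  using angle_half[of i] by (simp add: dir_def)

lemma line_half: "i \<le> n \<Longrightarrow> line (i + n) = line i"
  unfolding line_def by (simp add: dir_half offset_half)

lemma line_in: "i \<le> 2 * n \<Longrightarrow> line i \<in> \<L>"
proof -
  have *: "line i \<in> \<L>" if "i < n" for i using bij_betwE[OF bij_line] that by simp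
  assume i: "i \<le> 2 * n"
  consider "i < n" | "n \<le> i" "i < 2 * n" | "i = 2 * n" using i by linarith
  then show ?thesis
  proof cases
    case 2
    then show ?thesis using *[of "i - n"] line_half[of "i - n"] by simp
  next
    case 3
    then show ?thesis using *[of 0] line_half[of 0] line_half[of n] n_pos by (simp add: mult_2)
  qed (rule *)
qed

lemma affine_lines: "\<forall>L\<in>\<L>. affine L"
proof
  fix L assume "L \<in> \<L>"
  then obtain i where "L = line i" using bij_betw_imp_surj_on[OF bij_line] by blast
  then show "affine L" by (simp add: line_def affine_hyperplane)
qed

lemma convex_lines: "\<forall>L\<in>\<L>. convex L"
  using affine_lines affine_imp_convex by blast

lemma line_eq_cases:
  assumes "1 \<le> i" "i < j" "j \<le> 2 * n" "line i = line j"
  shows "j = i + n"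
proof -
  define r where "r k = (if k < n then k else if k < 2 * n then k - n else 0)" for k
  have r: "r k < n" "line (r k) = line k" if "k \<le> 2 * n" for k
  proof -
    show "r k < n" using n_pos that by (auto simp: r_def)
    show "line (r k) = line k"
      using line_half[of "k - n"] line_half[of 0] line_half[of n] that by (auto simp: r_def mult_2)
  qed
  have "r i = r j"
    using bij_betw_imp_inj_on[OF bij_line] r[of i] r[of j] assms by (auto simp: inj_on_def)
  then show ?thesis using assms by (auto simp: r_def split: if_splits)
qed

text \<open>The cost \<open>D\<close> is only required to be at most the length of every chain
  between its ends, so that shortest-path tables without confinement to a hull can be inserted. Each
  line counted by \<open>miss\<close> has all tour vertices strictly on one side.\<close>

lemma candidate:
  assumes "qs \<noteq> []" "curve qs \<subseteq> \<Union>\<L>"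
  obtains v where "\<And>i. i \<le> 2 * n \<Longrightarrow> v i \<in> vertices \<L>" "v (2 * n) = v 0"
    "\<And>i. i < 2 * n \<Longrightarrow> v (Suc i) = v i \<or>
       dir (\<theta> i) \<bullet> (v (Suc i) - v i) \<le> 0 \<and> 0 < dir (\<theta> (Suc i)) \<bullet> (v (Suc i) - v i)"
    "\<And>D. (\<And>xs. xs \<noteq> [] \<Longrightarrow> chain \<L> xs \<Longrightarrow> hd xs \<in> vertices \<L> \<Longrightarrow> last xs \<in> vertices \<L> \<Longrightarrow>
         D (hd xs) (last xs) \<le> plen xs) \<Longrightarrow> (\<Sum>i<2 * n. D (v i) (v (Suc i))) \<le> route_length qs"
    "(\<Sum>i<2 * n. miss (Suc i) (v (Suc i))) + num_visited \<L> qs \<le> n"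
proof -
  obtain ys where ys: "ys \<noteq> []" "set ys \<subseteq> vertices \<L>" "chain \<L> (ys @ [hd ys])"
    "cyc dist ys \<le> route_length qs" "num_visited \<L> qs \<le> card {L\<in>\<L>. L \<inter> set ys \<noteq> {}}"
    using vertex_tour_of_route[OF finite_lines affine_lines vertices_nonempty assms] by blast
  have pos: "0 < 2 * n" using n_pos by simp
  obtain v where v: "\<And>i. i \<le> 2 * n \<Longrightarrow> v i \<in> set ys"
    "\<And>i p. i \<le> 2 * n \<Longrightarrow> p \<in> set ys \<Longrightarrow> dir (\<theta> i) \<bullet> p \<le> dir (\<theta> i) \<bullet> v i"
    "v (2 * n) = v 0"
    "\<And>i. i < 2 * n \<Longrightarrow> v (Suc i) = v i \<or>
       dir (\<theta> i) \<bullet> (v (Suc i) - v i) \<le> 0 \<and> 0 < dir (\<theta> (Suc i)) \<bullet> (v (Suc i) - v i)"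
    "(\<Sum>i<2 * n. gdist \<L> (convex hull (set ys)) (v i) (v (Suc i))) \<le> cyc dist ys"
    using direction_tour[of \<L> ys "2 * n" \<theta>, OF convex_lines ys(1,3) pos angle_mono angle_period angle_gap] by blast
  let ?H = "convex hull (set ys)"
  show ?thesis
  proof (rule that[of v])
    show "v i \<in> vertices \<L>" if "i \<le> 2 * n" for i using v(1)[OF that] ys(2) by blast
    show "v (2 * n) = v 0" by (rule v)
    show "v (Suc i) = v i \<or>
       dir (\<theta> i) \<bullet> (v (Suc i) - v i) \<le> 0 \<and> 0 < dir (\<theta> (Suc i)) \<bullet> (v (Suc i) - v i)" if "i < 2 * n" for i
      by (rule v(4)[OF that])
    show "(\<Sum>i<2 * n. D (v i) (v (Suc i))) \<le> route_length qs"
      if D: "\<And>xs. xs \<noteq> [] \<Longrightarrow> chain \<L> xs \<Longrightarrow> hd xs \<in> vertices \<L> \<Longrightarrow> last xs \<in> vertices \<L> \<Longrightarrow>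
         D (hd xs) (last xs) \<le> plen xs" for D
    proof -
      have "(\<Sum>i<2 * n. D (v i) (v (Suc i))) \<le> (\<Sum>i<2 * n. gdist \<L> ?H (v i) (v (Suc i)))"
      proof (rule sum_mono)
        fix i assume "i \<in> {..<2 * n}"
        then have i: "v i \<in> set ys" "v (Suc i) \<in> set ys" using v(1) by auto
        have "set (ys @ [hd ys]) \<subseteq> ?H" using ys(1) hull_subset[of "set ys" convex] by auto
        from walks_nonempty[OF ys(3) this] i have ne: "walks \<L> ?H (v i) (v (Suc i)) \<noteq> {}" by simp
        show "D (v i) (v (Suc i)) \<le> gdist \<L> ?H (v i) (v (Suc i))"
        proof (rule gdist_ge[OF ne])
          fix xs assume xs: "xs \<in> walks \<L> ?H (v i) (v (Suc i))"
          then have "hd xs = v i" "last xs = v (Suc i)" "xs \<noteq> []" "chain \<L> xs" by (simp_all add: walks_def)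
          moreover from this(1,2) have "hd xs \<in> vertices \<L>" "last xs \<in> vertices \<L>" using i ys(2) by auto
          ultimately show "D (v i) (v (Suc i)) \<le> plen xs" using D[of xs] by simp
        qed
      qed
      then show ?thesis using v(5) ys(4) by linarith
    qed
    define M where "M = {i \<in> {1..2 * n}. dir (\<theta> i) \<bullet> v i < c i}"
    have below: "dir (\<theta> i) \<bullet> p < c i" if "i \<in> M" "p \<in> set ys" for i p
      using v(2)[of i p] that by (simp add: M_def)
    have "(\<Sum>i<2 * n. miss (Suc i) (v (Suc i))) = (\<Sum>i\<in>{1..2 * n}. miss i (v i))"
      by (simp add: sum.atLeast1_atMost_eq)
    also have "\<dots> = card M" by (simp add: miss_def M_def sum.If_cases Int_def)
    also have "\<dots> = card (line ` M)"
    proof -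
      \<comment> \<open>The two orientations of one line are never both counted, since the tour
        would lie strictly on both sides of it.\<close>
      have neq: "line i \<noteq> line j" if ij: "i < j" "i \<in> M" "j \<in> M" for i j
      proof
        assume "line i = line j"
        then have j: "j = i + n" using line_eq_cases[of i j] ij by (simp add: M_def)
        then have "i \<le> n" using ij by (simp add: M_def)
        moreover have "hd ys \<in> set ys" using ys(1) by simp
        ultimately show False
          using below[OF ij(2), of "hd ys"] below[OF ij(3), of "hd ys"] j dir_half[of i] offset_half[of i] by simp
      qed
      have "inj_on line M"
      proof (rule inj_onI)
        fix i j assume "i \<in> M" "j \<in> M" "line i = line j"
        then show "i = j" using neq[of i j] neq[of j i] by (cases i j rule: linorder_cases) simp_all
      qed
      then show ?thesis by (simp add: card_image)
    qed
    also have "\<dots> \<le> card {L\<in>\<L>. L \<inter> set ys = {}}"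
    proof (rule card_mono)
      show "line ` M \<subseteq> {L\<in>\<L>. L \<inter> set ys = {}}"
      proof
        fix L assume "L \<in> line ` M"
        then obtain i where i: "i \<in> M" "L = line i" by blast
        have "p \<notin> line i" if "p \<in> set ys" for p using below[OF i(1) that] by (simp add: line_def)
        then show "L \<in> {L\<in>\<L>. L \<inter> set ys = {}}" using i line_in[of i] by (auto simp: M_def)
      qed
    qed (use finite_lines in simp)
    finally have "(\<Sum>i<2 * n. miss (Suc i) (v (Suc i))) \<le> card {L\<in>\<L>. L \<inter> set ys = {}}" .
    moreover have "card {L\<in>\<L>. L \<inter> set ys = {}} + card {L\<in>\<L>. L \<inter> set ys \<noteq> {}} = n"
    proof -
      have "card ({L\<in>\<L>. L \<inter> set ys = {}} \<union> {L\<in>\<L>. L \<inter> set ys \<noteq> {}}) =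
          card {L\<in>\<L>. L \<inter> set ys = {}} + card {L\<in>\<L>. L \<inter> set ys \<noteq> {}}"
        using finite_lines by (intro card_Un_disjoint) auto
      moreover have "{L\<in>\<L>. L \<inter> set ys = {}} \<union> {L\<in>\<L>. L \<inter> set ys \<noteq> {}} = \<L>" by blast
      ultimately show ?thesis using card_lines by simp
    qed
    ultimately show "(\<Sum>i<2 * n. miss (Suc i) (v (Suc i))) + num_visited \<L> qs \<le> n" using ys(5) by linarith
  qed
qed

text \<open>
  A connected set that avoids a line lies strictly on one of its sides, so each line that is missed
  is counted in one of its two orientations.
\<close>

lemma visited_ge:
  assumes "rs \<noteq> []" "\<And>i. i < 2 * n \<Longrightarrow> v (Suc i) \<in> set rs"
  shows "n \<le> num_visited \<L> rs + (\<Sum>i<2 * n. miss (Suc i) (v (Suc i)))"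
proof -
  define M where "M = {i \<in> {1..2 * n}. dir (\<theta> i) \<bullet> v i < c i}"
  have cv: "curve rs = pcurve (rs @ [hd rs])" using assms(1) by (rule curve_eq)
  have "connected (curve rs)" unfolding cv by (intro path_connected_imp_connected path_connected_pcurve)
  have rs: "set rs \<subseteq> curve rs" unfolding cv using set_subset_pcurve[of "rs @ [hd rs]"] by simp
  have vr: "v i \<in> curve rs" if "1 \<le> i" "i \<le> 2 * n" for i using assms(2)[of "i - 1"] rs that by auto
  have "{L\<in>\<L>. L \<inter> curve rs = {}} \<subseteq> line ` M"
  proof
    fix L assume L: "L \<in> {L\<in>\<L>. L \<inter> curve rs = {}}"
    then obtain i where i: "i < n" "L = line i" using bij_betw_imp_surj_on[OF bij_line] by blast
    define f where "f z = dir (\<theta> i) \<bullet> z" for z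
    have "connected (f ` curve rs)" unfolding f_def
      by (intro connected_continuous_image continuous_intros \<open>connected (curve rs)\<close>)
    moreover have "c i \<notin> f ` curve rs" using L i by (auto simp: f_def line_def)
    ultimately have side: "(\<forall>y\<in>f ` curve rs. y < c i) \<or> (\<forall>y\<in>f ` curve rs. c i < y)"
      by (metis connectedD_interval linorder_not_le order_le_less)
    show "L \<in> line ` M"
    proof (cases "\<forall>y\<in>f ` curve rs. y < c i")
      case True
      show ?thesis
      proof (cases "i = 0")
        case False
        then have "i \<in> M" using True i(1) vr[of i] by (simp add: M_def f_def)
        then show ?thesis using i by blast
      next
        case i0: True
        \<comment> \<open>The sum covers indices 1 to \<open>2 * n\<close>, so orientation 0 is
          found at its repetition \<open>2 * n\<close>.\<close>
        have d: "dir (\<theta> (2 * n)) = dir (\<theta> 0)" unfolding angle_period by simp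
        have cc: "c (2 * n) = c 0" using offset_half[of 0] offset_half[of n] by (simp add: mult_2)
        have "2 * n \<in> M" using True i0 d cc vr[of "2 * n"] n_pos by (simp add: M_def f_def)
        moreover have "line (2 * n) = line i" by (simp add: line_def d cc i0)
        ultimately show ?thesis using i by blast
      qed
    next
      case False
      then have "\<forall>y\<in>f ` curve rs. c i < y" using side by blast
      then have "c i < dir (\<theta> i) \<bullet> v (i + n)" using vr[of "i + n"] i n_pos by (simp add: f_def)
      then have "i + n \<in> M" using i n_pos dir_half[of i] offset_half[of i] by (simp add: M_def)
      then show ?thesis using i line_half[of i] by auto
    qed
  qed
  then have "card {L\<in>\<L>. L \<inter> curve rs = {}} \<le> card (line ` M)" by (intro card_mono) (simp_all add: M_def)
  also have "\<dots> \<le> card M" by (intro card_image_le) (simp add: M_def)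
  also have "card M = (\<Sum>i\<in>{1..2 * n}. miss i (v i))" by (simp add: miss_def M_def sum.If_cases Int_def)
  also have "\<dots> = (\<Sum>i<2 * n. miss (Suc i) (v (Suc i)))" by (simp add: sum.atLeast1_atMost_eq)
  finally have "card {L\<in>\<L>. L \<inter> curve rs = {}} \<le> (\<Sum>i<2 * n. miss (Suc i) (v (Suc i)))" .
  moreover have "card {L\<in>\<L>. L \<inter> curve rs = {}} + num_visited \<L> rs = n"
  proof -
    have "card ({L\<in>\<L>. L \<inter> curve rs = {}} \<union> {L\<in>\<L>. L \<inter> curve rs \<noteq> {}}) =
        card {L\<in>\<L>. L \<inter> curve rs = {}} + card {L\<in>\<L>. L \<inter> curve rs \<noteq> {}}"
      using finite_lines by (intro card_Un_disjoint) auto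
    moreover have "{L\<in>\<L>. L \<inter> curve rs = {}} \<union> {L\<in>\<L>. L \<inter> curve rs \<noteq> {}} = \<L>" by blast
    ultimately show ?thesis using card_lines by (simp add: num_visited_def)
  qed
  ultimately show ?thesis by linarith
qed

text \<open>The directions with positive product with \<open>w\<close> form an open half-circle,
  entered once per turn. In angles: the points just after two entries would be at least
  \<open>pi\<close> apart both ways round, hence opposite, and the product cannot be positive at
  both.\<close>

lemma upcrossing_unique:
  assumes "i < j" "j < 2 * n" "dir (\<theta> i) \<bullet> w \<le> 0" "0 < dir (\<theta> (Suc i)) \<bullet> w"
    "dir (\<theta> j) \<bullet> w \<le> 0" "0 < dir (\<theta> (Suc j)) \<bullet> w"
  shows False
proof -
  have t: "\<theta> i \<le> \<theta> (Suc i)" "\<theta> (Suc i) \<le> \<theta> j" "\<theta> j \<le> \<theta> (Suc j)" "\<theta> (Suc j) \<le> \<theta> i + 2 * pi"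
    using angle_mono[of i "Suc i"] angle_mono[of "Suc i" j] angle_mono[of j "Suc j"]
      angle_mono[of "Suc j" "2 * n"] angle_mono[of 0 i] angle_period assms(1,2) by simp_all
  have "\<theta> (Suc j) - \<theta> (Suc i) \<ge> pi"
    using dir_between[of "\<theta> (Suc i)" "\<theta> j" "\<theta> (Suc j)" w] t assms by linarith
  moreover have "\<theta> (Suc i) + 2 * pi - \<theta> (Suc j) \<ge> pi"
    using dir_between[of "\<theta> (Suc j)" "\<theta> i + 2 * pi" "\<theta> (Suc i) + 2 * pi" w] t assms
    unfolding dir_add_2pi by linarith
  ultimately have "\<theta> (Suc j) = \<theta> (Suc i) + pi" by linarith
  then have "dir (\<theta> (Suc j)) = - dir (\<theta> (Suc i))" by (simp add: dir_def)
  then show False using assms(4,6) by simp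
qed

end

section \<open>Enumerating and counting transitions\<close>

definition triples :: "(nat \<Rightarrow> nat \<Rightarrow> nat \<Rightarrow> bool) \<Rightarrow> nat \<Rightarrow> nat \<Rightarrow> (nat \<times> nat \<times> nat) list" where
  "triples P k N = concat (map (\<lambda>i. concat (map (\<lambda>v. concat (map (\<lambda>w.
     if P i v w then [(i, v, w)] else []) [0..<N])) [0..<N])) [0..<k])"

lemma set_triples: "set (triples P k N) = {(i, v, w). i < k \<and> v < N \<and> w < N \<and> P i v w}"
  by (auto simp: triples_def)

lemma sorted_triples: "sorted (map fst (triples P k N))"
proof (induction k)
  case (Suc k)
  have eq: "triples P (Suc k) N = triples P k N @ concat (map (\<lambda>v. concat (map (\<lambda>w.
     if P k v w then [(k, v, w)] else []) [0..<N])) [0..<N])" (is "_ = _ @ ?b") by (simp add: triples_def)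
  have "map fst ?b = replicate (length ?b) k"
    by (intro replicate_eqI) auto
  then have "sorted (map fst ?b)" by simp
  moreover have "\<forall>x\<in>set (map fst (triples P k N)). \<forall>y\<in>set (map fst ?b). x \<le> y"
    by (auto simp: set_triples)
  ultimately show ?case using Suc unfolding eq by (simp add: sorted_append)
qed (simp add: triples_def)

lemma length_concat_map: "length (concat (map f [0..<k])) = (\<Sum>i<k. length (f i))"
  by (induction k) auto

text \<open>A pair of distinct vertices is admissible at one index at most, which gives
  \<open>N * N\<close>; a constant pair may occur at all \<open>k\<close> indices, which gives
  \<open>k * N\<close>. This saves a factor linear in the number of lines over all triples.\<close>

lemma length_triples_le:
  assumes "\<And>i j v w. i < j \<Longrightarrow> j < k \<Longrightarrow> v \<noteq> w \<Longrightarrow> v < N \<Longrightarrow> w < N \<Longrightarrow> P i v w \<Longrightarrow> P j v w \<Longrightarrow> False"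
  shows "length (triples P k N) \<le> N * N + k * N"
proof -
  have *: "(\<Sum>i<k. (if P i v w then 1 else 0)) \<le> (1 + (if v = w then k else 0) :: nat)" if "v < N" "w < N" for v w
  proof -
    have "(\<Sum>i<k. (if P i v w then 1 else 0 :: nat)) = card {i\<in>{..<k}. P i v w}" by (simp add: sum.If_cases Int_def)
    also have "\<dots> \<le> (1 + (if v = w then k else 0))"
    proof (cases "v = w")
      case True
      have "card {i\<in>{..<k}. P i v w} \<le> card {..<k}" by (intro card_mono) auto
      then show ?thesis using True by simp
    next
      case False
      have "card {i\<in>{..<k}. P i v w} \<le> Suc 0"
      proof (subst card_le_Suc0_iff_eq)
        have "i = j" if "i < k" "P i v w" "j < k" "P j v w" for i j
          using assms[of i j v w] assms[of j i v w] that False \<open>v < N\<close> \<open>w < N\<close>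
          by (cases i j rule: linorder_cases) simp_all
        then show "\<forall>i\<in>{i\<in>{..<k}. P i v w}. \<forall>j\<in>{i\<in>{..<k}. P i v w}. i = j" by blast
      qed simp
      then show ?thesis using False by simp
    qed
    finally show ?thesis .
  qed
  have "length (triples P k N) = (\<Sum>i<k. \<Sum>v<N. \<Sum>w<N. (if P i v w then 1 else 0))"
    unfolding triples_def length_concat_map by (intro sum.cong refl) simp
  also have "\<dots> = (\<Sum>v<N. \<Sum>w<N. \<Sum>i<k. (if P i v w then 1 else 0))"
    by (subst sum.swap) (intro sum.cong refl sum.swap)
  also have "\<dots> \<le> (\<Sum>v<N. \<Sum>w<N. 1 + (if v = w then k else 0))"
    by (intro sum_mono *) auto
  also have "\<dots> = N * N + k * N" by (simp add: sum.distrib sum_Suc algebra_simps)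
  finally show ?thesis .
qed

section \<open>Memory layout and normal forms of lines\<close>

declare nats_nwrite_other [simp] reals_rwrite_other [simp]

abbreviation "nn \<equiv> V 0"
abbreviation "nsq \<equiv> NMul nn nn"
abbreviation "ntwo \<equiv> NMul (NConst 2) nn"
abbreviation "R0 \<equiv> ROfNat (NConst 0)"
abbreviation BOr :: "bexp \<Rightarrow> bexp \<Rightarrow> bexp" where "BOr b c \<equiv> BNot (BAnd (BNot b) (BNot c))"

text \<open>Natural and real arrays are numbered separately; a scalar is cell 0 of its own array.
  \<open>aAD\<close> and \<open>aNX\<close> hold adjacency and next hops, \<open>aTI\<close>,
  \<open>aTV\<close>, \<open>aTW\<close> the transitions, \<open>aP\<close> predecessors,
  \<open>bs\<close> and \<open>bm\<close> the selected start and miss count. Among the reals,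
  \<open>aNA\<close>, \<open>aNB\<close>, \<open>aNC\<close> are normalised and \<open>aUA\<close>,
  \<open>aUB\<close>, \<open>aUC\<close> sorted oriented lines, \<open>aX\<close>, \<open>aY\<close>
  vertices, \<open>aD\<close> distances, \<open>aT\<close> costs.\<close>

abbreviation (input) "xi \<equiv> 2::nat"
abbreviation (input) "xj \<equiv> 3::nat"
abbreviation (input) "xk \<equiv> 4::nat"
abbreviation (input) "xl \<equiv> 5::nat"
abbreviation (input) "rk \<equiv> 6::nat"
abbreviation (input) "vc \<equiv> 7::nat"
abbreviation (input) "aAD \<equiv> 8::nat"
abbreviation (input) "aNX \<equiv> 9::nat"
abbreviation (input) "tc \<equiv> 10::nat"
abbreviation (input) "aTI \<equiv> 11::nat"
abbreviation (input) "aTV \<equiv> 12::nat"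
abbreviation (input) "aTW \<equiv> 13::nat"
abbreviation (input) "aP \<equiv> 14::nat"
abbreviation (input) "fnd \<equiv> 15::nat"
abbreviation (input) "bs \<equiv> 16::nat"
abbreviation (input) "bm \<equiv> 17::nat"
abbreviation (input) "cur \<equiv> 18::nat"
abbreviation (input) "cv \<equiv> 19::nat"
abbreviation (input) "cm \<equiv> 20::nat"
abbreviation (input) "tg \<equiv> 21::nat"
abbreviation (input) "vi \<equiv> 22::nat"
abbreviation (input) "vv \<equiv> 23::nat"
abbreviation (input) "vw \<equiv> 24::nat"
abbreviation (input) "mi \<equiv> 25::nat"

abbreviation (input) "aNA \<equiv> 2::nat"
abbreviation (input) "aNB \<equiv> 3::nat"
abbreviation (input) "aNC \<equiv> 4::nat"
abbreviation (input) "rr \<equiv> 5::nat"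
abbreviation (input) "aUA \<equiv> 6::nat"
abbreviation (input) "aUB \<equiv> 7::nat"
abbreviation (input) "aUC \<equiv> 8::nat"
abbreviation (input) "dt \<equiv> 9::nat"
abbreviation (input) "bx \<equiv> 10::nat"
abbreviation (input) "byy \<equiv> 11::nat"
abbreviation (input) "aX \<equiv> 12::nat"
abbreviation (input) "aY \<equiv> 13::nat"
abbreviation (input) "aD \<equiv> 14::nat"
abbreviation (input) "aT \<equiv> 15::nat"
abbreviation (input) "best \<equiv> 16::nat"
abbreviation (input) "vl \<equiv> 17::nat"

text \<open>The representative whose unit normal has angle in \<open>[0, pi)\<close>: the angle is
  then the arc cosine of the first coefficient, and parallel lines get equal normals.\<close>

definition norm_line :: "real \<Rightarrow> real \<Rightarrow> real \<Rightarrow> real \<Rightarrow> real \<Rightarrow> real \<Rightarrow> bool" where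
  "norm_line a b c a' b' c' \<longleftrightarrow> (\<exists>r. r \<noteq> 0 \<and> a' = a / r \<and> b' = b / r \<and> c' = c / r) \<and>
     a' * a' + b' * b' = 1 \<and> (0 < b' \<or> b' = 0 \<and> 0 < a')"

lemma norm_lineI:
  assumes "a \<noteq> 0 \<or> b \<noteq> 0" "r = (if b < 0 \<or> b = 0 \<and> a < 0 then - sqrt (a * a + b * b) else sqrt (a * a + b * b))"
  shows "norm_line a b c (a / r) (b / r) (c / r)"
proof -
  have pos: "a * a + b * b > 0" using assms(1) by (metis sum_squares_gt_zero_iff)
  then have r: "r \<noteq> 0" "r * r = a * a + b * b" using assms(2) by auto
  have "a / r * (a / r) + b / r * (b / r) = (a * a + b * b) / (r * r)" by (simp add: add_divide_distrib)
  then have 1: "a / r * (a / r) + b / r * (b / r) = 1" unfolding r(2)[symmetric] using r(1) by simp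
  have "0 < b / r \<or> b / r = 0 \<and> 0 < a / r"
  proof (cases "b < 0 \<or> b = 0 \<and> a < 0")
    case True
    then have "r < 0" using assms(2) pos by simp
    then show ?thesis using True by (auto simp: divide_neg_neg)
  next
    case False
    then have "r > 0" using assms(2) pos by simp
    then show ?thesis using False assms(1) by (auto simp: zero_less_divide_iff)
  qed
  then show ?thesis using 1 r(1) unfolding norm_line_def by blast
qed

text \<open>\<open>off\<close> is the position of the first coefficient. As \<open>fprog\<close> has
  no empty statement, assigning a cell to itself takes its place, here and below.\<close>

definition normalise :: "nat \<Rightarrow> fprog" where
  "normalise off = (let coef = (\<lambda>k. RCell 0 (NAdd (NConst (off + k)) (NMul (NConst 3) (V xi)))) in
     FFor xi nn (
       FR rr (NConst 0) (RSqrt (RAdd (RMul (coef 0) (coef 0)) (RMul (coef 1) (coef 1)))) ;;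
       FIf (BOr (RLess (coef 1) R0) (BAnd (REq (coef 1) R0) (RLess (coef 0) R0)))
         (FR rr (NConst 0) (RSub R0 (RV rr))) (FR rr (NConst 0) (RV rr)) ;;
       FR aNA (V xi) (RDiv (coef 0) (RV rr)) ;;
       FR aNB (V xi) (RDiv (coef 1) (RV rr)) ;;
       FR aNC (V xi) (RDiv (coef 2) (RV rr))))"

lemma mods_normalise [simp]: "nmods (normalise off) = {xi}" "rmods (normalise off) = {rr, aNA, aNB, aNC}"
  by (auto simp: normalise_def Let_def)

lemma run_normalise:
  assumes n: "nats s 0 0 = n" and nz: "\<And>k. k < n \<Longrightarrow> reals s 0 (off + 3 * k) \<noteq> 0 \<or> reals s 0 (Suc (off + 3 * k)) \<noteq> 0"
  shows "\<forall>k<n. norm_line (reals s 0 (off + 3 * k)) (reals s 0 (Suc (off + 3 * k))) (reals s 0 (Suc (Suc (off + 3 * k))))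
    (reals (run (normalise off) s) aNA k) (reals (run (normalise off) s) aNB k) (reals (run (normalise off) s) aNC k)"
  unfolding normalise_def Let_def
proof (rule run_For[where I="\<lambda>k t. \<forall>j<k. norm_line (reals s 0 (off + 3 * j)) (reals s 0 (Suc (off + 3 * j)))
    (reals s 0 (Suc (Suc (off + 3 * j)))) (reals t aNA j) (reals t aNB j) (reals t aNC j)"], goal_cases)
  case (2 k t)
  have k: "k < n" using 2(1) n by simp
  define A B C where "A = reals s 0 (off + 3 * k)" and "B = reals s 0 (Suc (off + 3 * k))"
    and "C = reals s 0 (Suc (Suc (off + 3 * k)))"
  have AB: "A \<noteq> 0 \<or> B \<noteq> 0" using nz[OF k] by (simp add: A_def B_def)
  have fr: "reals t 0 (off + 3 * k) = A" "reals t 0 (Suc (off + 3 * k)) = B" "reals t 0 (Suc (Suc (off + 3 * k))) = C"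
    using 2(3)[of 0] by (simp_all add: A_def B_def C_def)
  note N = norm_lineI[OF AB HOL.refl, of C]
  show ?case
  proof (cases "B < 0 \<or> B = 0 \<and> A < 0")
    case True
    then show ?thesis using N 2(4) by (simp add: fr less_Suc_eq A_def[symmetric] B_def[symmetric] C_def[symmetric])
  next
    case False
    then show ?thesis using N[unfolded if_not_P[OF False]] 2(4) by (simp add: fr less_Suc_eq A_def[symmetric] B_def[symmetric] C_def[symmetric])
  qed
qed (use n in simp_all)

section \<open>Sorting the directions\<close>

text \<open>Larger values come first, since the first coordinate of a unit normal in the upper
  half-plane decreases with the angle. Ties are broken by index, which makes ranks distinct. Sorting
  by counting is quadratic, cheap enough here.\<close>

definition before :: "(nat \<Rightarrow> real) \<Rightarrow> nat \<Rightarrow> nat \<Rightarrow> bool" where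
  "before f j i \<longleftrightarrow> f i < f j \<or> f j = f i \<and> j < i"

definition srank :: "nat \<Rightarrow> (nat \<Rightarrow> real) \<Rightarrow> nat \<Rightarrow> nat" where
  "srank n f i = card {j. j < n \<and> before f j i}"

lemma rank_mono:
  assumes "before f j i" "j < n"
  shows "srank n f j < srank n f i"
proof -
  have "{k. k < n \<and> before f k j} \<subset> {k. k < n \<and> before f k i}"
    using assms by (auto simp: before_def)
  then show ?thesis unfolding srank_def by (intro psubset_card_mono) auto
qed

lemma before_total: "i \<noteq> j \<Longrightarrow> before f i j \<or> before f j i"
  by (auto simp: before_def)

lemma rank_less: "i < n \<Longrightarrow> srank n f i < n"
proof -
  assume "i < n"
  then have "{j. j < n \<and> before f j i} \<subset> {..<n}" by (auto simp: before_def)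
  then have "srank n f i < card {..<n}" unfolding srank_def by (intro psubset_card_mono) auto
  then show ?thesis by simp
qed

lemma rank_inj: "i < n \<Longrightarrow> j < n \<Longrightarrow> srank n f i = srank n f j \<Longrightarrow> i = j"
  using before_total[of i j f] rank_mono[of f i j n] rank_mono[of f j i n] by (cases "i = j") auto

lemma rank_bij: "bij_betw (srank n f) {..<n} {..<n}"
proof -
  have inj: "inj_on (srank n f) {..<n}" by (intro inj_onI) (auto intro: rank_inj)
  moreover have "srank n f ` {..<n} \<subseteq> {..<n}" by (auto intro: rank_less)
  ultimately show ?thesis unfolding bij_betw_def using endo_inj_surj[of "{..<n}" "srank n f"] by auto
qed

lemma rank_antimono:
  assumes "srank n f i < srank n f j" "i < n" "j < n"
  shows "f j \<le> f i"
proof (rule ccontr)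
  assume "\<not> f j \<le> f i"
  then have "srank n f j < srank n f i" using rank_mono[of f j i n] assms by (simp add: before_def)
  then show False using assms(1) by simp
qed

definition rank_loop :: fprog where
  "rank_loop = FFor xj nn (FIf (BOr (RLess (RCell aNA (V xi)) (RCell aNA (V xj)))
       (BAnd (REq (RCell aNA (V xj)) (RCell aNA (V xi))) (NLess (V xj) (V xi))))
     (FN rk (NConst 0) (NAdd (V rk) (NConst 1))) (FN rk (NConst 0) (V rk)))"

lemma mods_rank_loop [simp]: "nmods rank_loop = {xj, rk}" "rmods rank_loop = {}"
  by (auto simp: rank_loop_def)

lemma run_rank_loop:
  assumes "nats s rk 0 = 0" "nats s 0 0 = n" "nats s xi 0 = i"
  shows "nats (run rank_loop s) rk 0 = srank n (reals s aNA) i"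
  unfolding rank_loop_def
proof (rule run_For[where I="\<lambda>k t. nats t rk 0 = card {j. j < k \<and> before (reals s aNA) j i}"], goal_cases)
  case (2 k t)
  have fr: "nats t xi = nats s xi" "reals t aNA = reals s aNA" using 2(2,3) by simp_all
  have "{j. j < Suc k \<and> before (reals s aNA) j i} =
     (if before (reals s aNA) k i then insert k {j. j < k \<and> before (reals s aNA) j i} else {j. j < k \<and> before (reals s aNA) j i})"
    by (auto simp: less_Suc_eq)
  then show ?case using 2(4) assms(3) by (simp add: fr before_def)
qed (use assms in \<open>simp_all add: srank_def\<close>)

text \<open>Three copies, shifted by \<open>n\<close> and with alternating sign: the two
  orientations and the start of the next turn, which supplies index \<open>2 * n\<close>.\<close>

definition sort_lines :: fprog where
  "sort_lines = FFor xi nn (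
     FN rk (NConst 0) (NConst 0) ;;
     rank_loop ;;
     FR aUA (V rk) (RCell aNA (V xi)) ;;
     FR aUB (V rk) (RCell aNB (V xi)) ;;
     FR aUC (V rk) (RCell aNC (V xi)) ;;
     FR aUA (NAdd (V rk) nn) (RSub R0 (RCell aNA (V xi))) ;;
     FR aUB (NAdd (V rk) nn) (RSub R0 (RCell aNB (V xi))) ;;
     FR aUC (NAdd (V rk) nn) (RSub R0 (RCell aNC (V xi))) ;;
     FR aUA (NAdd (V rk) ntwo) (RCell aNA (V xi)) ;;
     FR aUB (NAdd (V rk) ntwo) (RCell aNB (V xi)) ;;
     FR aUC (NAdd (V rk) ntwo) (RCell aNC (V xi)))"

lemma mods_sort_lines [simp]: "nmods sort_lines = {xi, xj, rk}" "rmods sort_lines = {aUA, aUB, aUC}"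
  by (auto simp: sort_lines_def)

lemma run_sort_lines:
  fixes s :: store
  defines "n \<equiv> nats s 0 0" and "\<rho> \<equiv> srank (nats s 0 0) (reals s aNA)" and "s' \<equiv> run sort_lines s"
  shows "\<forall>i<n. \<forall>(a, a') \<in> {(aNA, aUA), (aNB, aUB), (aNC, aUC)}.
    reals s' a' (\<rho> i) = reals s a i \<and> reals s' a' (\<rho> i + n) = - reals s a i \<and> reals s' a' (\<rho> i + 2 * n) = reals s a i"
  unfolding s'_def sort_lines_def
proof (rule run_For[where I="\<lambda>k t. \<forall>i<k. \<forall>(a, a') \<in> {(aNA, aUA), (aNB, aUB), (aNC, aUC)}.
    reals t a' (\<rho> i) = reals s a i \<and> reals t a' (\<rho> i + n) = - reals s a i \<and> reals t a' (\<rho> i + 2 * n) = reals s a i"], goal_cases)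
  case (2 k t)
  have fr: "nats t 0 = nats s 0" "reals t aNA = reals s aNA" "reals t aNB = reals s aNB" "reals t aNC = reals s aNC"
    using 2(2,3) by simp_all
  have kn: "k < n" using 2(1) by (simp add: n_def)
  define u where "u = run rank_loop (nwrite rk 0 0 (nwrite xi 0 k t))"
  have u: "nats u rk 0 = \<rho> k" "nats u xi 0 = k" "nats u 0 = nats s 0" "reals u = reals t"
  proof -
    show "nats u rk 0 = \<rho> k" unfolding u_def \<rho>_def by (subst run_rank_loop) (simp_all add: fr)
    show "reals u = reals t" by (rule ext) (simp add: u_def run_reals)
  qed (simp_all add: u_def run_nats fr)
  have \<rho>n: "\<rho> i < n" if "i \<le> k" for i using rank_less[of i n] that kn by (simp add: \<rho>_def n_def)
  have \<rho>i: "\<rho> i \<noteq> \<rho> k" if "i < k" for i using rank_inj[of i n k] that kn by (auto simp: \<rho>_def n_def)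
  have distinct: "\<rho> i \<noteq> \<rho> k + n" "\<rho> i + n \<noteq> \<rho> k" "\<rho> i \<noteq> \<rho> k + 2 * n" "\<rho> i + 2 * n \<noteq> \<rho> k"
     "\<rho> i + n \<noteq> \<rho> k + 2 * n" "\<rho> i + 2 * n \<noteq> \<rho> k + n" if "i \<le> k" for i
    using \<rho>n[OF that] \<rho>n[of k] by auto
  have n0: "nats s 0 0 = n" by (simp add: n_def)
  define t' where "t' = run (FN rk (NConst 0) (NConst 0) ;;
     rank_loop ;;
     FR aUA (V rk) (RCell aNA (V xi)) ;;
     FR aUB (V rk) (RCell aNB (V xi)) ;;
     FR aUC (V rk) (RCell aNC (V xi)) ;;
     FR aUA (NAdd (V rk) nn) (RSub R0 (RCell aNA (V xi))) ;;
     FR aUB (NAdd (V rk) nn) (RSub R0 (RCell aNB (V xi))) ;;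
     FR aUC (NAdd (V rk) nn) (RSub R0 (RCell aNC (V xi))) ;;
     FR aUA (NAdd (V rk) ntwo) (RCell aNA (V xi)) ;;
     FR aUB (NAdd (V rk) ntwo) (RCell aNB (V xi)) ;;
     FR aUC (NAdd (V rk) ntwo) (RCell aNC (V xi))) (nwrite xi 0 k t)"
  have val: "reals t' a' x = (if x = \<rho> k + 2 * n then reals s a k else if x = \<rho> k + n then - reals s a k
      else if x = \<rho> k then reals s a k else reals t a' x)"
    if "(a, a') \<in> {(aNA, aUA), (aNB, aUB), (aNC, aUC)}" for a a' x
    using that by (elim insertE emptyE) (simp_all add: t'_def u_def[symmetric] u n0 fr)
  have "\<forall>i<Suc k. \<forall>(a, a') \<in> {(aNA, aUA), (aNB, aUB), (aNC, aUC)}.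
    reals t' a' (\<rho> i) = reals s a i \<and> reals t' a' (\<rho> i + n) = - reals s a i \<and> reals t' a' (\<rho> i + 2 * n) = reals s a i"
  proof (intro allI impI ballI, clarify)
    fix i a a' assume i: "i < Suc k" and a: "(a, a') \<in> {(aNA, aUA), (aNB, aUB), (aNC, aUC)}"
    show "reals t' a' (\<rho> i) = reals s a i \<and> reals t' a' (\<rho> i + n) = - reals s a i \<and> reals t' a' (\<rho> i + 2 * n) = reals s a i"
    proof (cases "i = k")
      case True
      then show ?thesis unfolding val[OF a] using distinct[of k] by simp
    next
      case False
      then have "i < k" using i by simp
      moreover from this 2(4) a have "reals t a' (\<rho> i) = reals s a i \<and> reals t a' (\<rho> i + n) = - reals s a i \<and>
        reals t a' (\<rho> i + 2 * n) = reals s a i" by blast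
      ultimately show ?thesis unfolding val[OF a] using distinct[of i] \<rho>i[of i] by simp
    qed
  qed
  then show ?case unfolding t'_def .
qed (simp_all add: n_def)

section \<open>Rules for nested loops\<close>

definition frame :: "nat set \<Rightarrow> nat set \<Rightarrow> store \<Rightarrow> store \<Rightarrow> bool" where
  "frame A B s t \<longleftrightarrow> (\<forall>a. a \<notin> A \<longrightarrow> nats t a = nats s a) \<and> (\<forall>a. a \<notin> B \<longrightarrow> reals t a = reals s a)"

lemma frame_nats: "frame A B s t \<Longrightarrow> a \<notin> A \<Longrightarrow> nats t a = nats s a"
  and frame_reals: "frame A B s t \<Longrightarrow> a \<notin> B \<Longrightarrow> reals t a = reals s a"
  by (simp_all add: frame_def)

lemma frame_trans: "frame A B s t \<Longrightarrow> frame A' B' t u \<Longrightarrow> A' \<subseteq> A \<Longrightarrow> B' \<subseteq> B \<Longrightarrow> frame A B s u"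
  unfolding frame_def by (metis subsetD)

lemma run_For1:
  assumes "nval e s = K" "x \<notin> nmods c" "I 0 s"
    and "\<And>k t v. I k t \<Longrightarrow> I k (nwrite x 0 v t)"
    and "\<And>k t. k < K \<Longrightarrow> nats t x 0 = k \<Longrightarrow> frame (insert x (nmods c)) (rmods c) s t \<Longrightarrow> I k t \<Longrightarrow> I (Suc k) (run c t)"
  shows "I K (run (FFor x e c) s)"
proof (rule run_For[where I=I])
  fix k t assume *: "k < nval e s" "\<And>a. a \<notin> insert x (nmods c) \<Longrightarrow> nats t a = nats s a"
     "\<And>a. a \<notin> rmods c \<Longrightarrow> reals t a = reals s a" "I k t"
  have "frame (insert x (nmods c)) (rmods c) s (nwrite x 0 k t)"
    using *(2,3) by (simp add: frame_def)
  then show "I (Suc k) (run c (nwrite x 0 k t))" using * assms by (intro assms(5)) simp_all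
qed (use assms in simp_all)

text \<open>The invariant is indexed by the next position to be treated, in lexicographic order;
  \<open>row\<close> identifies the end \<open>(i, M)\<close> of a row with the beginning
  \<open>(Suc i, 0)\<close> of the next.\<close>

lemma run_For2:
  assumes e: "bound_exp e" "bound_val (nats s 0 0) e = K" and f: "bound_exp f" "bound_val (nats s 0 0) f = M"
    and wf: "0 \<notin> nmods c" "x \<notin> nmods c" "y \<notin> nmods c" "x \<noteq> y" "x \<noteq> 0" "y \<noteq> 0"
    and I0: "I 0 0 s"
    and Ix: "\<And>i j t v. I i j t \<Longrightarrow> I i j (nwrite x 0 v t)" and Iy: "\<And>i j t v. I i j t \<Longrightarrow> I i j (nwrite y 0 v t)"
    and row: "\<And>i t. i < K \<Longrightarrow> I i M t \<Longrightarrow> I (Suc i) 0 t"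
    and step: "\<And>i j t. i < K \<Longrightarrow> j < M \<Longrightarrow> nats t x 0 = i \<Longrightarrow> nats t y 0 = j \<Longrightarrow>
      frame (insert x (insert y (nmods c))) (rmods c) s t \<Longrightarrow> I i j t \<Longrightarrow> I i (Suc j) (run c t)"
  shows "I K 0 (run (FFor x e (FFor y f c)) s)"
proof (rule run_For1[where I="\<lambda>i t. I i 0 t"])
  show "nval e s = K" using nval_bound[OF e(1)] e(2) by simp
  fix i t assume i: "i < K" "nats t x 0 = i" "frame (insert x (nmods (FFor y f c))) (rmods (FFor y f c)) s t" "I i 0 t"
  have n: "nats t 0 0 = nats s 0 0" using frame_nats[OF i(3), of 0] wf by simp
  have "I i M (run (FFor y f c) t)"
  proof (rule run_For1[where I="\<lambda>j t. I i j t"])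
    show "nval f t = M" using nval_bound[OF f(1)] f(2) n by simp
    fix j u assume j: "j < M" "nats u y 0 = j" "frame (insert y (nmods c)) (rmods c) t u" "I i j u"
    have "nats u x 0 = i" using frame_nats[OF j(3), of x] i(2) wf by simp
    moreover have "frame (insert x (insert y (nmods c))) (rmods c) s u"
      using frame_trans[OF _ j(3), of "insert x (insert y (nmods c))" "rmods c" s] i(3) by auto
    ultimately show "I i (Suc j) (run c u)" using step i(1) j by blast
  qed (use wf Iy i in simp_all)
  then show "I (Suc i) 0 (run (FFor y f c) t)" using row i(1) by blast
qed (use wf Ix I0 in simp_all)

lemma run_For3:
  assumes d: "bound_exp d" "bound_val (nats s 0 0) d = H"
    and e: "bound_exp e" "bound_val (nats s 0 0) e = K" and f: "bound_exp f" "bound_val (nats s 0 0) f = M"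
    and wf: "0 \<notin> nmods c" "z \<notin> nmods c" "x \<notin> nmods c" "y \<notin> nmods c" "x \<noteq> y" "z \<noteq> x" "z \<noteq> y" "x \<noteq> 0" "y \<noteq> 0" "z \<noteq> 0"
    and I0: "I 0 0 0 s"
    and Iz: "\<And>h i j t v. I h i j t \<Longrightarrow> I h i j (nwrite z 0 v t)"
    and Ix: "\<And>h i j t v. I h i j t \<Longrightarrow> I h i j (nwrite x 0 v t)" and Iy: "\<And>h i j t v. I h i j t \<Longrightarrow> I h i j (nwrite y 0 v t)"
    and layer: "\<And>h t. h < H \<Longrightarrow> I h K 0 t \<Longrightarrow> I (Suc h) 0 0 t"
    and row: "\<And>h i t. h < H \<Longrightarrow> i < K \<Longrightarrow> I h i M t \<Longrightarrow> I h (Suc i) 0 t"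
    and step: "\<And>h i j t. h < H \<Longrightarrow> i < K \<Longrightarrow> j < M \<Longrightarrow> nats t z 0 = h \<Longrightarrow> nats t x 0 = i \<Longrightarrow> nats t y 0 = j \<Longrightarrow>
      frame (insert z (insert x (insert y (nmods c)))) (rmods c) s t \<Longrightarrow> I h i j t \<Longrightarrow> I h i (Suc j) (run c t)"
  shows "I H 0 0 (run (FFor z d (FFor x e (FFor y f c))) s)"
proof (rule run_For1[where I="\<lambda>h t. I h 0 0 t"])
  show "nval d s = H" using nval_bound[OF d(1)] d(2) by simp
  fix h t assume h: "h < H" "nats t z 0 = h" "frame (insert z (nmods (FFor x e (FFor y f c)))) (rmods (FFor x e (FFor y f c))) s t" "I h 0 0 t"
  have n: "nats t 0 0 = nats s 0 0" using frame_nats[OF h(3), of 0] wf by simp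
  have "I h K 0 (run (FFor x e (FFor y f c)) t)"
  proof (rule run_For2[where I="\<lambda>i j t. I h i j t"])
    show "bound_val (nats t 0 0) e = K" "bound_val (nats t 0 0) f = M" using e f n by simp_all
    fix i j u assume u: "i < K" "j < M" "nats u x 0 = i" "nats u y 0 = j" "frame (insert x (insert y (nmods c))) (rmods c) t u" "I h i j u"
    have "nats u z 0 = h" using frame_nats[OF u(5), of z] h(2) wf by simp
    moreover have "frame (insert z (insert x (insert y (nmods c)))) (rmods c) s u"
      using frame_trans[OF _ u(5), of "insert z (insert x (insert y (nmods c)))" "rmods c" s] h(3) by auto
    ultimately show "I h i (Suc j) (run c u)" using step h(1) u by blast
  qed (use wf e f Ix Iy h row in simp_all)
  then show "I (Suc h) 0 0 (run (FFor x e (FFor y f c)) t)" using layer h(1) by blast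
qed (use wf Iz I0 in simp_all)

section \<open>Computing the vertices\<close>

definition detf :: "(nat \<Rightarrow> real) \<Rightarrow> (nat \<Rightarrow> real) \<Rightarrow> nat \<Rightarrow> nat \<Rightarrow> real" where
  "detf A B i j = A i * B j - A j * B i"

text \<open>Cramer's rule for the two line equations.\<close>

definition isect :: "(nat \<Rightarrow> real) \<Rightarrow> (nat \<Rightarrow> real) \<Rightarrow> (nat \<Rightarrow> real) \<Rightarrow> nat \<Rightarrow> nat \<Rightarrow> real \<times> real" where
  "isect A B C i j = ((C i * B j - C j * B i) / detf A B i j, (A i * C j - A j * C i) / detf A B i j)"

definition crossings :: "nat \<Rightarrow> (nat \<Rightarrow> real) \<Rightarrow> (nat \<Rightarrow> real) \<Rightarrow> (nat \<Rightarrow> real) \<Rightarrow> (real \<times> real) set" where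
  "crossings n A B C = {isect A B C i j |i j. i < n \<and> j < n \<and> detf A B i j \<noteq> 0}"

definition edet :: rexp where
  "edet = RSub (RMul (RCell aNA (V xi)) (RCell aNB (V xj))) (RMul (RCell aNA (V xj)) (RCell aNB (V xi)))"

definition eix :: rexp where
  "eix = RDiv (RSub (RMul (RCell aNC (V xi)) (RCell aNB (V xj))) (RMul (RCell aNC (V xj)) (RCell aNB (V xi)))) edet"

definition eiy :: rexp where
  "eiy = RDiv (RSub (RMul (RCell aNA (V xi)) (RCell aNC (V xj))) (RMul (RCell aNA (V xj)) (RCell aNC (V xi)))) edet"

lemma rval_isect [simp]:
  "rval edet s = detf (reals s aNA) (reals s aNB) (nats s xi 0) (nats s xj 0)"
  "rval eix s = fst (isect (reals s aNA) (reals s aNB) (reals s aNC) (nats s xi 0) (nats s xj 0))"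
  "rval eiy s = snd (isect (reals s aNA) (reals s aNB) (reals s aNC) (nats s xi 0) (nats s xj 0))"
  by (simp_all add: edet_def eix_def eiy_def detf_def isect_def)

definition find_base :: fprog where
  "find_base = FFor xi nn (FFor xj nn (FIf (BNot (REq edet R0))
     (FR bx (NConst 0) eix ;; FR byy (NConst 0) eiy) (FR bx (NConst 0) (RV bx))))"

lemma mods_find_base [simp]: "nmods find_base = {xi, xj}" "rmods find_base = {bx, byy}"
  by (auto simp: find_base_def)

lemma run_find_base:
  assumes "crossings (nats s 0 0) (reals s aNA) (reals s aNB) (reals s aNC) \<noteq> {}"
  shows "(reals (run find_base s) bx 0, reals (run find_base s) byy 0)
     \<in> crossings (nats s 0 0) (reals s aNA) (reals s aNB) (reals s aNC)"
proof -
  let ?n = "nats s 0 0" and ?d = "detf (reals s aNA) (reals s aNB)"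
  let ?V = "crossings (nats s 0 0) (reals s aNA) (reals s aNB) (reals s aNC)"
  have "(\<exists>i'<?n. \<exists>j'<?n. (i' < ?n \<or> i' = ?n \<and> j' < 0) \<and> ?d i' j' \<noteq> 0) \<longrightarrow>
    (reals (run find_base s) bx 0, reals (run find_base s) byy 0) \<in> ?V"
    unfolding find_base_def
  proof (rule run_For2[where I="\<lambda>i j t. (\<exists>i'<?n. \<exists>j'<?n. (i' < i \<or> i' = i \<and> j' < j) \<and> ?d i' j' \<noteq> 0) \<longrightarrow>
      (reals t bx 0, reals t byy 0) \<in> ?V" and K="?n" and M="?n"], goal_cases)
    case (15 i j t)
    note fr = frame_nats[OF 15(5)] frame_reals[OF 15(5)]
    show ?case
    proof (cases "?d i j = 0")
      case True
      then show ?thesis using 15(3,4,6) by (simp add: fr less_Suc_eq) blast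
    next
      case False
      then have "isect (reals s aNA) (reals s aNB) (reals s aNC) i j \<in> ?V"
        using 15(1,2) unfolding crossings_def by blast
      then show ?thesis using False 15(3,4) by (simp add: fr)
    qed
  next
    case (14 i t)
    then show ?case by (metis less_Suc_eq not_less_zero)
  qed simp_all
  then show ?thesis using assms unfolding crossings_def by blast
qed

text \<open>One slot per ordered pair of lines. Pairs without a unique intersection, including equal
  indices, receive the base vertex, so that all \<open>n * n\<close> slots hold vertices and later
  loops can range over all of them.\<close>

definition make_vertices :: fprog where
  "make_vertices = FN vc (NConst 0) (NConst 0) ;; FFor xi nn (FFor xj nn (FIf (BNot (REq edet R0))
     (FR aX (V vc) eix ;; FR aY (V vc) eiy) (FR aX (V vc) (RV bx) ;; FR aY (V vc) (RV byy)) ;;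
     FN vc (NConst 0) (NAdd (V vc) (NConst 1))))"

lemma mods_make_vertices [simp]: "nmods make_vertices = {xi, xj, vc}" "rmods make_vertices = {aX, aY}"
  by (auto simp: make_vertices_def)

abbreviation pt :: "store \<Rightarrow> nat \<Rightarrow> real \<times> real" where
  "pt s k \<equiv> (reals s aX k, reals s aY k)"

lemma run_make_vertices:
  assumes base: "(reals s bx 0, reals s byy 0) \<in> crossings (nats s 0 0) (reals s aNA) (reals s aNB) (reals s aNC)"
  shows "pt (run make_vertices s) ` {..<nats s 0 0 * nats s 0 0} = crossings (nats s 0 0) (reals s aNA) (reals s aNB) (reals s aNC)"
proof -
  let ?n = "nats s 0 0" and ?d = "detf (reals s aNA) (reals s aNB)"
  let ?x = "isect (reals s aNA) (reals s aNB) (reals s aNC)"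
  let ?V = "crossings (nats s 0 0) (reals s aNA) (reals s aNB) (reals s aNC)"
  let ?I = "\<lambda>i j t. nats t vc 0 = i * ?n + j \<and> (\<forall>k<i * ?n + j. pt t k \<in> ?V) \<and>
      (\<forall>i' j'. i' < ?n \<longrightarrow> j' < ?n \<longrightarrow> (i' < i \<or> i' = i \<and> j' < j) \<longrightarrow> ?d i' j' \<noteq> 0 \<longrightarrow> (\<exists>k<i * ?n + j. pt t k = ?x i' j'))"
  have "?I ?n 0 (run make_vertices s)"
    unfolding make_vertices_def run.simps(3)
  proof (rule run_For2[where I="?I" and K="?n" and M="?n"], goal_cases)
    case (15 i j t)
    note fr = frame_nats[OF 15(5)] frame_reals[OF 15(5)]
    have I: "nats t vc 0 = i * ?n + j" "\<And>k. k < i * ?n + j \<Longrightarrow> pt t k \<in> ?V"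
      "\<And>i' j'. i' < ?n \<Longrightarrow> j' < ?n \<Longrightarrow> (i' < i \<or> i' = i \<and> j' < j) \<Longrightarrow> ?d i' j' \<noteq> 0 \<Longrightarrow> \<exists>k<i * ?n + j. pt t k = ?x i' j'"
      using 15(6) by blast+
    define z where "z = (if ?d i j = 0 then (reals s bx 0, reals s byy 0) else ?x i j)"
    have ij: "i < ?n" "j < ?n" using 15(1,2) by simp_all
    have zV: "z \<in> ?V" using base ij by (auto simp: z_def crossings_def)
    define t' where "t' = run (FIf (BNot (REq edet R0))
      (FR aX (V vc) eix ;; FR aY (V vc) eiy) (FR aX (V vc) (RV bx) ;; FR aY (V vc) (RV byy)) ;;
       FN vc (NConst 0) (NAdd (V vc) (NConst 1))) t"
    have p: "pt t' k = (if k = i * ?n + j then z else pt t k)" for k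
      using I(1) 15(3,4) by (simp add: t'_def fr z_def)
    have v: "nats t' vc 0 = i * ?n + Suc j" using I(1) by (simp add: t'_def)
    have "\<exists>k<i * ?n + Suc j. pt t' k = ?x i' j'"
      if "i' < ?n" "j' < ?n" "i' < i \<or> i' = i \<and> j' < Suc j" "?d i' j' \<noteq> 0" for i' j'
    proof (cases "i' = i \<and> j' = j")
      case True
      then show ?thesis using that p[of "i * ?n + j"] by (intro exI[of _ "i * ?n + j"]) (simp add: z_def)
    next
      case False
      then have "i' < i \<or> i' = i \<and> j' < j" using that(3) by (auto simp: less_Suc_eq)
      from I(3)[OF that(1,2) this that(4)] obtain k where k: "k < i * ?n + j" "pt t k = ?x i' j'" by blast
      then have "pt t' k = ?x i' j'" using p[of k] by simp
      then show ?thesis using k(1) by (intro exI[of _ k]) simp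
    qed
    moreover have "pt t' k \<in> ?V" if "k < i * ?n + Suc j" for k using p[of k] zV I(2)[of k] that by auto
    ultimately show ?case using v unfolding t'_def[symmetric] by blast
  next
    case (14 i t)
    have eq: "i * ?n + ?n = Suc i * ?n + 0" by simp
    have iff: "(i' < i \<or> i' = i \<and> j' < ?n) \<longleftrightarrow> (i' < Suc i \<or> i' = Suc i \<and> j' < 0)" if "j' < ?n" for i' j'
      using that by auto
    have n: "bound_val (nats (run (FN vc (NConst 0) (NConst 0)) s) 0 0) nn = ?n" by simp
    show ?case using 14(2) iff unfolding eq n by blast
  qed simp_all
  then have I: "\<And>k. k < ?n * ?n \<Longrightarrow> pt (run make_vertices s) k \<in> ?V"
    "\<And>i j. i < ?n \<Longrightarrow> j < ?n \<Longrightarrow> ?d i j \<noteq> 0 \<Longrightarrow> \<exists>k<?n * ?n. pt (run make_vertices s) k = ?x i j" by simp_all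
  show ?thesis
  proof
    show "pt (run make_vertices s) ` {..<?n * ?n} \<subseteq> ?V" using I(1) by blast
    show "?V \<subseteq> pt (run make_vertices s) ` {..<?n * ?n}"
    proof
      fix z assume "z \<in> ?V"
      then obtain i j where "z = ?x i j" "i < ?n" "j < ?n" "?d i j \<noteq> 0" unfolding crossings_def by blast
      then obtain k where "k < ?n * ?n" "pt (run make_vertices s) k = z" using I(2)[of i j] by auto
      then show "z \<in> pt (run make_vertices s) ` {..<?n * ?n}" by blast
    qed
  qed
qed

section \<open>Shortest paths\<close>

definition edist :: "nat \<Rightarrow> nat \<Rightarrow> rexp" where
  "edist x y = (let dx = RSub (RCell aX (V x)) (RCell aX (V y)); dy = RSub (RCell aY (V x)) (RCell aY (V y))
     in RSqrt (RAdd (RMul dx dx) (RMul dy dy)))"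

lemma rval_edist [simp]: "rval (edist x y) s = dist (pt s (nats s x 0)) (pt s (nats s y 0))"
  by (simp add: edist_def Let_def dist_prod_def dist_real_def power2_eq_square)

definition on_line :: "store \<Rightarrow> nat \<Rightarrow> nat \<Rightarrow> bool" where
  "on_line s l p \<longleftrightarrow> reals s aNA l * reals s aX p + reals s aNB l * reals s aY p = reals s aNC l"

definition eon :: "nat \<Rightarrow> nat \<Rightarrow> bexp" where
  "eon x y = REq (RAdd (RMul (RCell aNA (V x)) (RCell aX (V y))) (RMul (RCell aNB (V x)) (RCell aY (V y)))) (RCell aNC (V x))"

lemma bval_eon [simp]: "bval (eon x y) s \<longleftrightarrow> on_line s (nats s x 0) (nats s y 0)"
  by (simp add: eon_def on_line_def)

definition adj :: "store \<Rightarrow> nat \<Rightarrow> nat \<Rightarrow> nat \<Rightarrow> bool" where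
  "adj s n p q \<longleftrightarrow> (\<exists>l<n. on_line s l p \<and> on_line s l q)"

text \<open>Three times the sum of the side lengths of the box, whose corners start at offset
  \<open>b\<close> of the input. It stands in for infinity: any two vertices are joined by at most
  three segments in the box, so the entry already bounds the length of a genuine walk.\<close>

definition big :: "nat \<Rightarrow> store \<Rightarrow> real" where
  "big b s = 3 * ((reals s 0 (b + 2) - reals s 0 b) + (reals s 0 (b + 3) - reals s 0 (b + 1)))"

definition ebig :: "nat \<Rightarrow> rexp" where
  "ebig b = RMul (ROfNat (NConst 3)) (RAdd (RSub (RCell 0 (NConst (b + 2))) (RCell 0 (NConst b)))
     (RSub (RCell 0 (NConst (b + 3))) (RCell 0 (NConst (b + 1)))))"

lemma rval_ebig [simp]: "rval (ebig b) s = big b s"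
  by (simp add: ebig_def big_def)

definition init_dist :: "nat \<Rightarrow> fprog" where
  "init_dist b = FFor xi nsq (FFor xj nsq (
     FR aD (NPr (V xi) (V xj)) (ebig b) ;;
     FN aAD (NPr (V xi) (V xj)) (NConst 0) ;;
     FFor xk nn (FIf (BAnd (eon xk xi) (eon xk xj))
       (FR aD (NPr (V xi) (V xj)) (edist xi xj) ;; FN aAD (NPr (V xi) (V xj)) (NConst 1))
       (FN aAD (NPr (V xi) (V xj)) (NCell aAD (NPr (V xi) (V xj)))))))"

lemma mods_init_dist [simp]: "nmods (init_dist b) = {xi, xj, xk, aAD}" "rmods (init_dist b) = {aD}"
  by (auto simp: init_dist_def)

lemma run_init_dist:
  fixes s :: store and b :: nat
  defines "N \<equiv> nats s 0 0 * nats s 0 0" and "s' \<equiv> run (init_dist b) s"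
  assumes pq: "p < N" "q < N"
  shows "(nats s' aAD (pr p q) = 1 \<longleftrightarrow> adj s (nats s 0 0) p q) \<and>
    reals s' aD (pr p q) = (if adj s (nats s 0 0) p q then dist (pt s p) (pt s q) else big b s)"
proof -
  let ?n = "nats s 0 0"
  let ?ok = "\<lambda>m t p q. let c = \<exists>l<m. on_line s l p \<and> on_line s l q in
      nats t aAD (pr p q) = (if c then 1 else 0) \<and>
      reals t aD (pr p q) = (if c then dist (pt s p) (pt s q) else big b s)"
  let ?I = "\<lambda>i j t. \<forall>p<N. \<forall>q<N. (p < i \<or> p = i \<and> q < j) \<longrightarrow> ?ok ?n t p q"
  have "?I N 0 s'"
    unfolding s'_def init_dist_def
  proof (rule run_For2[where I="?I" and K=N and M=N], goal_cases)
    case (15 i j t)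
    note fr = frame_nats[OF 15(5)] frame_reals[OF 15(5)]
    define u where "u = run (FR aD (NPr (V xi) (V xj)) (ebig b) ;; FN aAD (NPr (V xi) (V xj)) (NConst 0)) t"
    have ud: "nats u xi 0 = i" "nats u xj 0 = j" "nats u 0 = nats s 0" "reals u aX = reals s aX"
       "reals u aY = reals s aY" "reals u aNA = reals s aNA" "reals u aNB = reals s aNB" "reals u aNC = reals s aNC"
      using 15(3,4) by (simp_all add: u_def fr)
    let ?loop = "FFor xk nn (FIf (BAnd (eon xk xi) (eon xk xj))
       (FR aD (NPr (V xi) (V xj)) (edist xi xj) ;; FN aAD (NPr (V xi) (V xj)) (NConst 1))
       (FN aAD (NPr (V xi) (V xj)) (NCell aAD (NPr (V xi) (V xj)))))"
    have "?ok ?n (run ?loop u) i j \<and> (\<forall>p q. \<not> (p = i \<and> q = j) \<longrightarrow>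
       nats (run ?loop u) aAD (pr p q) = nats u aAD (pr p q) \<and> reals (run ?loop u) aD (pr p q) = reals u aD (pr p q))"
    proof (rule run_For1[where I="\<lambda>m r. ?ok m r i j \<and> (\<forall>p q. \<not> (p = i \<and> q = j) \<longrightarrow>
       nats r aAD (pr p q) = nats u aAD (pr p q) \<and> reals r aD (pr p q) = reals u aD (pr p q))"], goal_cases)
      case 3
      have "reals u aD (pr i j) = big b s" "nats u aAD (pr i j) = 0"
        using 15(3,4) by (simp_all add: u_def fr big_def)
      then show ?case by simp
    next
      case (5 m r)
      note fr' = frame_nats[OF 5(3)] frame_reals[OF 5(3)]
      have "on_line r = on_line s" by (simp add: fun_eq_iff on_line_def fr' ud)
      then have onr: "on_line r l p \<longleftrightarrow> on_line s l p" for l p by simp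
      define r' where "r' = run (FIf (BAnd (eon xk xi) (eon xk xj))
        (FR aD (NPr (V xi) (V xj)) (edist xi xj) ;; FN aAD (NPr (V xi) (V xj)) (NConst 1))
        (FN aAD (NPr (V xi) (V xj)) (NCell aAD (NPr (V xi) (V xj))))) r"
      let ?c = "on_line s m i \<and> on_line s m j"
      have r': "nats r' aAD (pr p q) = (if ?c \<and> p = i \<and> q = j then 1 else nats r aAD (pr p q))"
        "reals r' aD (pr p q) = (if ?c \<and> p = i \<and> q = j then dist (pt s i) (pt s j) else reals r aD (pr p q))" for p q
        using 5(2) by (simp_all add: r'_def fr' ud onr)
      have ex: "(\<exists>l<Suc m. on_line s l i \<and> on_line s l j) \<longleftrightarrow> (\<exists>l<m. on_line s l i \<and> on_line s l j) \<or> ?c"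
        by (auto simp: less_Suc_eq)
      obtain cc where cc: "?c = cc" by blast
      have "?ok (Suc m) r' i j" using 5(4) unfolding ex r' Let_def cc by (cases cc) simp_all
      moreover have "nats r' aAD (pr p q) = nats u aAD (pr p q) \<and> reals r' aD (pr p q) = reals u aD (pr p q)"
        if "\<not> (p = i \<and> q = j)" for p q
        using 5(4) that unfolding r' by auto
      ultimately show ?case unfolding r'_def by blast
    qed (simp_all add: ud)
    moreover have "nats u aAD (pr p q) = nats t aAD (pr p q) \<and> reals u aD (pr p q) = reals t aD (pr p q)"
      if "\<not> (p = i \<and> q = j)" for p q using that 15(3,4) by (auto simp: u_def)
    ultimately have "?I i (Suc j) (run ?loop u)"
      using 15(6) by (auto simp: less_Suc_eq Let_def)
    then show ?case by (simp only: run.simps u_def)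
  next
    case (14 i t)
    then show ?case by (auto simp: less_Suc_eq)
  qed (simp_all add: N_def)
  then have "?ok ?n s' p q" using pq by blast
  then show ?thesis unfolding adj_def Let_def by simp
qed

definition floyd_warshall :: fprog where
  "floyd_warshall = FFor xk nsq (FFor xi nsq (FFor xj nsq (
     FIf (RLess (RAdd (RCell aD (NPr (V xi) (V xk))) (RCell aD (NPr (V xk) (V xj)))) (RCell aD (NPr (V xi) (V xj))))
       (FR aD (NPr (V xi) (V xj)) (RAdd (RCell aD (NPr (V xi) (V xk))) (RCell aD (NPr (V xk) (V xj)))))
       (FR aD (NPr (V xi) (V xj)) (RCell aD (NPr (V xi) (V xj)))))))"

lemma mods_floyd_warshall [simp]: "nmods floyd_warshall = {xi, xj, xk}" "rmods floyd_warshall = {aD}"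
  by (auto simp: floyd_warshall_def)

lemma dsum_nonneg: "(\<And>x y. d x y \<ge> 0) \<Longrightarrow> dsum d xs \<ge> 0"
  by (induction xs rule: induct_list012) auto

text \<open>Cutting out everything between the first and the last visit to \<open>k\<close> leaves
  two walks whose intermediate points are below \<open>k\<close>; as weights are nonnegative, the
  total does not grow.\<close>

lemma walk_through:
  fixes w :: "nat \<Rightarrow> nat \<Rightarrow> real"
  assumes w: "\<And>x y. w x y \<ge> 0" and xs: "successively R (p # xs @ [q])" "set xs \<subseteq> {..<Suc k}" "k \<in> set xs"
  shows "\<exists>us vs. set us \<subseteq> {..<k} \<and> set vs \<subseteq> {..<k} \<and> successively R (p # us @ [k]) \<and> successively R (k # vs @ [q]) \<and>
    dsum w (p # us @ [k]) + dsum w (k # vs @ [q]) \<le> dsum w (p # xs @ [q])"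
proof -
  obtain us r where us: "xs = us @ k # r" "k \<notin> set us" using split_list_first[OF xs(3)] by blast
  have less: "x < k" if "x \<in> set xs" "x \<noteq> k" for x using that xs(2) by force
  have split: "successively R (ls @ x # rs) \<longleftrightarrow> successively R (ls @ [x]) \<and> successively R (x # rs)" for ls x rs
    by (cases ls rule: rev_cases) (auto simp: successively_append_iff)
  have s: "successively R (p # us @ [k])" "successively R (k # r @ [q])"
    using xs(1) split[of "p # us" k "r @ [q]"] by (simp_all add: us)
  have d: "dsum w (p # xs @ [q]) = dsum w (p # us @ [k]) + dsum w (k # r @ [q])"
    using dsum_append[of w "p # us" k "r @ [q]"] by (simp add: us)
  have usk: "set us \<subseteq> {..<k}" using less us by auto
  show ?thesis
  proof (cases "k \<in> set r")
    case False
    then have "set r \<subseteq> {..<k}" using less us by auto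
    then show ?thesis using s d usk by (intro exI[of _ us] exI[of _ r]) simp
  next
    case True
    obtain m vs where r: "r = m @ k # vs" "k \<notin> set vs" using split_list_last[OF True] by blast
    have "set vs \<subseteq> {..<k}" using less us r by auto
    moreover have "successively R (k # vs @ [q])" using s(2) split[of "k # m" k "vs @ [q]"] by (simp add: r)
    moreover have "dsum w (k # r @ [q]) = dsum w (k # m @ [k]) + dsum w (k # vs @ [q])"
      using dsum_append[of w "k # m" k "vs @ [q]"] by (simp add: r)
    ultimately show ?thesis using s(1) d usk dsum_nonneg[of w "k # m @ [k]"] w
      by (intro exI[of _ us] exI[of _ vs]) simp
  qed
qed

definition id_walk :: "(nat \<Rightarrow> nat \<Rightarrow> bool) \<Rightarrow> nat \<Rightarrow> nat \<Rightarrow> nat \<Rightarrow> nat list \<Rightarrow> bool" where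
  "id_walk R N p q xs \<longleftrightarrow> xs \<noteq> [] \<and> hd xs = p \<and> last xs = q \<and> set xs \<subseteq> {..<N} \<and> successively R xs"

text \<open>Updating in place is harmless: entries only decrease, each remains realised by a walk,
  and the bound by walks through points below \<open>k\<close>, on which an update relies, holds for
  old and new entries alike.\<close>

lemma run_floyd_warshall:
  fixes s :: store and w :: "nat \<Rightarrow> nat \<Rightarrow> real"
  defines "N \<equiv> nats s 0 0 * nats s 0 0" and "s' \<equiv> run floyd_warshall s"
  assumes w: "\<And>x y. w x y \<ge> 0"
    and edge: "\<And>p q. p < N \<Longrightarrow> q < N \<Longrightarrow> R p q \<Longrightarrow> reals s aD (pr p q) \<le> w p q"
    and sound: "\<And>p q. p < N \<Longrightarrow> q < N \<Longrightarrow> \<exists>xs. id_walk R N p q xs \<and> dsum w xs \<le> reals s aD (pr p q)"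
  shows "(\<forall>p<N. \<forall>q<N. \<exists>xs. id_walk R N p q xs \<and> dsum w xs \<le> reals s' aD (pr p q)) \<and>
    (\<forall>p<N. \<forall>q<N. \<forall>xs. set xs \<subseteq> {..<N} \<longrightarrow> successively R (p # xs @ [q]) \<longrightarrow> reals s' aD (pr p q) \<le> dsum w (p # xs @ [q]))"
proof -
  let ?D = "\<lambda>(t :: store) p q. reals t aD (pr p q)"
  let ?C = "\<lambda>k t p q. \<forall>xs. set xs \<subseteq> {..<k} \<longrightarrow> successively R (p # xs @ [q]) \<longrightarrow> ?D t p q \<le> dsum w (p # xs @ [q])"
  let ?I = "\<lambda>k i j t. (\<forall>p<N. \<forall>q<N. \<exists>xs. id_walk R N p q xs \<and> dsum w xs \<le> ?D t p q) \<and> (\<forall>p<N. \<forall>q<N. ?C k t p q) \<and>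
      (\<forall>p<N. \<forall>q<N. (p < i \<or> p = i \<and> q < j) \<longrightarrow> ?C (Suc k) t p q)"
  have "?I N 0 0 s'"
    unfolding s'_def floyd_warshall_def
  proof (rule run_For3[where I="?I" and H=N and K=N and M=N])
    show "?I 0 0 0 s" using edge sound by simp
    show "?I (Suc h) 0 0 t" if "h < N" "?I h N 0 t" for h t using that by simp
    show "?I h (Suc i) 0 t" if "h < N" "i < N" "?I h i N t" for h i t
      using that by (auto simp: less_Suc_eq)
    fix k i j and t :: store assume *: "k < N" "i < N" "j < N" "nats t xk 0 = k" "nats t xi 0 = i" "nats t xj 0 = j" "?I k i j t"
    define t' where "t' = run (FIf (RLess (RAdd (RCell aD (NPr (V xi) (V xk))) (RCell aD (NPr (V xk) (V xj)))) (RCell aD (NPr (V xi) (V xj))))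
       (FR aD (NPr (V xi) (V xj)) (RAdd (RCell aD (NPr (V xi) (V xk))) (RCell aD (NPr (V xk) (V xj)))))
       (FR aD (NPr (V xi) (V xj)) (RCell aD (NPr (V xi) (V xj))))) t"
    have D': "?D t' p q = (if p = i \<and> q = j then min (?D t i j) (?D t i k + ?D t k j) else ?D t p q)" for p q
      using *(4-6) by (auto simp: t'_def)
    have le: "?D t' p q \<le> ?D t p q" for p q by (simp add: D')
    have S: "\<exists>xs. id_walk R N p q xs \<and> dsum w xs \<le> ?D t p q" if "p < N" "q < N" for p q using *(7) that by blast
    have C: "?D t p q \<le> dsum w (p # xs @ [q])" if "p < N" "q < N" "set xs \<subseteq> {..<k}" "successively R (p # xs @ [q])" for p q xs
      using *(7) that by blast
    have "\<exists>xs. id_walk R N p q xs \<and> dsum w xs \<le> ?D t' p q" if "p < N" "q < N" for p q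
    proof (cases "p = i \<and> q = j \<and> ?D t i k + ?D t k j < ?D t i j")
      case False
      then have "?D t' p q = ?D t p q" by (auto simp: D')
      then show ?thesis using S[OF that] by simp
    next
      case True
      obtain f g where fg: "id_walk R N i k f" "dsum w f \<le> ?D t i k" "id_walk R N k j g" "dsum w g \<le> ?D t k j"
        using S[of i k] S[of k j] * by blast
      obtain us where f: "f = us @ [k]" using fg(1) by (cases f rule: rev_cases) (auto simp: id_walk_def)
      obtain vs where g: "g = k # vs" using fg(3) by (cases g) (auto simp: id_walk_def)
      have "successively R (us @ k # vs)" using fg(1,3)
        by (cases us rule: rev_cases) (auto simp: id_walk_def f g successively_append_iff)
      moreover have "hd (us @ k # vs) = hd (us @ [k])" by (simp add: hd_append)
      ultimately have "id_walk R N i j (us @ k # vs)" using fg(1,3) by (auto simp: id_walk_def f g)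
      moreover have "dsum w (us @ k # vs) \<le> ?D t' i j" using fg(2,4) True dsum_append[of w us k vs] by (simp add: D' f g)
      ultimately show ?thesis using True by blast
    qed
    moreover have "?C k t' p q" if "p < N" "q < N" for p q using C[OF that] le[of p q] by (meson order_trans)
    moreover have "?C (Suc k) t' p q" if "p < N" "q < N" "p < i \<or> p = i \<and> q < Suc j" for p q
    proof (cases "p = i \<and> q = j")
      case False
      then have "?C (Suc k) t p q" using *(7) that by (auto simp: less_Suc_eq)
      then show ?thesis using le[of p q] by (meson order_trans)
    next
      case True
      show ?thesis
      proof (intro allI impI)
        fix xs assume xs: "set xs \<subseteq> {..<Suc k}" "successively R (p # xs @ [q])"
        show "?D t' p q \<le> dsum w (p # xs @ [q])"
        proof (cases "k \<in> set xs")
          case False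
          then have "set xs \<subseteq> {..<k}" using xs(1) by (auto simp: less_Suc_eq)
          from C[OF that(1,2) this xs(2)] le[of p q] show ?thesis by simp
        next
          case kin: True
          obtain us vs where uv: "set us \<subseteq> {..<k}" "set vs \<subseteq> {..<k}" "successively R (p # us @ [k])" "successively R (k # vs @ [q])"
            "dsum w (p # us @ [k]) + dsum w (k # vs @ [q]) \<le> dsum w (p # xs @ [q])"
            using walk_through[where w=w, OF w xs(2,1) kin] by blast
          have "?D t' p q \<le> ?D t i k + ?D t k j" using True by (simp add: D')
          then show ?thesis using C[OF that(1) *(1) uv(1,3)] C[OF *(1) that(2) uv(2,4)] uv(5) True by simp
        qed
      qed
    qed
    ultimately show "?I k i (Suc j) t'" by blast
  qed (simp_all add: N_def)
  then show ?thesis by blast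
qed

text \<open>Hops are recovered from the finished table by exact equality tests, which real
  arithmetic permits. They must have positive length: several numbers may denote one vertex, and
  hops of length zero could cycle.\<close>

definition next_hops :: fprog where
  "next_hops = FFor xi nsq (FFor xj nsq (FFor xk nsq (
     FIf (BAnd (NEq (NCell aAD (NPr (V xi) (V xk))) (NConst 1)) (BAnd (RLess R0 (edist xi xk))
         (REq (RAdd (edist xi xk) (RCell aD (NPr (V xk) (V xj)))) (RCell aD (NPr (V xi) (V xj))))))
       (FN aNX (NPr (V xi) (V xj)) (V xk)) (FN aNX (NPr (V xi) (V xj)) (NCell aNX (NPr (V xi) (V xj)))))))"

lemma mods_next_hops [simp]: "nmods next_hops = {xi, xj, xk, aNX}" "rmods next_hops = {}"
  by (auto simp: next_hops_def)

lemma run_next_hops: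
  fixes s :: store
  defines "N \<equiv> nats s 0 0 * nats s 0 0" and "s' \<equiv> run next_hops s"
    and "good \<equiv> \<lambda>p q r. r < nats s 0 0 * nats s 0 0 \<and> nats s aAD (pr p r) = 1 \<and> 0 < dist (pt s p) (pt s r) \<and>
      dist (pt s p) (pt s r) + reals s aD (pr r q) = reals s aD (pr p q)"
  assumes "p < N" "q < N" "good p q r"
  shows "good p q (nats s' aNX (pr p q))"
proof -
  let ?I = "\<lambda>i j k t. \<forall>p<N. \<forall>q<N. \<forall>r<N. (p < i \<or> p = i \<and> q < j \<or> p = i \<and> q = j \<and> r < k) \<longrightarrow> good p q r \<longrightarrow> good p q (nats t aNX (pr p q))"
  have "?I N 0 0 s'"
    unfolding s'_def next_hops_def
  proof (rule run_For3[where I="?I" and H=N and K=N and M=N])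
    show "?I (Suc h) 0 0 t" if "h < N" "?I h N 0 t" for h t using that by (auto simp: less_Suc_eq)
    show "?I h (Suc i) 0 t" if "h < N" "i < N" "?I h i N t" for h i t
      using that by (auto simp: less_Suc_eq)
    fix i j k and t :: store assume *: "i < N" "j < N" "k < N" "nats t xi 0 = i" "nats t xj 0 = j" "nats t xk 0 = k"
      and f: "frame (insert xi (insert xj (insert xk (nmods (
         FIf (BAnd (NEq (NCell aAD (NPr (V xi) (V xk))) (NConst 1)) (BAnd (RLess R0 (edist xi xk))
         (REq (RAdd (edist xi xk) (RCell aD (NPr (V xk) (V xj)))) (RCell aD (NPr (V xi) (V xj))))))
       (FN aNX (NPr (V xi) (V xj)) (V xk)) (FN aNX (NPr (V xi) (V xj)) (NCell aNX (NPr (V xi) (V xj)))))))))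
      (rmods (FIf (BAnd (NEq (NCell aAD (NPr (V xi) (V xk))) (NConst 1)) (BAnd (RLess R0 (edist xi xk))
         (REq (RAdd (edist xi xk) (RCell aD (NPr (V xk) (V xj)))) (RCell aD (NPr (V xi) (V xj))))))
       (FN aNX (NPr (V xi) (V xj)) (V xk)) (FN aNX (NPr (V xi) (V xj)) (NCell aNX (NPr (V xi) (V xj)))))) s t"
      and I: "?I i j k t"
    note fr = frame_nats[OF f] frame_reals[OF f]
    define t' where "t' = run (FIf (BAnd (NEq (NCell aAD (NPr (V xi) (V xk))) (NConst 1)) (BAnd (RLess R0 (edist xi xk))
         (REq (RAdd (edist xi xk) (RCell aD (NPr (V xk) (V xj)))) (RCell aD (NPr (V xi) (V xj))))))
       (FN aNX (NPr (V xi) (V xj)) (V xk)) (FN aNX (NPr (V xi) (V xj)) (NCell aNX (NPr (V xi) (V xj))))) t"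
    have nx: "nats t' aNX (pr p q) = (if p = i \<and> q = j \<and> good i j k then k else nats t aNX (pr p q))" for p q
      using * by (auto simp: t'_def fr good_def N_def)
    show "?I i j (Suc k) t'"
      using I unfolding nx by (auto simp: less_Suc_eq)
  qed (simp_all add: N_def)
  moreover have "r < N" using assms(6) by (simp add: good_def N_def)
  ultimately show ?thesis using assms(4-6) by blast
qed

section \<open>Transitions\<close>

definition edot :: "nexp \<Rightarrow> rexp \<Rightarrow> rexp \<Rightarrow> rexp" where
  "edot i x y = RAdd (RMul (RCell aUA i) x) (RMul (RCell aUB i) y)"

definition sdot :: "store \<Rightarrow> nat \<Rightarrow> real \<times> real \<Rightarrow> real" where
  "sdot s i z = reals s aUA i * fst z + reals s aUB i * snd z"

lemma rval_edot [simp]: "rval (edot i x y) s = sdot s (nval i s) (rval x s, rval y s)"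
  by (simp add: edot_def sdot_def)

definition trans_ok :: "store \<Rightarrow> nat \<Rightarrow> nat \<Rightarrow> nat \<Rightarrow> bool" where
  "trans_ok s i v w \<longleftrightarrow> v = w \<or> \<not> 0 < sdot s i (pt s w - pt s v) \<and> 0 < sdot s (Suc i) (pt s w - pt s v)"

definition edx :: "nat \<Rightarrow> nat \<Rightarrow> nat \<Rightarrow> rexp" where
  "edx a y x = RSub (RCell a (V y)) (RCell a (V x))"

lemma rval_edx [simp]: "rval (edx a y x) s = reals s a (nats s y 0) - reals s a (nats s x 0)"
  by (simp add: edx_def)

definition push_triple :: fprog where
  "push_triple = FIf (BOr (NEq (V xj) (V xk)) (BAnd (BNot (RLess R0 (edot (V xi) (edx aX xk xj) (edx aY xk xj))))
       (RLess R0 (edot (NAdd (V xi) (NConst 1)) (edx aX xk xj) (edx aY xk xj)))))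
     (FN aTI (V tc) (V xi) ;; FN aTV (V tc) (V xj) ;; FN aTW (V tc) (V xk) ;; FN tc (NConst 0) (NAdd (V tc) (NConst 1)))
     (FN tc (NConst 0) (V tc))"

definition make_triples :: fprog where
  "make_triples = FN tc (NConst 0) (NConst 0) ;; FFor xi ntwo (FFor xj nsq (FFor xk nsq push_triple))"

lemma mods_push_triple [simp]: "nmods push_triple = {aTI, aTV, aTW, tc}" "rmods push_triple = {}"
  by (auto simp: push_triple_def)

lemma mods_make_triples [simp]: "nmods make_triples = {xi, xj, xk, aTI, aTV, aTW, tc}" "rmods make_triples = {}"
  by (auto simp: make_triples_def)

definition holds_triples :: "store \<Rightarrow> (nat \<times> nat \<times> nat) list \<Rightarrow> bool" where
  "holds_triples t xs \<longleftrightarrow> nats t tc 0 = length xs \<and>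
     (\<forall>e<length xs. xs ! e = (nats t aTI e, nats t aTV e, nats t aTW e))"

lemma run_make_triples:
  "holds_triples (run make_triples s) (triples (trans_ok s) (2 * nats s 0 0) (nats s 0 0 * nats s 0 0))"
proof -
  define N where "N = nats s 0 0 * nats s 0 0"
  let ?P = "trans_ok s"
  define row where "row i v m = concat (map (\<lambda>w. if ?P i v w then [(i, v, w)] else []) [0..<m])" for i v m
  define pre where "pre h i j = triples ?P h N @ concat (map (\<lambda>v. row h v N) [0..<i]) @ row h i j" for h i j
  have "holds_triples (run make_triples s) (pre (2 * nats s 0 0) 0 0)"
    unfolding make_triples_def run.simps(3)
  proof (rule run_For3[where I="\<lambda>h i j t. holds_triples t (pre h i j)" and H="2 * nats s 0 0" and K=N and M=N])
    show "holds_triples (run (FN tc (NConst 0) (NConst 0)) s) (pre 0 0 0)"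
      by (simp add: holds_triples_def pre_def triples_def row_def)
    show "holds_triples t (pre (Suc h) 0 0)" if "holds_triples t (pre h N 0)" for h t
      using that by (simp add: pre_def triples_def row_def)
    show "holds_triples t (pre h (Suc i) 0)" if "holds_triples t (pre h i N)" for h i t
      using that by (simp add: pre_def row_def)
    fix h i j t
    assume *: "h < 2 * nats s 0 0" "i < N" "j < N" "nats t xi 0 = h" "nats t xj 0 = i" "nats t xk 0 = j"
      and f: "frame (insert xi (insert xj (insert xk (nmods push_triple)))) (rmods push_triple) (run (FN tc (NConst 0) (NConst 0)) s) t"
      and I: "holds_triples t (pre h i j)"
    have fr: "reals t = reals s"
    proof
      fix a show "reals t a = reals s a" using frame_reals[OF f, of a] by simp
    qed
    have pre: "pre h i (Suc j) = pre h i j @ (if ?P h i j then [(h, i, j)] else [])"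
      by (simp add: pre_def row_def)
    have ok: "?P h i j \<longleftrightarrow> i = j \<or> \<not> 0 < sdot t h (reals t aX j - reals t aX i, reals t aY j - reals t aY i) \<and>
       0 < sdot t (Suc h) (reals t aX j - reals t aX i, reals t aY j - reals t aY i)"
      by (simp add: trans_ok_def sdot_def fr)
    show "holds_triples (run push_triple t) (pre h i (Suc j))"
    proof (cases "?P h i j")
      case True
      then have "run push_triple t = nwrite tc 0 (Suc (nats t tc 0)) (nwrite aTW (nats t tc 0) j (nwrite aTV (nats t tc 0) i (nwrite aTI (nats t tc 0) h t)))"
        using * ok unfolding push_triple_def by auto
      then show ?thesis using I True unfolding pre by (auto simp: holds_triples_def nth_append less_Suc_eq)
    next
      case False
      then have "run push_triple t = nwrite tc 0 (nats t tc 0) t"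
        using * ok unfolding push_triple_def by auto
      then show ?thesis using I False unfolding pre by (simp add: holds_triples_def)
    qed
  qed (simp_all add: N_def holds_triples_def)
  then show ?thesis by (simp add: pre_def row_def N_def)
qed

section \<open>Dynamic programming\<close>

definition pr4 :: "nat \<Rightarrow> nat \<Rightarrow> nat \<Rightarrow> nat \<Rightarrow> nat" where
  "pr4 i a v m = pr (pr i a) (pr v m)"

definition NPr4 :: "nexp \<Rightarrow> nexp \<Rightarrow> nexp \<Rightarrow> nexp \<Rightarrow> nexp" where
  "NPr4 i a v m = NPr (NPr i a) (NPr v m)"

lemma pr4_eq_iff [simp]: "pr4 i a v m = pr4 i' a' v' m' \<longleftrightarrow> i = i' \<and> a = a' \<and> v = v' \<and> m = m'"
  by (auto simp: pr4_def)

lemma nval_NPr4 [simp]: "nval (NPr4 i a v m) s = pr4 (nval i s) (nval a s) (nval v s) (nval m s)"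
  by (simp add: NPr4_def pr4_def)

text \<open>A state consists of the event \<open>i\<close>, the start \<open>a\<close>, the current
  vertex \<open>v\<close> and the number \<open>m\<close> of misses so far. The entry is the
  predecessor plus one, so that 0, the initial content of memory, marks a state not reached.\<close>

abbreviation tP :: "store \<Rightarrow> nat \<Rightarrow> nat \<Rightarrow> nat \<Rightarrow> nat \<Rightarrow> nat" where "tP t i a v m \<equiv> nats t aP (pr4 i a v m)"
abbreviation tT :: "store \<Rightarrow> nat \<Rightarrow> nat \<Rightarrow> nat \<Rightarrow> nat \<Rightarrow> real" where "tT t i a v m \<equiv> reals t aT (pr4 i a v m)"

definition dp_init :: fprog where
  "dp_init = FFor xi nsq (FN aP (NPr4 (NConst 0) (V xi) (V xi) (NConst 0)) (NConst 1) ;;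
     FR aT (NPr4 (NConst 0) (V xi) (V xi) (NConst 0)) R0)"

abbreviation "eP0 \<equiv> NPr4 (V vi) (V xi) (V vv) (V xj)"
abbreviation "eP1 \<equiv> NPr4 (NAdd (V vi) (NConst 1)) (V xi) (V vw) (NAdd (V xj) (V mi))"
abbreviation "eval' \<equiv> RAdd (RCell aT eP0) (RCell aD (NPr (V vw) (V vv)))"

text \<open>The step is charged with the distance from \<open>w\<close> back to \<open>v\<close>,
  because the tour is printed backwards from the last event.\<close>

definition dp_relax :: fprog where
  "dp_relax = FIf (BAnd (NLess (NConst 0) (NCell aP eP0)) (BOr (NEq (NCell aP eP1) (NConst 0)) (RLess eval' (RCell aT eP1))))
     (FR aT eP1 eval' ;; FN aP eP1 (NAdd (V vv) (NConst 1))) (FN aP eP1 (NCell aP eP1))"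

definition emiss :: "nexp \<Rightarrow> nat \<Rightarrow> bexp" where
  "emiss i x = RLess (edot i (RCell aX (V x)) (RCell aY (V x))) (RCell aUC i)"

definition smiss :: "store \<Rightarrow> nat \<Rightarrow> nat \<Rightarrow> nat" where
  "smiss s i v = (if sdot s i (pt s v) < reals s aUC i then 1 else 0)"

lemma bval_emiss [simp]: "bval (emiss i x) s \<longleftrightarrow> smiss s (nval i s) (nats s x 0) = 1"
  by (simp add: emiss_def smiss_def)

definition dp_row :: fprog where
  "dp_row = FN vi (NConst 0) (NCell aTI (V xl)) ;; FN vv (NConst 0) (NCell aTV (V xl)) ;; FN vw (NConst 0) (NCell aTW (V xl)) ;;
     FIf (emiss (NAdd (V vi) (NConst 1)) vw) (FN mi (NConst 0) (NConst 1)) (FN mi (NConst 0) (NConst 0)) ;;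
     FFor xi nsq (FFor xj (NAdd ntwo (NConst 1)) dp_relax)"

text \<open>Loop bounds must be polynomials in the input size, so the proved bound on the number of
  transitions replaces \<open>tc\<close>, and the surplus rounds change nothing that
  matters.\<close>

definition dp_loop :: fprog where
  "dp_loop = FFor xl (NAdd (NMul nsq nsq) (NMul ntwo nsq)) (FIf (NLess (V xl) (V tc)) dp_row (FN vi (NConst 0) (V vi)))"

lemma mods_dp [simp]:
  "nmods dp_init = {xi, aP}" "rmods dp_init = {aT}"
  "nmods dp_relax = {aP}" "rmods dp_relax = {aT}"
  "nmods dp_row = {vi, vv, vw, mi, xi, xj, aP}" "rmods dp_row = {aT}"
  "nmods dp_loop = {xl, vi, vv, vw, mi, xi, xj, aP}" "rmods dp_loop = {aT}"
  by (auto simp: dp_init_def dp_relax_def dp_row_def dp_loop_def)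

text \<open>
  Layers are final once they have been read: a cell of layer \<open>i + 1\<close> is justified by an unchanging
  cell of layer \<open>i\<close>, and \<open>R\<close> collects the transitions that have been relaxed.
\<close>

definition dp_inv :: "nat \<Rightarrow> (nat \<Rightarrow> nat \<Rightarrow> real) \<Rightarrow> (nat \<Rightarrow> nat \<Rightarrow> nat) \<Rightarrow>
    (nat \<times> nat \<times> nat \<times> nat \<times> nat) set \<Rightarrow> nat \<Rightarrow> store \<Rightarrow> bool" where
  "dp_inv N D ms R l t \<longleftrightarrow>
     (\<forall>a<N. tP t 0 a a 0 > 0) \<and>
     (\<forall>a v m. tP t 0 a v m > 0 \<longrightarrow> v = a \<and> m = 0 \<and> tT t 0 a v m = 0) \<and>
     (\<forall>i a w m. tP t (Suc i) a w m > 0 \<longrightarrow> i \<le> l \<and> tP t (Suc i) a w m - 1 < N \<and> ms (Suc i) w \<le> m \<and>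
        tP t i a (tP t (Suc i) a w m - 1) (m - ms (Suc i) w) > 0 \<and>
        tT t (Suc i) a w m = tT t i a (tP t (Suc i) a w m - 1) (m - ms (Suc i) w) + D w (tP t (Suc i) a w m - 1)) \<and>
     (\<forall>i v w a m. (i, v, w, a, m) \<in> R \<longrightarrow> i \<le> l \<and> (tP t i a v m > 0 \<longrightarrow>
        tP t (Suc i) a w (m + ms (Suc i) w) > 0 \<and> tT t (Suc i) a w (m + ms (Suc i) w) \<le> tT t i a v m + D w v))"

lemmas dp_invD1 = dp_inv_def[THEN iffD1, THEN conjunct1, rule_format]
lemmas dp_invD2 = dp_inv_def[THEN iffD1, THEN conjunct2, THEN conjunct1, rule_format]
lemmas dp_invD3 = dp_inv_def[THEN iffD1, THEN conjunct2, THEN conjunct2, THEN conjunct1, rule_format]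
lemmas dp_invD4 = dp_inv_def[THEN iffD1, THEN conjunct2, THEN conjunct2, THEN conjunct2, rule_format]

lemma dp_inv_cong:
  "nats t aP = nats t' aP \<Longrightarrow> reals t aT = reals t' aT \<Longrightarrow> dp_inv N D ms R l t \<longleftrightarrow> dp_inv N D ms R l t'"
  by (simp add: dp_inv_def)

lemma run_dp_init:
  assumes "nats s aP = (\<lambda>_. 0)" "N = nats s 0 0 * nats s 0 0"
  shows "dp_inv N D ms {} 0 (run dp_init s)"
proof -
  have "(\<forall>i a v m. tP (run dp_init s) i a v m > 0 \<longleftrightarrow> i = 0 \<and> v = a \<and> m = 0 \<and> a < N) \<and>
    (\<forall>a<N. tT (run dp_init s) 0 a a 0 = 0)"
    unfolding dp_init_def
  proof (rule run_For1[where I="\<lambda>k t. (\<forall>i a v m. tP t i a v m > 0 \<longleftrightarrow> i = 0 \<and> v = a \<and> m = 0 \<and> a < k) \<and>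
     (\<forall>a<k. tT t 0 a a 0 = 0)"], goal_cases)
    case (5 k t)
    then show ?case by (auto simp: less_Suc_eq)
  qed (use assms in simp_all)
  then show ?thesis by (simp add: dp_inv_def)
qed

text \<open>Only layer \<open>i + 1\<close> is written, while justifications and recorded
  inequalities read from layers up to \<open>i\<close>. A reached cell is overwritten only by a
  cheaper value, so earlier inequalities survive.\<close>

lemma dp_inv_relax:
  assumes I: "dp_inv N D ms R i t"
    and x: "nats t vi 0 = i" "nats t xi 0 = a" "nats t vv 0 = v" "nats t xj 0 = m" "nats t vw 0 = w" "nats t mi 0 = ms (Suc i) w"
    and D: "reals t aD (pr w v) = D w v" and v: "v < N"
  shows "dp_inv N D ms (insert (i, v, w, a, m) R) i (run dp_relax t)"
proof -
  define m' where "m' = m + ms (Suc i) w"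
  define c where "c \<longleftrightarrow> tP t i a v m > 0 \<and> (tP t (Suc i) a w m' = 0 \<or> tT t i a v m + D w v < tT t (Suc i) a w m')"
  define t' where "t' = run dp_relax t"
  have P': "tP t' j b u k = (if c \<and> j = Suc i \<and> b = a \<and> u = w \<and> k = m' then Suc v else tP t j b u k)" for j b u k
    using x D by (auto simp: t'_def dp_relax_def c_def m'_def)
  have T': "tT t' j b u k = (if c \<and> j = Suc i \<and> b = a \<and> u = w \<and> k = m' then tT t i a v m + D w v else tT t j b u k)" for j b u k
    using x D by (auto simp: t'_def dp_relax_def c_def m'_def)
  note I1 = dp_invD1[OF I] and I2 = dp_invD2[OF I] and I3 = dp_invD3[OF I] and I4 = dp_invD4[OF I]
  have low: "tP t' j b u k = tP t j b u k" "tT t' j b u k = tT t j b u k" if "j \<le> i" for j b u k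
    using that by (simp_all add: P' T')
  show ?thesis unfolding t'_def[symmetric] dp_inv_def
  proof (intro conjI allI impI)
    show "tP t' 0 b b 0 > 0" if "b < N" for b using I1[OF that] by (simp add: low)
  next
    fix b u k assume "tP t' 0 b u k > 0"
    then have "tP t 0 b u k > 0" by (simp add: low)
    note e = I2[OF this]
    show "u = b" "k = 0" using e by blast+
    show "tT t' 0 b u k = 0" unfolding low[OF le0] using e by blast
  next
    fix j b u k assume pos: "tP t' (Suc j) b u k > 0"
    have "j \<le> i \<and> tP t' (Suc j) b u k - 1 < N \<and> ms (Suc j) u \<le> k \<and>
        tP t' j b (tP t' (Suc j) b u k - 1) (k - ms (Suc j) u) > 0 \<and>
        tT t' (Suc j) b u k = tT t' j b (tP t' (Suc j) b u k - 1) (k - ms (Suc j) u) + D u (tP t' (Suc j) b u k - 1)"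
    proof (cases "c \<and> j = i \<and> b = a \<and> u = w \<and> k = m'")
      case True
      then have "tP t' (Suc j) b u k = Suc v" "tT t' (Suc j) b u k = tT t i a v m + D w v" by (simp_all add: P' T')
      then show ?thesis using True v by (simp add: low m'_def c_def)
    next
      case False
      then have eq: "tP t' (Suc j) b u k = tP t (Suc j) b u k" "tT t' (Suc j) b u k = tT t (Suc j) b u k" by (auto simp: P' T')
      then have "tP t (Suc j) b u k > 0" using pos by simp
      from I3[OF this] show ?thesis unfolding eq by (simp add: low)
    qed
    then show "j \<le> i" "tP t' (Suc j) b u k - 1 < N" "ms (Suc j) u \<le> k"
        "tP t' j b (tP t' (Suc j) b u k - 1) (k - ms (Suc j) u) > 0"
        "tT t' (Suc j) b u k = tT t' j b (tP t' (Suc j) b u k - 1) (k - ms (Suc j) u) + D u (tP t' (Suc j) b u k - 1)"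
      by blast+
  next
    fix j v' w' b k assume R: "(j, v', w', b, k) \<in> insert (i, v, w, a, m) R"
    have mono: "tP t' (Suc j) b w' k' > 0 \<and> tT t' (Suc j) b w' k' \<le> r"
      if "tP t (Suc j) b w' k' > 0" "tT t (Suc j) b w' k' \<le> r" for k' r
    proof (cases "c \<and> j = i \<and> b = a \<and> w' = w \<and> k' = m'")
      case True
      then have "tT t i a v m + D w v < tT t (Suc i) a w m'" using that(1) by (auto simp: c_def)
      then show ?thesis using True that by (simp add: P' T')
    next
      case False
      then have "tP t' (Suc j) b w' k' = tP t (Suc j) b w' k'" "tT t' (Suc j) b w' k' = tT t (Suc j) b w' k'" by (auto simp: P' T')
      then show ?thesis using that by simp
    qed
    have "j \<le> i \<and> (tP t' j b v' k > 0 \<longrightarrow>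
        tP t' (Suc j) b w' (k + ms (Suc j) w') > 0 \<and> tT t' (Suc j) b w' (k + ms (Suc j) w') \<le> tT t' j b v' k + D w' v')"
    proof (cases "(j, v', w', b, k) \<in> R")
      case True
      from I4[OF this] show ?thesis using mono[of "k + ms (Suc j) w'" "tT t j b v' k + D w' v'"] by (simp add: low)
    next
      case False
      then have eq: "j = i" "v' = v" "w' = w" "b = a" "k = m" using R by auto
      show ?thesis
      proof (intro conjI impI)
        assume "tP t' j b v' k > 0"
        then have pos: "tP t i a v m > 0" by (simp add: low eq)
        have "tP t' (Suc i) a w m' > 0 \<and> tT t' (Suc i) a w m' \<le> tT t i a v m + D w v"
          using pos by (auto simp: P' T' c_def)
        then show "tP t' (Suc j) b w' (k + ms (Suc j) w') > 0" "tT t' (Suc j) b w' (k + ms (Suc j) w') \<le> tT t' j b v' k + D w' v'"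
          by (simp_all add: eq low m'_def)
      qed (simp add: eq)
    qed
    then show "j \<le> i" "tP t' j b v' k > 0 \<Longrightarrow> tP t' (Suc j) b w' (k + ms (Suc j) w') > 0"
      "tP t' j b v' k > 0 \<Longrightarrow> tT t' (Suc j) b w' (k + ms (Suc j) w') \<le> tT t' j b v' k + D w' v'" by blast+
  qed
qed

lemma dp_inv_mono: "dp_inv N D ms R l t \<Longrightarrow> l \<le> l' \<Longrightarrow> R' \<subseteq> R \<Longrightarrow> dp_inv N D ms R' l' t"
  unfolding dp_inv_def by (meson le_trans subsetD)

definition relaxed :: "nat \<Rightarrow> nat \<Rightarrow> (nat \<times> nat \<times> nat) set \<Rightarrow> (nat \<times> nat \<times> nat \<times> nat \<times> nat) set" where
  "relaxed n N X = {(i, v, w, a, m). (i, v, w) \<in> X \<and> a < N \<and> m < 2 * n + 1}"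

lemma run_dp_row:
  fixes s :: store
  defines "n \<equiv> nats s 0 0" and "N \<equiv> nats s 0 0 * nats s 0 0"
  assumes I: "dp_inv N (\<lambda>w v. reals s aD (pr w v)) (smiss s) (relaxed n N X) l s"
    and x: "(nats s aTI (nats s xl 0), nats s aTV (nats s xl 0), nats s aTW (nats s xl 0)) = (i, v, w)"
    and i: "l \<le> i" and v: "v < N"
  shows "dp_inv N (\<lambda>w v. reals s aD (pr w v)) (smiss s) (relaxed n N (insert (i, v, w) X)) i (run dp_row s)"
proof -
  let ?D = "\<lambda>w v. reals s aD (pr w v)"
  define u where "u = run (FN vi (NConst 0) (NCell aTI (V xl)) ;; FN vv (NConst 0) (NCell aTV (V xl)) ;; FN vw (NConst 0) (NCell aTW (V xl)) ;;
     FIf (emiss (NAdd (V vi) (NConst 1)) vw) (FN mi (NConst 0) (NConst 1)) (FN mi (NConst 0) (NConst 0))) s"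
  have sm: "smiss (nwrite a k z q) = smiss q" for a k z q by (simp add: fun_eq_iff smiss_def sdot_def)
  have m01: "smiss s j p = 1 \<or> smiss s j p = 0" for j p by (simp add: smiss_def)
  have u: "nats u vi 0 = i" "nats u vv 0 = v" "nats u vw 0 = w" "nats u mi 0 = smiss s (Suc i) w"
    "nats u 0 = nats s 0" "nats u aP = nats s aP" "reals u = reals s"
    using x m01[of "Suc i" w] by (auto simp: u_def sm)
  let ?R = "\<lambda>b k. relaxed n N X \<union> {(i, v, w, a, m) |a m. (a < b \<or> a = b \<and> m < k) \<and> m < 2 * n + 1}"
  have "dp_inv N ?D (smiss s) (?R N 0) i (run (FFor xi nsq (FFor xj (NAdd ntwo (NConst 1)) dp_relax)) u)"
  proof (rule run_For2[where I="\<lambda>b k t. dp_inv N ?D (smiss s) (?R b k) i t" and K=N and M="2 * n + 1"])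
    have "dp_inv N ?D (smiss s) (relaxed n N X) i u"
      using dp_inv_mono[OF I i] dp_inv_cong[of u s] u by simp
    moreover have "?R 0 0 = relaxed n N X" by auto
    ultimately show "dp_inv N ?D (smiss s) (?R 0 0) i u" by simp
    show "dp_inv N ?D (smiss s) (?R (Suc b) 0) i t" if "b < N" "dp_inv N ?D (smiss s) (?R b (2 * n + 1)) i t" for b t
    proof -
      have "?R (Suc b) 0 \<subseteq> ?R b (2 * n + 1)" by (auto simp: less_Suc_eq)
      then show ?thesis by (rule dp_inv_mono[OF that(2) order_refl])
    qed
    show "dp_inv N ?D (smiss s) (?R b k) i (nwrite xi 0 z t)" if "dp_inv N ?D (smiss s) (?R b k) i t" for b k t z
      using that dp_inv_cong[of "nwrite xi 0 z t" t] by simp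
    show "dp_inv N ?D (smiss s) (?R b k) i (nwrite xj 0 z t)" if "dp_inv N ?D (smiss s) (?R b k) i t" for b k t z
      using that dp_inv_cong[of "nwrite xj 0 z t" t] by simp
    fix b k t assume bk: "b < N" "k < 2 * n + 1" "nats t xi 0 = b" "nats t xj 0 = k"
      and f: "frame (insert xi (insert xj (nmods dp_relax))) (rmods dp_relax) u t" and It: "dp_inv N ?D (smiss s) (?R b k) i t"
    note fr = frame_nats[OF f] frame_reals[OF f]
    have "dp_inv N ?D (smiss s) (insert (i, v, w, b, k) (?R b k)) i (run dp_relax t)"
      by (rule dp_inv_relax[OF It]) (use bk u v in \<open>simp_all add: fr\<close>)
    moreover have "?R b (Suc k) \<subseteq> insert (i, v, w, b, k) (?R b k)" by (auto simp: less_Suc_eq)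
    ultimately show "dp_inv N ?D (smiss s) (?R b (Suc k)) i (run dp_relax t)" by (rule dp_inv_mono[OF _ order_refl])
  qed (simp_all add: u n_def N_def)
  moreover have "relaxed n N (insert (i, v, w) X) \<subseteq> ?R N 0" by (auto simp: relaxed_def)
  ultimately have "dp_inv N ?D (smiss s) (relaxed n N (insert (i, v, w) X)) i (run (FFor xi nsq (FFor xj (NAdd ntwo (NConst 1)) dp_relax)) u)"
    by (rule dp_inv_mono[OF _ order_refl])
  then show ?thesis by (simp only: dp_row_def run.simps u_def)
qed

text \<open>As transitions are sorted by event, the layer \<open>l\<close> reached never exceeds the
  event of a pending transition. This keeps layers that have been read from being written
  again.\<close>

lemma run_dp_loop:
  fixes s :: store
  defines "n \<equiv> nats s 0 0" and "N \<equiv> nats s 0 0 * nats s 0 0"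
  assumes I: "dp_inv N (\<lambda>w v. reals s aD (pr w v)) (smiss s) {} 0 s"
    and L: "holds_triples s L" "sorted (map fst L)" "\<And>i v w. (i, v, w) \<in> set L \<Longrightarrow> v < N" "length L \<le> N * N + 2 * n * N"
  shows "\<exists>l. dp_inv N (\<lambda>w v. reals s aD (pr w v)) (smiss s) (relaxed n N (set L)) l (run dp_loop s)"
proof -
  let ?D = "\<lambda>w v. reals s aD (pr w v)"
  let ?I = "\<lambda>e t. \<exists>l. dp_inv N ?D (smiss s) (relaxed n N (set (take e L))) l t \<and> (\<forall>x\<in>set (drop e L). l \<le> fst x)"
  have "?I (N * N + 2 * n * N) (run dp_loop s)"
    unfolding dp_loop_def
  proof (rule run_For1[where I="?I"], goal_cases)
    case 3
    have "relaxed n N {} = {}" by (auto simp: relaxed_def)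
    then show ?case using I by (intro exI[of _ 0]) simp
  next
    case (4 e t z)
    then show ?case using dp_inv_cong[of "nwrite xl 0 z t" t] by simp
  next
    case (5 e t)
    note fr = frame_nats[OF 5(3)] frame_reals[OF 5(3)]
    obtain l where l: "dp_inv N ?D (smiss s) (relaxed n N (set (take e L))) l t" "\<forall>x\<in>set (drop e L). l \<le> fst x"
      using 5(4) by blast
    have tct: "nats t tc 0 = length L" using L(1) by (simp add: fr holds_triples_def)
    show ?case
    proof (cases "e < length L")
      case False
      then have "run (FIf (NLess (V xl) (V tc)) dp_row (FN vi (NConst 0) (V vi))) t = nwrite vi 0 (nats t vi 0) t"
        using 5(2) tct by simp
      moreover have "take (Suc e) L = take e L" "drop (Suc e) L = drop e L" using False by simp_all
      ultimately show ?thesis using l dp_inv_cong[of "nwrite vi 0 (nats t vi 0) t" t] by auto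
    next
      case True
      obtain i v w where e: "L ! e = (i, v, w)" by (metis prod_cases3)
      have run: "run (FIf (NLess (V xl) (V tc)) dp_row (FN vi (NConst 0) (V vi))) t = run dp_row t"
        using True 5(2) tct by simp
      have dr: "drop e L = (i, v, w) # drop (Suc e) L" using True e by (metis Cons_nth_drop_Suc)
      have sm: "smiss t = smiss s" by (simp add: fun_eq_iff smiss_def sdot_def fr)
      have Dt: "reals t aD = reals s aD" by (simp add: fr)
      have "dp_inv N ?D (smiss s) (relaxed n N (insert (i, v, w) (set (take e L)))) i (run dp_row t)"
      proof -
        have n0: "nats t 0 = nats s 0" by (simp add: fr)
        have "(nats t aTI (nats t xl 0), nats t aTV (nats t xl 0), nats t aTW (nats t xl 0)) = (i, v, w)"
          using L(1) True e 5(2) by (simp add: holds_triples_def fr)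
        moreover have "l \<le> i" using l(2) dr by simp
        moreover have "v < N" using L(3)[of i v w] nth_mem[OF True] e by simp
        ultimately show ?thesis using run_dp_row[of t "set (take e L)" l i v w, unfolded sm Dt n0, folded N_def, folded n_def] l(1)
          by blast
      qed
      moreover have "set (take (Suc e) L) = insert (i, v, w) (set (take e L))"
        using True e by (simp add: take_Suc_conv_app_nth)
      moreover have "\<forall>x\<in>set (drop (Suc e) L). i \<le> fst x"
      proof -
        have "sorted (map fst (drop e L))" using L(2) by (simp add: drop_map[symmetric] sorted_wrt_drop)
        then show ?thesis by (simp add: dr)
      qed
      ultimately show ?thesis unfolding run by auto
    qed
  qed (simp_all add: n_def N_def)
  then show ?thesis using L(4) by auto
qed

text \<open>Each step has been relaxed from the cell that the previous step guarantees. With at most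
  one miss per event the count stays in the range \<open>m < 2 * n + 1\<close> of the inner
  loop.\<close>

lemma dp_inv_complete:
  assumes I: "dp_inv N D ms (relaxed n N X) l t"
    and v: "\<And>i. i \<le> 2 * n \<Longrightarrow> v i < N" "\<And>i. i < 2 * n \<Longrightarrow> (i, v i, v (Suc i)) \<in> X"
    and ms: "\<And>i z. ms i z \<le> 1"
  shows "j \<le> 2 * n \<Longrightarrow> tP t j (v 0) (v j) (\<Sum>i<j. ms (Suc i) (v (Suc i))) > 0 \<and>
    tT t j (v 0) (v j) (\<Sum>i<j. ms (Suc i) (v (Suc i))) \<le> (\<Sum>i<j. D (v (Suc i)) (v i))"
proof (induction j)
  case 0
  have "tP t 0 (v 0) (v 0) 0 > 0" using I v(1)[of 0] unfolding dp_inv_def by simp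
  moreover from this have "tT t 0 (v 0) (v 0) 0 = 0" using I unfolding dp_inv_def by blast
  ultimately show ?case by simp
next
  case (Suc j)
  let ?m = "\<Sum>i<j. ms (Suc i) (v (Suc i))"
  have "?m \<le> (\<Sum>i<j. 1)" by (intro sum_mono ms)
  then have "?m \<le> j" by simp
  then have "(j, v j, v (Suc j), v 0, ?m) \<in> relaxed n N X" using v(1)[of 0] v(2)[of j] Suc.prems by (simp add: relaxed_def)
  then have "tP t (Suc j) (v 0) (v (Suc j)) (?m + ms (Suc j) (v (Suc j))) > 0 \<and>
      tT t (Suc j) (v 0) (v (Suc j)) (?m + ms (Suc j) (v (Suc j))) \<le> tT t j (v 0) (v j) ?m + D (v (Suc j)) (v j)"
    using dp_invD4[OF I] Suc.IH Suc.prems by simp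
  then show ?case using Suc.IH Suc.prems by simp
qed

section \<open>Selecting the best tour and printing it\<close>

abbreviation "eS \<equiv> NPr4 ntwo (V xi) (V xi) (V xj)"

text \<open>\<open>c\<close> filters admissible closed states and \<open>q\<close> decides whether
  the current one beats the stored one, so that one loop serves for least cost under a limit on
  misses and for fewest misses under a limit on cost.\<close>

definition select_body :: "bexp \<Rightarrow> bexp \<Rightarrow> fprog" where
  "select_body c q = FIf (BAnd (NLess (NConst 0) (NCell aP eS)) (BAnd c (BOr (NEq (V fnd) (NConst 0)) q)))
     (FR best (NConst 0) (RCell aT eS) ;; FN bs (NConst 0) (V xi) ;; FN bm (NConst 0) (V xj) ;; FN fnd (NConst 0) (NConst 1))
     (FN fnd (NConst 0) (V fnd))"

definition select :: "bexp \<Rightarrow> bexp \<Rightarrow> fprog" where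
  "select c q = FN fnd (NConst 0) (NConst 0) ;; FFor xi nsq (FFor xj (NAdd ntwo (NConst 1)) (select_body c q))"

lemma mods_select [simp]:
  "nmods (select_body c q) = {bs, bm, fnd}" "rmods (select_body c q) = {best}"
  "nmods (select c q) = {xi, xj, bs, bm, fnd}" "rmods (select c q) = {best}"
  by (auto simp: select_def select_body_def)

lemma run_select:
  fixes s :: store and key :: "nat \<Rightarrow> nat \<Rightarrow> real" and c q :: bexp
  defines "n \<equiv> nats s 0 0" and "N \<equiv> nats s 0 0 * nats s 0 0" and "s' \<equiv> run (select c q) s"
  assumes c: "\<And>t. frame {xi, xj, bs, bm, fnd} {best} s t \<Longrightarrow> bval c t \<longleftrightarrow> C (nats t xi 0) (nats t xj 0)"
    and q: "\<And>t. frame {xi, xj, bs, bm, fnd} {best} s t \<Longrightarrow> reals t best 0 = tT s (2 * n) (nats t bs 0) (nats t bs 0) (nats t bm 0) \<Longrightarrow>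
      bval q t \<longleftrightarrow> key (nats t xi 0) (nats t xj 0) < key (nats t bs 0) (nats t bm 0)"
  defines "good \<equiv> \<lambda>a m. a < nats s 0 0 * nats s 0 0 \<and> m < 2 * nats s 0 0 + 1 \<and> tP s (2 * nats s 0 0) a a m > 0 \<and> C a m"
  shows "nats s' fnd 0 = 0 \<and> (\<forall>a m. \<not> good a m) \<or>
    nats s' fnd 0 = 1 \<and> good (nats s' bs 0) (nats s' bm 0) \<and> (\<forall>a m. good a m \<longrightarrow> key (nats s' bs 0) (nats s' bm 0) \<le> key a m)"
proof -
  let ?I = "\<lambda>i j t. nats t fnd 0 = 0 \<and> (\<forall>a m. (a < i \<or> a = i \<and> m < j) \<longrightarrow> \<not> good a m) \<or>
    nats t fnd 0 = 1 \<and> good (nats t bs 0) (nats t bm 0) \<and> reals t best 0 = tT s (2 * n) (nats t bs 0) (nats t bs 0) (nats t bm 0) \<and>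
    (\<forall>a m. (a < i \<or> a = i \<and> m < j) \<longrightarrow> good a m \<longrightarrow> key (nats t bs 0) (nats t bm 0) \<le> key a m)"
  have "?I N 0 s'"
    unfolding s'_def select_def run.simps(3)
  proof (rule run_For2[where I="?I" and K=N and M="2 * n + 1"])
    show "?I (Suc i) 0 t" if "i < N" "?I i (2 * n + 1) t" for i t
    proof -
      have "(a < Suc i \<or> a = Suc i \<and> m < 0) \<Longrightarrow> good a m \<Longrightarrow> a < i \<or> a = i \<and> m < 2 * n + 1" for a m
        by (auto simp: good_def n_def less_Suc_eq)
      then show ?thesis using that(2) by blast
    qed
    fix i j t assume *: "i < N" "j < 2 * n + 1" "nats t xi 0 = i" "nats t xj 0 = j"
      and f: "frame (insert xi (insert xj (nmods (select_body c q)))) (rmods (select_body c q)) (run (FN fnd (NConst 0) (NConst 0)) s) t"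
      and I: "?I i j t"
    have fs: "frame {xi, xj, bs, bm, fnd} {best} s t"
      using frame_trans[OF _ f, of "{xi, xj, bs, bm, fnd}" "{best}" s] by (auto simp: frame_def)
    note fr = frame_nats[OF fs] frame_reals[OF fs]
    have cc: "bval c t \<longleftrightarrow> C i j" using c[OF fs] * by simp
    have g: "good i j \<longleftrightarrow> tP s (2 * n) i i j > 0 \<and> C i j" using * by (simp add: good_def n_def N_def)
    have lex: "(a < i \<or> a = i \<and> m < Suc j) \<longleftrightarrow> (a < i \<or> a = i \<and> m < j) \<or> a = i \<and> m = j" for a m by auto
    define b where "b \<longleftrightarrow> good i j \<and> (nats t fnd 0 = 0 \<or> bval q t)"
    have run: "run (select_body c q) t = (if b then nwrite fnd 0 1 (nwrite bm 0 j (nwrite bs 0 i (rwrite best 0 (tT s (2 * n) i i j) t)))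
       else nwrite fnd 0 (nats t fnd 0) t)"
      using * cc by (auto simp: select_body_def b_def g fr n_def)
    show "?I i (Suc j) (run (select_body c q) t)"
    proof (cases b)
      case True
      have "\<forall>a m. (a < i \<or> a = i \<and> m < Suc j) \<longrightarrow> good a m \<longrightarrow> key i j \<le> key a m"
      proof (cases "nats t fnd 0 = 0")
        case True
        then show ?thesis using I unfolding lex by auto
      next
        case False
        then have I': "bval q t" "reals t best 0 = tT s (2 * n) (nats t bs 0) (nats t bs 0) (nats t bm 0)"
          "\<And>a m. (a < i \<or> a = i \<and> m < j) \<Longrightarrow> good a m \<Longrightarrow> key (nats t bs 0) (nats t bm 0) \<le> key a m"
          using \<open>b\<close> I by (auto simp: b_def)
        have less: "key i j < key (nats t bs 0) (nats t bm 0)" using q[OF fs I'(2)] I'(1) * by simp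
        show ?thesis
        proof (intro allI impI)
          fix a m assume a: "a < i \<or> a = i \<and> m < Suc j" "good a m"
          show "key i j \<le> key a m"
          proof (cases "a = i \<and> m = j")
            case False
            then have "a < i \<or> a = i \<and> m < j" using a(1) by auto
            from I'(3)[OF this a(2)] less show ?thesis by linarith
          qed simp
        qed
      qed
      moreover have "good i j" using True by (simp add: b_def)
      ultimately show ?thesis unfolding run using True by simp
    next
      case False
      show ?thesis
      proof (cases "nats t fnd 0 = 0")
        case True
        then have "\<not> good i j" using False by (simp add: b_def)
        then show ?thesis unfolding run lex using False True I by auto
      next
        case fnd: False
        then have I': "nats t fnd 0 = 1" "good (nats t bs 0) (nats t bm 0)" "reals t best 0 = tT s (2 * n) (nats t bs 0) (nats t bs 0) (nats t bm 0)"
          "\<And>a m. (a < i \<or> a = i \<and> m < j) \<Longrightarrow> good a m \<Longrightarrow> key (nats t bs 0) (nats t bm 0) \<le> key a m"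
          using I by auto
        have "good i j \<Longrightarrow> key (nats t bs 0) (nats t bm 0) \<le> key i j"
          using False q[OF fs I'(3)] * by (simp add: b_def)
        then have "\<forall>a m. (a < i \<or> a = i \<and> m < Suc j) \<longrightarrow> good a m \<longrightarrow> key (nats t bs 0) (nats t bm 0) \<le> key a m"
          unfolding lex using I'(4) by blast
        then show ?thesis unfolding run using False I'(1-3) by simp
      qed
    qed
  qed (simp_all add: N_def n_def)
  moreover have "good a m \<Longrightarrow> a < N \<or> a = N \<and> m < 0" for a m by (simp add: good_def N_def)
  ultimately show ?thesis by blast
qed

definition push :: "nat \<Rightarrow> fprog" where
  "push x = FR 1 (NMul (NConst 2) (V 1)) (RCell aX (V x)) ;;
     FR 1 (NAdd (NMul (NConst 2) (V 1)) (NConst 1)) (RCell aY (V x)) ;; FN 1 (NConst 0) (NAdd (V 1) (NConst 1))"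

lemma mods_push [simp]: "nmods (push x) = {1}" "rmods (push x) = {1}"
  by (auto simp: push_def)

lemma answer_push: "answer (run (push x) t) = answer t @ [pt t (nats t x 0)]"
proof -
  have "2 * j \<noteq> Suc (2 * k)" "Suc (2 * j) \<noteq> 2 * k" for j k :: nat by presburger+
  then show ?thesis by (simp add: push_def answer_def)
qed

lemma answer_cong: "nats t 1 = nats u 1 \<Longrightarrow> reals t 1 = reals u 1 \<Longrightarrow> answer t = answer u"
  by (simp add: answer_def)

definition hop :: fprog where
  "hop = FIf (RLess R0 (RCell aD (NPr (V cur) (V tg))))
     (FN cur (NConst 0) (NCell aNX (NPr (V cur) (V tg))) ;; push cur) (FN cur (NConst 0) (V cur))"

abbreviation "eh \<equiv> NSub ntwo (V xi)"

definition leg :: fprog where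
  "leg = FN tg (NConst 0) (NSub (NCell aP (NPr4 eh (V bs) (V cv) (V cm))) (NConst 1)) ;;
     FIf (emiss eh cv) (FN cm (NConst 0) (NSub (V cm) (NConst 1))) (FN cm (NConst 0) (V cm)) ;;
     FFor xj nsq hop ;; FN cv (NConst 0) (V tg) ;; FN cur (NConst 0) (V tg)"

definition output_route :: fprog where
  "output_route = FN 1 (NConst 0) (NConst 0) ;; FIf (NEq (V fnd) (NConst 1))
     (push bs ;; FN cv (NConst 0) (V bs) ;; FN cm (NConst 0) (V bm) ;; FN cur (NConst 0) (V bs) ;; FFor xi ntwo leg)
     (FN cur (NConst 0) (V cur))"

lemma mods_output [simp]:
  "nmods hop = {1, cur}" "rmods hop = {1}"
  "nmods leg = {1, cur, tg, cm, cv, xj}" "rmods leg = {1}"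
  "nmods output_route = {1, cur, tg, cm, cv, xj, xi}" "rmods output_route = {1}"
  by (auto simp: hop_def leg_def output_route_def)

definition hops_ok :: "(real \<times> real) set set \<Rightarrow> nat \<Rightarrow> store \<Rightarrow> bool" where
  "hops_ok \<L> N s \<longleftrightarrow> (\<forall>p<N. \<forall>q<N. dist (pt s p) (pt s q) \<le> reals s aD (pr p q) \<and>
     (0 < reals s aD (pr p q) \<longrightarrow> nats s aNX (pr p q) < N \<and> share \<L> (pt s p) (pt s (nats s aNX (pr p q))) \<and>
       0 < dist (pt s p) (pt s (nats s aNX (pr p q))) \<and>
       dist (pt s p) (pt s (nats s aNX (pr p q))) + reals s aD (pr (nats s aNX (pr p q)) q) = reals s aD (pr p q)))"

text \<open>Each hop strictly decreases the remaining distance, which takes at most \<open>N\<close>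
  values for a fixed target, so \<open>N\<close> rounds reach distance 0. The measure
  \<open>?c\<close> counts the vertex numbers that are nearer to the target.\<close>

lemma run_hops:
  assumes ok: "hops_ok \<L> N s" and N: "N = nats s 0 0 * nats s 0 0"
    and pq: "nats s cur 0 = p" "nats s tg 0 = q" "p < N" "q < N"
  shows "\<exists>ext. answer (run (FFor xj nsq hop) s) = answer s @ ext \<and> chain \<L> (pt s p # ext) \<and> set ext \<subseteq> pt s ` {..<N} \<and>
    last (pt s p # ext) = pt s q \<and> plen (pt s p # ext) \<le> reals s aD (pr p q)"
proof -
  let ?D = "\<lambda>r. reals s aD (pr r q)"
  let ?c = "\<lambda>r. card {r'. r' < N \<and> ?D r' < ?D r}"
  let ?E = "\<lambda>ext r t. answer t = answer s @ ext \<and> chain \<L> (pt s p # ext) \<and> set ext \<subseteq> pt s ` {..<N} \<and>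
      last (pt s p # ext) = pt s r \<and> plen (pt s p # ext) + ?D r = ?D p"
  have nx: "?D r > 0 \<Longrightarrow> nats s aNX (pr r q) < N \<and> share \<L> (pt s r) (pt s (nats s aNX (pr r q))) \<and>
       0 < dist (pt s r) (pt s (nats s aNX (pr r q))) \<and>
       dist (pt s r) (pt s (nats s aNX (pr r q))) + ?D (nats s aNX (pr r q)) = ?D r"
    and D0: "dist (pt s r) (pt s q) \<le> ?D r" if "r < N" for r
    using ok that pq(4) unfolding hops_ok_def by blast+
  let ?I = "\<lambda>k t. \<exists>ext r. nats t cur 0 = r \<and> r < N \<and> ?E ext r t \<and> (?D r \<le> 0 \<or> ?c r + k \<le> N)"
  have "?I N (run (FFor xj nsq hop) s)"
  proof (rule run_For1[where I="?I"])
    have "?c p \<le> card {..<N}" by (intro card_mono) auto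
    then show "?I 0 s" using pq by (intro exI[of _ "[]"] exI[of _ p]) simp
    show "?I k (nwrite xj 0 v t)" if "?I k t" for k t v
    proof -
      have "answer (nwrite xj 0 v t) = answer t" by (rule answer_cong) simp_all
      then show ?thesis using that by simp
    qed
    fix k t assume k: "k < N" "nats t xj 0 = k" and f: "frame (insert xj (nmods hop)) (rmods hop) s t" and I: "?I k t"
    note fr = frame_nats[OF f] frame_reals[OF f]
    obtain ext r where r: "nats t cur 0 = r" "r < N" "?E ext r t" "?D r \<le> 0 \<or> ?c r + k \<le> N" using I by blast
    show "?I (Suc k) (run hop t)"
    proof (cases "?D r > 0")
      case False
      then have h: "run hop t = nwrite cur 0 r t" using r(1) pq(2) by (simp add: hop_def fr)
      have "answer (nwrite cur 0 r t) = answer t" by (rule answer_cong) simp_all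
      then show ?thesis unfolding h using r False by (intro exI[of _ ext] exI[of _ r]) simp
    next
      case True
      define z where "z = nats s aNX (pr r q)"
      have z: "z < N" "share \<L> (pt s r) (pt s z)" "0 < dist (pt s r) (pt s z)" "dist (pt s r) (pt s z) + ?D z = ?D r"
        using nx[OF r(2) True] unfolding z_def by blast+
      have h: "run hop t = run (push cur) (nwrite cur 0 z t)" using r(1) pq(2) True by (simp add: hop_def fr z_def)
      have "answer (nwrite cur 0 z t) = answer t" by (rule answer_cong) simp_all
      then have a: "answer (run hop t) = answer s @ (ext @ [pt s z])" unfolding h answer_push using r(3) by (simp add: fr)
      have cz: "nats (run hop t) cur 0 = z" unfolding h by (simp add: run_nats)
      have zr: "?D z < ?D r" using z(3,4) by linarith
      have "{r'. r' < N \<and> ?D r' < ?D z} \<subset> {r'. r' < N \<and> ?D r' < ?D r}"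
      proof (rule psubsetI)
        show "{r'. r' < N \<and> ?D r' < ?D z} \<subseteq> {r'. r' < N \<and> ?D r' < ?D r}"
          using order.strict_trans[OF _ zr] by blast
        have "z \<in> {r'. r' < N \<and> ?D r' < ?D r}" "z \<notin> {r'. r' < N \<and> ?D r' < ?D z}" using z(1) zr by simp_all
        then show "{r'. r' < N \<and> ?D r' < ?D z} \<noteq> {r'. r' < N \<and> ?D r' < ?D r}" by blast
      qed
      then have "?c z < ?c r" by (intro psubset_card_mono) simp_all
      then have m: "?c z + Suc k \<le> N" using r(4) True by linarith
      have ch: "chain \<L> (pt s p # ext @ [pt s z])"
        using r(3) z(2) successively_append_iff[of "share \<L>" "pt s p # ext" "[pt s z]"] by simp
      have pl: "plen (pt s p # ext @ [pt s z]) = plen (pt s p # ext) + dist (pt s r) (pt s z)"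
        using dsum_snoc[of "pt s p # ext" dist "pt s z"] r(3) by simp
      have "?E (ext @ [pt s z]) z (run hop t)" using a ch pl r(3) z(1,4) by simp
      then show ?thesis using cz z(1) m by blast
    qed
  qed (simp_all add: N)
  then obtain ext r where r: "r < N" "?E ext r (run (FFor xj nsq hop) s)" "?D r \<le> 0 \<or> ?c r + N \<le> N" by blast
  have "?D r \<le> 0"
  proof (rule ccontr)
    assume D: "\<not> ?D r \<le> 0"
    then have "?c r = 0" using r(3) by simp
    then have "{r'. r' < N \<and> ?D r' < ?D r} = {}" by simp
    moreover have "nats s aNX (pr r q) < N" "?D (nats s aNX (pr r q)) < ?D r"
    proof -
      note z = nx[OF r(1) D[unfolded not_le]]
      show "nats s aNX (pr r q) < N" by (rule z[THEN conjunct1])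
      show "?D (nats s aNX (pr r q)) < ?D r" using z by linarith
    qed
    ultimately show False by blast
  qed
  then have "dist (pt s r) (pt s q) \<le> 0" "?D r = 0" using D0[OF r(1)] zero_le_dist[of "pt s r" "pt s q"] by linarith+
  then have "pt s r = pt s q" "?D r = 0" by simp_all
  then show ?thesis using r(2) by (intro exI[of _ ext]) simp
qed

lemma run_leg:
  fixes s :: store
  assumes N: "N = nats s 0 0 * nats s 0 0"
    and ok: "hops_ok \<L> N s" and I: "dp_inv N (\<lambda>w v. reals s aD (pr w v)) (smiss s) R l s"
    and x: "nats s xi 0 = k" "2 * nats s 0 0 - k = Suc i" "nats s bs 0 = a" "nats s cv 0 = w" "nats s cm 0 = m" "nats s cur 0 = w" "w < N"
    and P: "tP s (Suc i) a w m > 0" and v: "v = tP s (Suc i) a w m - 1"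
  shows "nats (run leg s) cv 0 = v \<and> nats (run leg s) cm 0 = m - smiss s (Suc i) w \<and> nats (run leg s) cur 0 = v \<and>
    (\<exists>ext. answer (run leg s) = answer s @ ext \<and> chain \<L> (pt s w # ext) \<and> set ext \<subseteq> pt s ` {..<N} \<and>
    last (pt s w # ext) = pt s v \<and> plen (pt s w # ext) \<le> reals s aD (pr w v))"
proof -
  have vN: "v < N" using dp_invD3[OF I P] by (simp add: v)
  define u where "u = run (FN tg (NConst 0) (NSub (NCell aP (NPr4 eh (V bs) (V cv) (V cm))) (NConst 1)) ;;
     FIf (emiss eh cv) (FN cm (NConst 0) (NSub (V cm) (NConst 1))) (FN cm (NConst 0) (V cm))) s"
  have sm: "smiss (nwrite b j z t) = smiss t" for b j z t by (simp add: fun_eq_iff smiss_def sdot_def)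
  have m01: "smiss s j p = 1 \<or> smiss s j p = 0" for j p by (simp add: smiss_def)
  have u: "nats u tg 0 = v" "nats u cm 0 = m - smiss s (Suc i) w" "nats u cur 0 = w" "nats u 0 = nats s 0"
    "nats u aNX = nats s aNX" "reals u = reals s" "answer u = answer s"
    using x m01[of "Suc i" w] by (auto simp: u_def sm v answer_def)
  have "hops_ok \<L> N u" using ok by (simp add: hops_ok_def u)
  from run_hops[OF this _ u(3,1) x(7) vN] obtain ext where ext: "answer (run (FFor xj nsq hop) u) = answer s @ ext" "chain \<L> (pt s w # ext)"
    "set ext \<subseteq> pt s ` {..<N}" "last (pt s w # ext) = pt s v" "plen (pt s w # ext) \<le> reals s aD (pr w v)"
    unfolding u using N by blast
  define r where "r = run (FFor xj nsq hop) u"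
  have r1: "nats r tg 0 = v" unfolding r_def using u(1) by (simp add: run_nats del: run.simps)
  have r2: "nats r cm 0 = m - smiss s (Suc i) w" unfolding r_def using u(2) by (simp add: run_nats del: run.simps)
  have s': "run leg s = nwrite cur 0 v (nwrite cv 0 v r)"
    using r1 by (simp add: leg_def u_def r_def del: run.simps(5))
  have "answer (run leg s) = answer r" unfolding s' by (rule answer_cong) simp_all
  then have "answer (run leg s) = answer s @ ext" using ext(1) by (simp only: r_def)
  moreover have "nats (run leg s) cv 0 = v" "nats (run leg s) cur 0 = v" "nats (run leg s) cm 0 = m - smiss s (Suc i) w"
    unfolding s' using r2 by simp_all
  ultimately show ?thesis using ext(2-5) by blast
qed

text \<open>Tracing back ends in layer 0, where only states with current vertex equal to the start,
  no misses and cost 0 are reached. Hence the printed list closes at \<open>a\<close>, its length is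
  within the cost, and the misses taken back add up to \<open>m\<close>.\<close>

lemma run_output_route:
  fixes s :: store
  defines "n \<equiv> nats s 0 0" and "N \<equiv> nats s 0 0 * nats s 0 0" and "s' \<equiv> run output_route s"
  assumes ok: "hops_ok \<L> N s" and I: "dp_inv N (\<lambda>w v. reals s aD (pr w v)) (smiss s) R l s"
    and x: "nats s fnd 0 = 1" "nats s bs 0 = a" "nats s bm 0 = m" "a < N" and P: "tP s (2 * n) a a m > 0"
  shows "answer s' \<noteq> [] \<and> chain \<L> (answer s') \<and> hd (answer s') = last (answer s') \<and> set (answer s') \<subseteq> pt s ` {..<N} \<and>
    plen (answer s') \<le> tT s (2 * n) a a m \<and>
    (\<exists>v. (\<forall>i<2 * n. v (Suc i) < N \<and> pt s (v (Suc i)) \<in> set (answer s')) \<and> (\<Sum>i<2 * n. smiss s (Suc i) (v (Suc i))) = m)"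
proof -
  define ms where "ms = smiss s"
  \<comment> \<open>\<open>h\<close> is the current layer, \<open>w\<close> its vertex and
    \<open>k\<close> the number of misses still to be accounted for; \<open>v\<close> collects the
    vertices traced so far, for layers \<open>h\<close> and above.\<close>
  let ?Q = "\<lambda>h t w k v. nats t cv 0 = w \<and> nats t cm 0 = k \<and> nats t cur 0 = w \<and> w < N \<and> tP s h a w k > 0 \<and>
     answer t \<noteq> [] \<and> chain \<L> (answer t) \<and> hd (answer t) = pt s a \<and> last (answer t) = pt s w \<and> set (answer t) \<subseteq> pt s ` {..<N} \<and>
     plen (answer t) + tT s h a w k \<le> tT s (2 * n) a a m \<and> v h = w \<and>
     (\<forall>i. h \<le> i \<longrightarrow> i \<le> 2 * n \<longrightarrow> v i < N \<and> pt s (v i) \<in> set (answer t)) \<and> k + (\<Sum>i\<in>{h..<2 * n}. ms (Suc i) (v (Suc i))) = m"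
  let ?I = "\<lambda>j t. \<exists>w k v. ?Q (2 * n - j) t w k v"
  define s0 where "s0 = run (push bs ;; FN cv (NConst 0) (V bs) ;; FN cm (NConst 0) (V bm) ;; FN cur (NConst 0) (V bs)) (nwrite 1 0 0 s)"
  have "s' = run (FFor xi ntwo leg) s0" using x(1) by (simp add: s'_def output_route_def s0_def del: run.simps(5))
  moreover have "?I (2 * n) (run (FFor xi ntwo leg) s0)"
  proof (rule run_For1[where I="?I"])
    have fr0: "nats s0 0 = nats s 0" by (simp add: s0_def run_nats)
    then show "nval ntwo s0 = 2 * n" by (simp add: n_def)
    have "answer (nwrite 1 0 0 s) = []" by (simp add: answer_def)
    then have "answer (run (push bs) (nwrite 1 0 0 s)) = [pt s a]" unfolding answer_push using x by simp
    then have ans: "answer s0 = [pt s a]"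
      using answer_cong[of s0 "run (push bs) (nwrite 1 0 0 s)"] by (simp add: s0_def)
    have "nats s0 cv 0 = a" "nats s0 cm 0 = m" "nats s0 cur 0 = a" using x by (simp_all add: s0_def run_nats)
    then show "?I 0 s0" using ans P x(4) by (intro exI[of _ a] exI[of _ m] exI[of _ "\<lambda>_. a"]) simp
    show "?I j (nwrite xi 0 z t)" if "?I j t" for j t z
    proof -
      have "answer (nwrite xi 0 z t) = answer t" by (rule answer_cong) simp_all
      then show ?thesis using that by simp
    qed
    fix j t assume j: "j < 2 * n" "nats t xi 0 = j" and f: "frame (insert xi (nmods leg)) (rmods leg) s0 t" and It: "?I j t"
    have f0: "frame {1, cur, tg, cm, cv, xj, xi} {1} s s0" by (simp add: frame_def s0_def run_nats run_reals)
    have fs: "frame {1, cur, tg, cm, cv, xj, xi} {1} s t" using frame_trans[OF f0 f] by auto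
    note fr = frame_nats[OF fs] frame_reals[OF fs]
    obtain i where i: "2 * n - j = Suc i" "2 * n - Suc j = i" "i < 2 * n" using j(1) by (metis Suc_diff_Suc diff_less_Suc less_Suc_eq_le diff_le_self Suc_le_lessD)
    obtain w k v where Q: "?Q (Suc i) t w k v" using It unfolding i(1) by (elim exE) (rule that)
    note q1 = Q[THEN conjunct1] and qr1 = Q[THEN conjunct2]
    note q2 = qr1[THEN conjunct1] and qr2 = qr1[THEN conjunct2]
    note q3 = qr2[THEN conjunct1] and qr3 = qr2[THEN conjunct2]
    note q4 = qr3[THEN conjunct1] and qr4 = qr3[THEN conjunct2]
    note q5 = qr4[THEN conjunct1] and qr5 = qr4[THEN conjunct2]
    note q6 = qr5[THEN conjunct1] and qr6 = qr5[THEN conjunct2]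
    note q7 = qr6[THEN conjunct1] and qr7 = qr6[THEN conjunct2]
    note q8 = qr7[THEN conjunct1] and qr8 = qr7[THEN conjunct2]
    note q9 = qr8[THEN conjunct1] and qr9 = qr8[THEN conjunct2]
    note q10 = qr9[THEN conjunct1] and qr10 = qr9[THEN conjunct2]
    note q11 = qr10[THEN conjunct1] and qr11 = qr10[THEN conjunct2]
    note q12 = qr11[THEN conjunct1] and qr12 = qr11[THEN conjunct2]
    note q13 = qr12[THEN conjunct1] and qr13 = qr12[THEN conjunct2]
    note q14 = qr13
    have okt: "hops_ok \<L> N t" using ok by (simp add: hops_ok_def fr)
    have smt: "smiss t = ms" by (simp add: fun_eq_iff smiss_def sdot_def fr ms_def)
    have It': "dp_inv N (\<lambda>w v. reals t aD (pr w v)) (smiss t) R l t"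
      unfolding smt ms_def using I dp_inv_cong[of t s] by (simp add: fr)
    define x where "x = tP s (Suc i) a w k - 1"
    have D3: "x < N" "ms (Suc i) w \<le> k" "tP s i a x (k - ms (Suc i) w) > 0"
      "tT s (Suc i) a w k = tT s i a x (k - ms (Suc i) w) + reals s aD (pr w x)"
      using dp_invD3[OF I q5] unfolding x_def ms_def by simp_all
    have t0: "N = nats t 0 0 * nats t 0 0" "2 * nats t 0 0 - j = Suc i" "nats t bs 0 = a" "reals t aD = reals s aD" "nats t aP = nats s aP"
      using assms(7) i(1) by (simp_all add: fr N_def n_def)
    have ptf: "reals t aX = reals s aX" "reals t aY = reals s aY" by (simp_all add: fr)
    have P': "tP t (Suc i) a w k > 0" "x = tP t (Suc i) a w k - 1" using q5 by (simp_all only: t0(5) x_def)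
    have "nats (run leg t) cv 0 = x \<and> nats (run leg t) cm 0 = k - ms (Suc i) w \<and> nats (run leg t) cur 0 = x \<and>
      (\<exists>ext. answer (run leg t) = answer t @ ext \<and> chain \<L> (pt s w # ext) \<and> set ext \<subseteq> pt s ` {..<N} \<and>
      last (pt s w # ext) = pt s x \<and> plen (pt s w # ext) \<le> reals s aD (pr w x))"
      using run_leg[OF t0(1) okt It' j(2) t0(2,3) q1 q2 q3 q4 P'] unfolding smt ptf t0(4) .
    then obtain ext where e: "nats (run leg t) cv 0 = x" "nats (run leg t) cm 0 = k - ms (Suc i) w" "nats (run leg t) cur 0 = x"
      "answer (run leg t) = answer t @ ext" "chain \<L> (pt s w # ext)" "set ext \<subseteq> pt s ` {..<N}"
      "last (pt s w # ext) = pt s x" "plen (pt s w # ext) \<le> reals s aD (pr w x)" by blast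
    obtain as where as: "answer t = as @ [pt s w]" using q6 q9 by (metis append_butlast_last_id)
    have ans: "answer (run leg t) = as @ pt s w # ext" using e(4) as by simp
    have pl: "plen (answer (run leg t)) = plen (answer t) + plen (pt s w # ext)"
      unfolding ans as by (rule dsum_append)
    have ch: "chain \<L> (answer (run leg t))" unfolding ans chain_append_last[of \<L> as "pt s w" ext] using q7 e(5) as by simp
    have la: "last (answer (run leg t)) = pt s x" unfolding ans using e(7) by simp
    have hd: "hd (answer (run leg t)) = pt s a" using e(4) q6 q8 by simp
    define v' where "v' = v(i := x)"
    have v'S: "v' y = v y" if "Suc i \<le> y" for y using that by (simp add: v'_def)
    have se: "set (answer (run leg t)) = set (answer t) \<union> set ext" using e(4) by simp
    have vis: "v' y < N \<and> pt s (v' y) \<in> set (answer (run leg t))" if "i \<le> y" "y \<le> 2 * n" for y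
    proof (cases "y = i")
      case True
      have "pt s x \<in> set (answer (run leg t))" using la last_in_set[of "answer (run leg t)"] ans by auto
      then show ?thesis using True D3(1) by (simp add: v'_def)
    next
      case False
      then have "Suc i \<le> y" using that(1) by simp
      then show ?thesis using q13 that(2) v'S[of y] se by simp
    qed
    have "(\<Sum>y\<in>{i..<2 * n}. ms (Suc y) (v' (Suc y))) = ms (Suc i) w + (\<Sum>y\<in>{Suc i..<2 * n}. ms (Suc y) (v (Suc y)))"
    proof -
      have "v' (Suc i) = w" using v'S[of "Suc i"] q12 by simp
      moreover have "(\<Sum>y\<in>{Suc i..<2 * n}. ms (Suc y) (v' (Suc y))) = (\<Sum>y\<in>{Suc i..<2 * n}. ms (Suc y) (v (Suc y)))"
        by (intro sum.cong refl) (simp add: v'S)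
      ultimately show ?thesis using sum.atLeast_Suc_lessThan[OF i(3), of "\<lambda>y. ms (Suc y) (v' (Suc y))"] by simp
    qed
    then have su: "k - ms (Suc i) w + (\<Sum>y\<in>{i..<2 * n}. ms (Suc y) (v' (Suc y))) = m" using q14 D3(2) by simp
    have "plen (answer (run leg t)) + tT s i a x (k - ms (Suc i) w) \<le> tT s (2 * n) a a m"
      using pl e(8) q11 D3(4) by linarith
    moreover have "answer (run leg t) \<noteq> []" "set (answer (run leg t)) \<subseteq> pt s ` {..<N}" "v' i = x"
      using ans se q10 e(6) by (simp_all add: v'_def)
    ultimately have "?Q i (run leg t) x (k - ms (Suc i) w) v'"
      using e(1-3) D3(1,3) ch hd la vis su by (intro conjI allI impI) blast+
    then show "?I (Suc j) (run leg t)" unfolding i(2) by blast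
  qed simp_all
  ultimately have "\<exists>w k v. ?Q 0 s' w k v" by simp
  then obtain w k v where Q: "?Q 0 s' w k v" by (elim exE) (rule that)
  note q1 = Q[THEN conjunct1] and qr1 = Q[THEN conjunct2]
  note q2 = qr1[THEN conjunct1] and qr2 = qr1[THEN conjunct2]
  note q3 = qr2[THEN conjunct1] and qr3 = qr2[THEN conjunct2]
  note q4 = qr3[THEN conjunct1] and qr4 = qr3[THEN conjunct2]
  note q5 = qr4[THEN conjunct1] and qr5 = qr4[THEN conjunct2]
  note q6 = qr5[THEN conjunct1] and qr6 = qr5[THEN conjunct2]
  note q7 = qr6[THEN conjunct1] and qr7 = qr6[THEN conjunct2]
  note q8 = qr7[THEN conjunct1] and qr8 = qr7[THEN conjunct2]
  note q9 = qr8[THEN conjunct1] and qr9 = qr8[THEN conjunct2]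
  note q10 = qr9[THEN conjunct1] and qr10 = qr9[THEN conjunct2]
  note q11 = qr10[THEN conjunct1] and qr11 = qr10[THEN conjunct2]
  note q12 = qr11[THEN conjunct1] and qr12 = qr11[THEN conjunct2]
  note q13 = qr12[THEN conjunct1] and qr13 = qr12[THEN conjunct2]
  note q14 = qr13
  have wk: "w = a" "k = 0" "tT s 0 a w k = 0" using dp_invD2[OF I q5] by blast+
  have "hd (answer s') = last (answer s')" using q8 q9 wk(1) by simp
  moreover have "plen (answer s') \<le> tT s (2 * n) a a m" using q11 wk(3) by simp
  moreover have "(\<Sum>i<2 * n. smiss s (Suc i) (v (Suc i))) = m" using q14 wk(2) by (simp add: ms_def atLeast0LessThan)
  moreover have "\<forall>i<2 * n. v (Suc i) < N \<and> pt s (v (Suc i)) \<in> set (answer s')" using q13 by simp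
  ultimately show ?thesis using q6 q7 q10 by blast
qed

lemma run_output_none:
  "nats s fnd 0 = 0 \<Longrightarrow> answer (run output_route s) = []"
  by (simp add: output_route_def answer_def)

section \<open>Correctness of the computed tables\<close>

definition core :: "nat \<Rightarrow> fprog" where
  "core b = normalise (b + 4) ;; sort_lines ;; find_base ;; make_vertices ;; init_dist b ;; floyd_warshall ;;
     next_hops ;; make_triples ;; dp_init ;; dp_loop"

text \<open>By Lagrange's identity, unit vectors with determinant 0 have inner product 1 or -1; the
  latter makes them opposite, which the half-plane excludes.\<close>

lemma unit_upper_eq:
  fixes a b a' b' :: real
  assumes "a * a + b * b = 1" "a' * a' + b' * b' = 1" "0 < b \<or> b = 0 \<and> 0 < a" "0 < b' \<or> b' = 0 \<and> 0 < a'"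
    and "a * b' = a' * b"
  shows "a = a' \<and> b = b'"
proof -
  define d where "d = a * a' + b * b'"
  have "(a * a + b * b) * (a' * a' + b' * b') = d * d + (a * b' - a' * b) * (a * b' - a' * b)"
    by (simp add: d_def algebra_simps)
  then have "d * d = 1" using assms by simp
  then have d: "d = 1 \<or> d = - 1" by (simp add: square_eq_1_iff)
  have sq: "(a - a') * (a - a') + (b - b') * (b - b') = 2 - 2 * d" "(a + a') * (a + a') + (b + b') * (b + b') = 2 + 2 * d"
    using assms(1,2) by (simp_all add: d_def algebra_simps)
  show ?thesis
  proof (cases "d = 1")
    case True
    then show ?thesis using sq(1) by (simp add: sum_squares_eq_zero_iff)
  next
    case False
    then have "a + a' = 0" "b + b' = 0" using d sq(2) by (simp_all add: sum_squares_eq_zero_iff)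
    then show ?thesis using assms(3,4) by linarith
  qed
qed

text \<open>Both problems share this input up to the offset \<open>b\<close> of the box, which is
  followed by the coefficients. Zeros in all other natural arrays mean that no state counts as
  reached at the start.\<close>

locale arrangement_input =
  fixes ls :: "(real \<times> real \<times> real) list" and lo hi :: "real \<times> real" and b :: nat and s :: store
  assumes arr: "line_arrangement ls lo hi"
    and n_cell: "nats s 0 0 = length ls"
    and zero: "\<And>a. a \<noteq> 0 \<Longrightarrow> nats s a = (\<lambda>_. 0)"
    and box: "reals s 0 b = fst lo" "reals s 0 (b + 1) = snd lo" "reals s 0 (b + 2) = fst hi" "reals s 0 (b + 3) = snd hi"
    and coef: "\<And>k. k < length ls \<Longrightarrow>
      ls ! k = (reals s 0 (b + 4 + 3 * k), reals s 0 (Suc (b + 4 + 3 * k)), reals s 0 (Suc (Suc (b + 4 + 3 * k))))"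
begin

definition n :: nat where "n = length ls"
definition N :: nat where "N = n * n"

definition "s1 = run (normalise (b + 4)) s"
definition "s2 = run sort_lines s1"
definition "s3 = run find_base s2"
definition "s4 = run make_vertices s3"
definition "s5 = run (init_dist b) s4"
definition "s6 = run floyd_warshall s5"
definition "s7 = run next_hops s6"
definition "s8 = run make_triples s7"
definition "s9 = run dp_init s8"
definition "sf = run dp_loop s9"

lemmas s_defs = s1_def s2_def s3_def s4_def s5_def s6_def s7_def s8_def s9_def sf_def

lemma run_core: "run (core b) s = sf"
  by (simp add: core_def s_defs)

definition "NA = reals s1 aNA"
definition "NB = reals s1 aNB"
definition "NC = reals s1 aNC"

lemma frames [simp]:
  "nats s1 0 = nats s 0" "nats s2 0 = nats s 0" "nats s3 0 = nats s 0" "nats s4 0 = nats s 0" "nats s5 0 = nats s 0"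
  "nats s6 0 = nats s 0" "nats s7 0 = nats s 0" "nats s8 0 = nats s 0" "nats s9 0 = nats s 0" "nats sf 0 = nats s 0"
  "reals s2 aNA = NA" "reals s3 aNA = NA" "reals s4 aNA = NA" "reals s5 aNA = NA" "reals s6 aNA = NA"
  "reals s2 aNB = NB" "reals s3 aNB = NB" "reals s4 aNB = NB" "reals s5 aNB = NB" "reals s6 aNB = NB"
  "reals s2 aNC = NC" "reals s3 aNC = NC" "reals s4 aNC = NC" "reals s5 aNC = NC" "reals s6 aNC = NC"
  "reals s4 0 = reals s 0"
  by (simp_all add: s_defs NA_def NB_def NC_def run_nats run_reals)

lemma frames_final:
  "reals s4 aX = reals sf aX" "reals s5 aX = reals sf aX" "reals s6 aX = reals sf aX" "reals s7 aX = reals sf aX" "reals s8 aX = reals sf aX" "reals s9 aX = reals sf aX"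
  "reals s4 aY = reals sf aY" "reals s5 aY = reals sf aY" "reals s6 aY = reals sf aY" "reals s7 aY = reals sf aY" "reals s8 aY = reals sf aY" "reals s9 aY = reals sf aY"
  "reals s2 aUA = reals sf aUA" "reals s7 aUA = reals sf aUA" "reals s9 aUA = reals sf aUA"
  "reals s2 aUB = reals sf aUB" "reals s7 aUB = reals sf aUB" "reals s9 aUB = reals sf aUB"
  "reals s2 aUC = reals sf aUC" "reals s7 aUC = reals sf aUC" "reals s9 aUC = reals sf aUC"
  "reals s6 aD = reals sf aD" "reals s7 aD = reals sf aD" "reals s9 aD = reals sf aD"
  "nats s7 aNX = nats sf aNX" "nats s6 aAD = nats s5 aAD" "nats s8 tc = nats s9 tc" "nats s8 aTI = nats s9 aTI"
  "nats s8 aTV = nats s9 aTV" "nats s8 aTW = nats s9 aTW"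
  by (simp_all add: s_defs run_nats run_reals)

lemma n0: "nats s 0 0 = n"
  by (simp add: n_def n_cell)

section \<open>Lines and crossings of the input\<close>

definition Lk :: "nat \<Rightarrow> (real \<times> real) set" where "Lk k = line_of (ls ! k)"

lemma normals:
  assumes "k < n"
  shows "Lk k = {z. (NA k, NB k) \<bullet> z = NC k}" "NA k * NA k + NB k * NB k = 1" "0 < NB k \<or> NB k = 0 \<and> 0 < NA k"
proof -
  have nz: "reals s 0 (b + 4 + 3 * k) \<noteq> 0 \<or> reals s 0 (Suc (b + 4 + 3 * k)) \<noteq> 0" if "k < n" for k
  proof -
    have "ls ! k \<in> set ls" using that by (simp add: n_def)
    then show ?thesis using arr coef[of k] that unfolding line_arrangement_def by (fastforce simp: n_def)
  qed
  have "norm_line (reals s 0 (b + 4 + 3 * k)) (reals s 0 (Suc (b + 4 + 3 * k))) (reals s 0 (Suc (Suc (b + 4 + 3 * k)))) (NA k) (NB k) (NC k)"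
    using run_normalise[OF n0 nz] assms by (simp add: NA_def NB_def NC_def s1_def)
  then obtain r where r: "r \<noteq> 0" "NA k = reals s 0 (b + 4 + 3 * k) / r" "NB k = reals s 0 (Suc (b + 4 + 3 * k)) / r"
    "NC k = reals s 0 (Suc (Suc (b + 4 + 3 * k))) / r" and
    u: "NA k * NA k + NB k * NB k = 1" "0 < NB k \<or> NB k = 0 \<and> 0 < NA k" unfolding norm_line_def by blast
  show "NA k * NA k + NB k * NB k = 1" "0 < NB k \<or> NB k = 0 \<and> 0 < NA k" by (rule u)+
  have "A * x + B * y = C \<longleftrightarrow> A / r * x + B / r * y = C / r" for A B C x y :: real
    using r(1) by (simp add: field_simps flip: distrib_left)
  then show "Lk k = {z. (NA k, NB k) \<bullet> z = NC k}"
    using assms coef[of k] by (auto simp: Lk_def line_of_def n_def r(2-4))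
qed

lemma bij_Lk: "bij_betw Lk {..<n} (lines ls)"
proof -
  have d: "distinct (map line_of ls)" using arr by (simp add: line_arrangement_def)
  have "bij_betw ((!) (map line_of ls)) {..<n} (lines ls)" by (rule bij_betw_nth[OF d]) (simp_all add: n_def lines_def)
  moreover have "map line_of ls ! k = Lk k" if "k \<in> {..<n}" for k using that by (simp add: Lk_def n_def)
  ultimately show ?thesis using bij_betw_cong[of "{..<n}" "(!) (map line_of ls)" Lk "lines ls"] by blast
qed

lemma lines_eq: "lines ls = Lk ` {..<n}"
  using bij_Lk by (simp add: bij_betw_def)

lemma parallel_eq: "i < n \<Longrightarrow> j < n \<Longrightarrow> detf NA NB i j = 0 \<Longrightarrow> NA i = NA j \<and> NB i = NB j"
  using unit_upper_eq[of "NA i" "NB i" "NA j" "NB j"] normals(2,3)[of i] normals(2,3)[of j] by (simp add: detf_def)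

lemma isect_mem:
  assumes "i < n" "j < n" "detf NA NB i j \<noteq> 0"
  shows "isect NA NB NC i j \<in> Lk i \<inter> Lk j" "Lk i \<noteq> Lk j"
proof -
  define d where "d = detf NA NB i j"
  have d: "d \<noteq> 0" "d = NA i * NB j - NA j * NB i" using assms by (simp_all add: d_def detf_def)
  have "NA i * (NC i * NB j - NC j * NB i) + NB i * (NA i * NC j - NA j * NC i) = NC i * d"
    "NA j * (NC i * NB j - NC j * NB i) + NB j * (NA i * NC j - NA j * NC i) = NC j * d"
    by (simp_all add: d(2) algebra_simps)
  then have "NA i * ((NC i * NB j - NC j * NB i) / d) + NB i * ((NA i * NC j - NA j * NC i) / d) = NC i"
    "NA j * ((NC i * NB j - NC j * NB i) / d) + NB j * ((NA i * NC j - NA j * NC i) / d) = NC j"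
    using d(1) by (simp_all flip: add_divide_distrib)
  then show m: "isect NA NB NC i j \<in> Lk i \<inter> Lk j"
    by (simp add: normals(1) assms isect_def d_def[symmetric] inner_prod_def)
  show "Lk i \<noteq> Lk j"
  proof
    assume eq: "Lk i = Lk j"
    \<comment> \<open>A step along line \<open>i\<close> away from the crossing leaves line
      \<open>j\<close>, as the determinant is nonzero.\<close>
    define z where "z = isect NA NB NC i j + (- NB i, NA i)"
    have "z \<in> Lk i" using m assms by (simp add: z_def normals(1) inner_add_right)
    then have "(NA j, NB j) \<bullet> z = NC j" using eq normals(1)[of j] assms by simp
    then have "(NA j, NB j) \<bullet> (- NB i, NA i) = 0" using m assms by (simp add: z_def normals(1) inner_add_right)
    then show False using assms by (simp add: inner_prod_def detf_def algebra_simps)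
  qed
qed

lemma vertices_eq: "vertices (lines ls) = crossings n NA NB NC"
proof
  show "crossings n NA NB NC \<subseteq> vertices (lines ls)"
  proof
    fix z assume "z \<in> crossings n NA NB NC"
    then obtain i j where ij: "z = isect NA NB NC i j" "i < n" "j < n" "detf NA NB i j \<noteq> 0" unfolding crossings_def by blast
    then show "z \<in> vertices (lines ls)" using isect_mem[OF ij(2-4)] unfolding vertices_def lines_eq by blast
  qed
  show "vertices (lines ls) \<subseteq> crossings n NA NB NC"
  proof
    fix z assume "z \<in> vertices (lines ls)"
    then obtain i j where ij: "i < n" "j < n" "Lk i \<noteq> Lk j" "z \<in> Lk i" "z \<in> Lk j"
      unfolding vertices_def lines_eq by blast
    have e: "NA i * fst z + NB i * snd z = NC i" "NA j * fst z + NB j * snd z = NC j"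
      using ij by (simp_all add: normals(1) inner_prod_def)
    have det: "detf NA NB i j \<noteq> 0"
    proof
      assume "detf NA NB i j = 0"
      then have "NA i = NA j" "NB i = NB j" using parallel_eq ij by blast+
      then show False using e ij by (simp add: normals(1))
    qed
    define d where "d = detf NA NB i j"
    have d: "d \<noteq> 0" "d = NA i * NB j - NA j * NB i" using det by (simp_all add: d_def detf_def)
    have "NC i * NB j - NC j * NB i = fst z * d" "NA i * NC j - NA j * NC i = snd z * d"
      by (simp_all add: d(2) algebra_simps flip: e)
    then have "z = isect NA NB NC i j" using d(1) by (simp add: isect_def d_def[symmetric] prod_eq_iff)
    then show "z \<in> crossings n NA NB NC" using ij det unfolding crossings_def by blast
  qed
qed

text \<open>Otherwise all unit normals would agree and the lines would be translates of one another,
  that is, all parallel.\<close>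

lemma ex_crossing: "\<exists>i<n. \<exists>j<n. detf NA NB i j \<noteq> 0"
proof (rule ccontr)
  assume "\<not> ?thesis"
  then have eq: "NA i = NA j \<and> NB i = NB j" if "i < n" "j < n" for i j using parallel_eq that by blast
  have "affine_parallel (Lk i) (Lk j)" if "i < n" "j < n" for i j
    unfolding affine_parallel_expl
  proof (intro exI allI)
    fix x
    define t where "t = (NC j - NC i) *\<^sub>R (NA i, NB i)"
    have "(NA i, NB i) \<bullet> t = (NC j - NC i) * (NA i * NA i + NB i * NB i)"
      by (simp add: t_def inner_prod_def algebra_simps)
    then have t: "(NA i, NB i) \<bullet> t = NC j - NC i" using normals(2)[OF that(1)] by simp
    have j: "(NA j, NB j) = (NA i, NB i)" using eq[OF that] by simp
    have "x \<in> Lk i \<longleftrightarrow> t + x \<in> Lk j"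
      unfolding normals(1)[OF that(1)] normals(1)[OF that(2)] mem_Collect_eq inner_add_right j t by auto
    then show "x \<in> Lk i \<longleftrightarrow> (NC j - NC i) *\<^sub>R (NA i, NB i) + x \<in> Lk j" by (simp only: t_def)
  qed
  then have "affine_parallel (line_of l) (line_of m)" if "l \<in> set ls" "m \<in> set ls" for l m
    using that by (metis Lk_def in_set_conv_nth n_def)
  then show False using arr unfolding line_arrangement_def by blast
qed

lemma crossings_nonempty: "crossings n NA NB NC \<noteq> {}"
  using ex_crossing unfolding crossings_def by blast

lemma n_pos: "n > 0"
  using ex_crossing by auto

abbreviation "p \<equiv> pt sf"

lemma pt_image: "p ` {..<N} = vertices (lines ls)"
proof -
  have "(reals s3 bx 0, reals s3 byy 0) \<in> crossings (nats s3 0 0) (reals s3 aNA) (reals s3 aNB) (reals s3 aNC)"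
    using run_find_base[of s2] crossings_nonempty unfolding s3_def[symmetric] by (simp add: n0)
  from run_make_vertices[OF this] have "pt s4 ` {..<N} = crossings n NA NB NC" by (simp add: s4_def[symmetric] n0 N_def)
  then show ?thesis by (simp add: vertices_eq frames_final)
qed

lemma vertex_pt: "k < N \<Longrightarrow> p k \<in> vertices (lines ls)"
  using pt_image by blast

text \<open>A crossing has at least two numbers, one for each order of its lines, so one has to be
  chosen.\<close>

definition vid :: "real \<times> real \<Rightarrow> nat" where "vid z = (SOME k. k < N \<and> p k = z)"

lemma vid: "z \<in> vertices (lines ls) \<Longrightarrow> vid z < N" "z \<in> vertices (lines ls) \<Longrightarrow> p (vid z) = z"
proof -
  have *: "vid z < N \<and> p (vid z) = z" if "z \<in> vertices (lines ls)"
  proof -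
    have "z \<in> p ` {..<N}" using that by (simp only: pt_image)
    then have "\<exists>k. k < N \<and> p k = z" by blast
    then show ?thesis unfolding vid_def by (rule someI_ex)
  qed
  then show "z \<in> vertices (lines ls) \<Longrightarrow> vid z < N" "z \<in> vertices (lines ls) \<Longrightarrow> p (vid z) = z" by blast+
qed

lemma vertices_in_box: "vertices (lines ls) \<subseteq> cbox lo hi"
proof
  fix z assume "z \<in> vertices (lines ls)"
  then obtain L M where "L \<in> lines ls" "M \<in> lines ls" "L \<noteq> M" "z \<in> L" "z \<in> M" unfolding vertices_def by blast
  then show "z \<in> cbox lo hi" using arr unfolding line_arrangement_def lines_def by blast
qed

definition diam :: real where "diam = (fst hi - fst lo) + (snd hi - snd lo)"

lemma dist_le_diam: "z \<in> vertices (lines ls) \<Longrightarrow> z' \<in> vertices (lines ls) \<Longrightarrow> dist z z' \<le> diam"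
proof -
  assume "z \<in> vertices (lines ls)" "z' \<in> vertices (lines ls)"
  then have z: "z \<in> cbox lo hi" "z' \<in> cbox lo hi" using vertices_in_box by blast+
  have box: "w \<in> cbox lo hi \<longleftrightarrow> fst lo \<le> fst w \<and> fst w \<le> fst hi \<and> snd lo \<le> snd w \<and> snd w \<le> snd hi" for w :: "real \<times> real"
    by (cases lo; cases hi; cases w) (auto simp: cbox_Pair_eq)
  have "dist z z' \<le> \<bar>fst z - fst z'\<bar> + \<bar>snd z - snd z'\<bar>"
    using sqrt_sum_squares_le_sum_abs[of "fst z - fst z'" "snd z - snd z'"] by (simp add: dist_prod_def dist_real_def)
  then show ?thesis using z unfolding box diam_def by linarith
qed

lemma on_line_iff: "l < n \<Longrightarrow> on_line s4 l k \<longleftrightarrow> p k \<in> Lk l"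
  by (simp add: on_line_def normals(1) inner_prod_def frames_final)

lemma adj_iff: "adj s4 n q r \<longleftrightarrow> share (lines ls) (p q) (p r)"
  unfolding adj_def share_def lines_eq by (auto simp: on_line_iff)

section \<open>The distance table\<close>

abbreviation "R q r \<equiv> share (lines ls) (p q) (p r)"
abbreviation "w q r \<equiv> dist (p q) (p r)"
abbreviation "D q r \<equiv> reals sf aD (pr q r)"

lemma init_tables:
  assumes "q < N" "r < N"
  shows "nats s5 aAD (pr q r) = 1 \<longleftrightarrow> R q r" "reals s5 aD (pr q r) = (if R q r then w q r else 3 * diam)"
proof -
  have "big b s4 = 3 * diam" by (simp add: big_def box diam_def numeral_2_eq_2 numeral_3_eq_3) (simp add: box[unfolded numeral_2_eq_2 numeral_3_eq_3, simplified])
  then show "nats s5 aAD (pr q r) = 1 \<longleftrightarrow> R q r" "reals s5 aD (pr q r) = (if R q r then w q r else 3 * diam)"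
    using run_init_dist[where b=b and s=s4 and p=q and q=r] assms unfolding s5_def[symmetric] by (simp_all add: n0 N_def adj_iff frames_final)
qed

lemma refl_R: "q < N \<Longrightarrow> R q q"
  using vertex_pt[of q] by (auto simp: vertices_def share_def)

text \<open>Vertices on intersecting lines are joined through the crossing by two segments, those on
  parallel lines through a transversal by three. This is the origin of the factor 3 in
  \<open>big\<close>.\<close>

lemma initial_walk:
  assumes "q < N" "r < N"
  shows "\<exists>xs. id_walk R N q r xs \<and> dsum w xs \<le> reals s5 aD (pr q r)"
proof (cases "R q r")
  case True
  then show ?thesis using init_tables[OF assms] assms by (intro exI[of _ "[q, r]"]) (simp add: id_walk_def)
next
  case False
  have ids: "\<exists>k<N. p k = isect NA NB NC i j" if "i < n" "j < n" "detf NA NB i j \<noteq> 0" for i j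
  proof -
    have "isect NA NB NC i j \<in> p ` {..<N}" unfolding pt_image vertices_eq crossings_def using that by blast
    then show ?thesis by (auto simp del: split_paired_All)
  qed
  have le: "w x y \<le> diam" if "x < N" "y < N" for x y using dist_le_diam vertex_pt that by blast
  have diam0: "diam \<ge> 0" using le[OF assms] zero_le_dist[of "p q" "p r"] by linarith
  have onl: "\<exists>i<n. p k \<in> Lk i" if "k < N" for k using vertex_pt[OF that] unfolding vertices_def lines_eq by blast
  obtain i j where ij: "i < n" "j < n" "p q \<in> Lk i" "p r \<in> Lk j" using onl assms by blast
  have RI: "R x y" if "l < n" "p x \<in> Lk l" "p y \<in> Lk l" for x y l using that unfolding share_def lines_eq by blast
  have D: "reals s5 aD (pr q r) = 3 * diam" using init_tables[OF assms] False by simp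
  show ?thesis
  proof (cases "detf NA NB i j = 0")
    case False
    obtain k where k: "k < N" "p k = isect NA NB NC i j" using ids[OF ij(1,2) False] by blast
    have "p k \<in> Lk i" "p k \<in> Lk j" using isect_mem(1)[OF ij(1,2) False] k(2) by simp_all
    then have "id_walk R N q r [q, k, r]" using RI ij assms k(1) by (simp add: id_walk_def)
    moreover have "dsum w [q, k, r] \<le> 3 * diam" using le[of q k] le[of k r] assms k(1) diam0 by simp
    ultimately show ?thesis unfolding D by blast
  next
    case True
    have "\<exists>l<n. detf NA NB i l \<noteq> 0"
    proof (rule ccontr)
      assume "\<not> ?thesis"
      then have "NA l = NA i \<and> NB l = NB i" if "l < n" for l using parallel_eq[of i l] ij that by simp
      then show False using ex_crossing by (auto simp: detf_def)
    qed
    then obtain l where l: "l < n" "detf NA NB i l \<noteq> 0" by blast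
    have l2: "detf NA NB j l \<noteq> 0" using l(2) parallel_eq[OF ij(1,2) True] by (simp add: detf_def)
    obtain k1 where k1: "k1 < N" "p k1 = isect NA NB NC i l" using ids[OF ij(1) l] by blast
    obtain k2 where k2: "k2 < N" "p k2 = isect NA NB NC j l" using ids[OF ij(2) l(1) l2] by blast
    have "p k1 \<in> Lk i" "p k1 \<in> Lk l" "p k2 \<in> Lk j" "p k2 \<in> Lk l"
      using isect_mem(1)[OF ij(1) l] isect_mem(1)[OF ij(2) l(1) l2] k1(2) k2(2) by simp_all
    then have "id_walk R N q r [q, k1, k2, r]" using RI ij assms k1(1) k2(1) l(1) by (simp add: id_walk_def)
    moreover have "dsum w [q, k1, k2, r] \<le> 3 * diam" using le[of q k1] le[of k1 k2] le[of k2 r] assms k1(1) k2(1) by simp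
    ultimately show ?thesis unfolding D by blast
  qed
qed

lemma D_realised: "q < N \<Longrightarrow> r < N \<Longrightarrow> \<exists>xs. id_walk R N q r xs \<and> dsum w xs \<le> D q r"
  and D_complete: "q < N \<Longrightarrow> r < N \<Longrightarrow> set xs \<subseteq> {..<N} \<Longrightarrow> successively R (q # xs @ [r]) \<Longrightarrow> D q r \<le> dsum w (q # xs @ [r])"
proof -
  have *: "(\<forall>q<N. \<forall>r<N. \<exists>xs. id_walk R N q r xs \<and> dsum w xs \<le> D q r) \<and>
    (\<forall>q<N. \<forall>r<N. \<forall>xs. set xs \<subseteq> {..<N} \<longrightarrow> successively R (q # xs @ [r]) \<longrightarrow> D q r \<le> dsum w (q # xs @ [r]))"
    using run_floyd_warshall[of w s5 R] initial_walk init_tables(2)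
    unfolding s6_def[symmetric] by (simp add: n0 N_def[symmetric] frames_final)
  then show "q < N \<Longrightarrow> r < N \<Longrightarrow> \<exists>xs. id_walk R N q r xs \<and> dsum w xs \<le> D q r"
    "q < N \<Longrightarrow> r < N \<Longrightarrow> set xs \<subseteq> {..<N} \<Longrightarrow> successively R (q # xs @ [r]) \<Longrightarrow> D q r \<le> dsum w (q # xs @ [r])"
    by blast+
qed

lemma D_le_walk:
  assumes "id_walk R N q r xs"
  shows "D q r \<le> dsum w xs"
proof -
  have xs: "xs \<noteq> []" "hd xs = q" "last xs = r" "set xs \<subseteq> {..<N}" "successively R xs" using assms by (auto simp: id_walk_def)
  have qr: "q < N" "r < N" using xs hd_in_set last_in_set by blast+
  obtain ys where ys: "xs = q # ys" using xs(1,2) by (cases xs) auto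
  show ?thesis
  proof (cases ys rule: rev_cases)
    case Nil
    then have "q = r" using xs(3) ys by simp
    then show ?thesis using D_complete[OF qr, of "[]"] refl_R[OF qr(1)] Nil ys by simp
  next
    case (snoc zs z)
    then have "z = r" using xs(3) ys by simp
    then show ?thesis using D_complete[OF qr, of zs] xs(4,5) ys snoc by simp
  qed
qed

lemma D_step: "R q z \<Longrightarrow> q < N \<Longrightarrow> z < N \<Longrightarrow> r < N \<Longrightarrow> D q r \<le> w q z + D z r"
proof -
  assume *: "R q z" "q < N" "z < N" "r < N"
  obtain xs where xs: "id_walk R N z r xs" "dsum w xs \<le> D z r" using D_realised *(3,4) by blast
  then have ne: "xs \<noteq> []" "hd xs = z" by (simp_all add: id_walk_def)
  have "id_walk R N q r (q # xs)" using xs(1) *(1,2) ne by (cases xs) (simp_all add: id_walk_def)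
  from D_le_walk[OF this] xs(2) show ?thesis using ne dsum_Cons[of xs w q] by simp
qed

lemma D_ge_dist: "q < N \<Longrightarrow> r < N \<Longrightarrow> w q r \<le> D q r"
proof -
  assume "q < N" "r < N"
  then obtain xs where xs: "id_walk R N q r xs" "dsum w xs \<le> D q r" using D_realised by blast
  have "dist (p (hd xs)) (p (last xs)) \<le> dsum w xs" if "xs \<noteq> []" for xs using that
  proof (induction xs rule: induct_list012)
    case (3 x y zs)
    have "dist (p x) (p (last (y # zs))) \<le> dist (p x) (p y) + dist (p y) (p (last (y # zs)))" by (rule dist_triangle)
    then show ?case using 3(2) by simp
  qed simp_all
  then show ?thesis using xs by (force simp: id_walk_def)
qed

text \<open>The first edge of a realising walk is tight. If it has length zero, both ends number the
  same point and have the same distance to \<open>r\<close>, so the search continues from the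
  second.\<close>

lemma hop_exists:
  "id_walk R N q r xs \<Longrightarrow> dsum w xs \<le> D q r \<Longrightarrow> 0 < D q r \<Longrightarrow> \<exists>z<N. R q z \<and> 0 < w q z \<and> w q z + D z r = D q r"
proof (induction xs arbitrary: q)
  case (Cons x xs)
  have q: "x = q" "q < N" using Cons.prems(1) by (auto simp: id_walk_def)
  have r: "r < N" using Cons.prems(1) last_in_set[of "x # xs"] by (auto simp: id_walk_def simp del: last.simps)
  show ?case
  proof (cases xs)
    case Nil
    then have "q = r" using Cons.prems(1) by (simp add: id_walk_def)
    then have "D q r \<le> 0" using D_complete[of q q "[]"] refl_R q(2) by simp
    then show ?thesis using Cons.prems(3) by simp
  next
    case (Cons z zs)
    have z: "z < N" "R q z" "id_walk R N z r xs" using Cons.prems(1) q Cons by (auto simp: id_walk_def)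
    have d: "w q z + dsum w xs \<le> D q r" using Cons.prems(2) q Cons by simp
    have Dz: "D z r \<le> dsum w xs" using D_le_walk z(3) by blast
    have up: "D q r \<le> w q z + D z r" using D_step[OF z(2) q(2) z(1) r] .
    show ?thesis
    proof (cases "w q z > 0")
      case True
      then show ?thesis using z(1,2) d Dz up by (intro exI[of _ z]) simp
    next
      case False
      then have eq: "p q = p z" by simp
      have "D z r \<le> w z q + D q r" using share_commute[THEN iffD1, OF z(2)] z(1) q(2) r by (rule D_step)
      then have "D z r = D q r" using up eq by simp
      then obtain z' where "z' < N" "R z z'" "0 < w z z'" "w z z' + D z' r = D z r"
        using Cons.IH[of z] z(3) d Cons.prems(3) eq by auto
      then show ?thesis using eq \<open>D z r = D q r\<close> by auto
    qed
  qed
qed (simp add: id_walk_def)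

lemma hops: "hops_ok (lines ls) N sf"
  unfolding hops_ok_def
proof (intro allI impI conjI)
  fix q r assume qr: "q < N" "r < N"
  show "w q r \<le> D q r" using D_ge_dist qr .
  assume pos: "0 < D q r"
  obtain z where z: "z < N" "R q z" "0 < w q z" "w q z + D z r = D q r" using hop_exists D_realised[OF qr] pos by blast
  have "nats s6 aAD (pr q z) = 1" using init_tables(1)[OF qr(1) z(1)] z(2) by (simp add: frames_final)
  then have h: "nats sf aNX (pr q r) < N" "nats s5 aAD (pr q (nats sf aNX (pr q r))) = 1"
     "0 < w q (nats sf aNX (pr q r))" "w q (nats sf aNX (pr q r)) + D (nats sf aNX (pr q r)) r = D q r"
    using run_next_hops[of q s6 r z] qr z unfolding s7_def[symmetric]
    by (simp_all add: n0 N_def[symmetric] frames_final)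
  show "nats sf aNX (pr q r) < N" "0 < w q (nats sf aNX (pr q r))" "w q (nats sf aNX (pr q r)) + D (nats sf aNX (pr q r)) r = D q r"
    by (rule h)+
  show "R q (nats sf aNX (pr q r))" using init_tables(1)[OF qr(1) h(1)] h(2) by simp
qed

text \<open>Points other than crossings are bypassed and interior crossings are numbered by
  \<open>vid\<close>, while the ends keep the given numbers \<open>q\<close> and
  \<open>r\<close>.\<close>

lemma D_le_chain:
  assumes qr: "q < N" "r < N" and xs: "xs \<noteq> []" "chain (lines ls) xs" "hd xs = p q" "last xs = p r"
  shows "D q r \<le> plen xs"
proof -
  obtain ys where ys: "xs = p q # ys" using xs(1,3) by (cases xs) auto
  define V where "V = vertices (lines ls)"
  have lastV: "last (p q # ys) \<in> V" using xs(4) ys vertex_pt[OF qr(2)] by (simp add: V_def)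
  have c: "chain (lines ls) (p q # filter (\<lambda>z. z \<in> V) ys)" "plen (p q # filter (\<lambda>z. z \<in> V) ys) \<le> plen xs"
    using chain_filter_vertices[of "lines ls" "p q" ys] xs(2) ys lastV unfolding V_def by blast+
  show ?thesis
  proof (cases ys rule: rev_cases)
    case Nil
    then have "p q = p r" using xs(4) ys by simp
    then have "id_walk R N q r [q, r]" using refl_R[OF qr(1)] qr by (simp add: id_walk_def)
    from D_le_walk[OF this] show ?thesis using \<open>p q = p r\<close> ys Nil by simp
  next
    case (snoc us u)
    then have u: "u = p r" using xs(4) ys by simp
    define ms where "ms = map vid (filter (\<lambda>z. z \<in> V) us)"
    have "u \<in> V" using u vertex_pt[OF qr(2)] by (simp add: V_def)
    moreover have "map p ms = filter (\<lambda>z. z \<in> V) us" unfolding ms_def map_map by (rule map_idI) (simp add: V_def vid)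
    ultimately have eq: "p q # filter (\<lambda>z. z \<in> V) ys = map p (q # ms @ [r])" using snoc u by simp
    have ms: "set ms \<subseteq> {..<N}" by (auto simp: ms_def V_def vid)
    have "successively R (q # ms @ [r])" using c(1) unfolding eq successively_map .
    moreover have "dsum w zs = plen (map p zs)" for zs by (induction zs rule: induct_list012) simp_all
    ultimately show ?thesis using D_complete[OF qr ms] c(2) unfolding eq by simp
  qed
qed

section \<open>The sorted directions of the input\<close>

definition \<rho> :: "nat \<Rightarrow> nat" where "\<rho> = srank n NA"
definition \<sigma> :: "nat \<Rightarrow> nat" where "\<sigma> = inv_into {..<n} \<rho>"

lemma \<rho>_bij: "bij_betw \<rho> {..<n} {..<n}"
  unfolding \<rho>_def by (rule rank_bij)

lemma \<sigma>_bij: "bij_betw \<sigma> {..<n} {..<n}"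
  unfolding \<sigma>_def using \<rho>_bij by (rule bij_betw_inv_into)

lemma \<sigma>: "r < n \<Longrightarrow> \<sigma> r < n" "r < n \<Longrightarrow> \<rho> (\<sigma> r) = r"
  using bij_betwE[OF \<sigma>_bij] bij_betw_inv_into_right[OF \<rho>_bij, of r] by (auto simp: \<sigma>_def)

abbreviation "UA \<equiv> reals sf aUA"
abbreviation "UB \<equiv> reals sf aUB"
abbreviation "UC \<equiv> reals sf aUC"

lemma sorted_dirs:
  assumes "r < n"
  shows "UA r = NA (\<sigma> r)" "UA (r + n) = - NA (\<sigma> r)" "UA (r + 2 * n) = NA (\<sigma> r)"
    "UB r = NB (\<sigma> r)" "UB (r + n) = - NB (\<sigma> r)" "UB (r + 2 * n) = NB (\<sigma> r)"
    "UC r = NC (\<sigma> r)" "UC (r + n) = - NC (\<sigma> r)" "UC (r + 2 * n) = NC (\<sigma> r)"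
proof -
  have "\<forall>(a, a') \<in> {(aNA, aUA), (aNB, aUB), (aNC, aUC)}. reals s2 a' r = reals s1 a (\<sigma> r) \<and>
      reals s2 a' (r + n) = - reals s1 a (\<sigma> r) \<and> reals s2 a' (r + 2 * n) = reals s1 a (\<sigma> r)"
    using run_sort_lines[of s1] \<sigma>[OF assms] unfolding s2_def[symmetric] by (simp add: n0 \<rho>_def NA_def) metis
  then show "UA r = NA (\<sigma> r)" "UA (r + n) = - NA (\<sigma> r)" "UA (r + 2 * n) = NA (\<sigma> r)"
    "UB r = NB (\<sigma> r)" "UB (r + n) = - NB (\<sigma> r)" "UB (r + 2 * n) = NB (\<sigma> r)"
    "UC r = NC (\<sigma> r)" "UC (r + n) = - NC (\<sigma> r)" "UC (r + 2 * n) = NC (\<sigma> r)"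
    by (simp_all add: frames_final NA_def NB_def NC_def)
qed

text \<open>The upper normals, sorted by arc cosine, fill the first half-turn, and each further
  block of \<open>n\<close> indices adds \<open>pi\<close>.\<close>

definition \<theta> :: "nat \<Rightarrow> real" where "\<theta> i = arccos (NA (\<sigma> (i mod n))) + pi * real (i div n)"

lemma arccos_NA:
  assumes "k < n"
  shows "0 \<le> arccos (NA k)" "arccos (NA k) < pi" "cos (arccos (NA k)) = NA k" "sin (arccos (NA k)) = NB k" "\<bar>NA k\<bar> \<le> 1"
proof -
  note u = normals(2,3)[OF assms]
  have "NA k * NA k \<le> 1" using u(1) zero_le_square[of "NB k"] by linarith
  then show a: "\<bar>NA k\<bar> \<le> 1" by (metis abs_square_le_1 power2_eq_square)
  then have b: "- 1 \<le> NA k" "NA k \<le> 1" by linarith+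
  have "NA k \<noteq> - 1" using u by auto
  then show "arccos (NA k) < pi" using b by (metis arccos_minus_1 arccos_less_arccos order_le_less order_refl)
  show "0 \<le> arccos (NA k)" "cos (arccos (NA k)) = NA k" using b by (simp_all add: arccos_lbound)
  have "sin (arccos (NA k)) = sqrt (1 - (NA k)\<^sup>2)" by (rule sin_arccos_abs[OF a])
  also have "1 - (NA k)\<^sup>2 = (NB k)\<^sup>2" using u(1) by (simp add: power2_eq_square)
  also have "sqrt ((NB k)\<^sup>2) = NB k" using u(2) by auto
  finally show "sin (arccos (NA k)) = NB k" .
qed

lemma dir_\<theta>: "i \<le> 2 * n \<Longrightarrow> dir (\<theta> i) = (UA i, UB i)"
proof -
  assume "i \<le> 2 * n"
  then obtain r k where r: "r < n" "i = r + k * n" "k = 0 \<or> k = 1 \<or> k = 2"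
  proof -
    have "i < 3 * n" using \<open>i \<le> 2 * n\<close> n_pos by linarith
    then have "i div n < 3" by (rule less_mult_imp_div_less)
    then have "i div n = 0 \<or> i div n = 1 \<or> i div n = 2" by linarith
    then show ?thesis using n_pos by (intro that[of "i mod n" "i div n"] mod_div_mult_eq[symmetric]) simp_all
  qed
  have \<theta>: "\<theta> i = arccos (NA (\<sigma> r)) + pi * real k" using r n_pos by (simp add: \<theta>_def)
  note a = arccos_NA[OF \<sigma>(1)[OF r(1)]] and s = sorted_dirs[OF r(1)]
  from r(3) show ?thesis
  proof (elim disjE)
    assume "k = 0"
    then show ?thesis using \<theta> a(3,4) s r(2) by (simp add: dir_def)
  next
    assume "k = 1"
    then show ?thesis using \<theta> a(3,4) s r(2) by (simp add: dir_def)
  next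
    assume k: "k = 2"
    then have "dir (\<theta> i) = dir (arccos (NA (\<sigma> r)))" using \<theta> dir_add_2pi[of "arccos (NA (\<sigma> r))"] by (simp add: mult.commute)
    then show ?thesis using k a(3,4) s r(2) by (simp add: dir_def)
  qed
qed

lemma arccos_mono: "r \<le> r' \<Longrightarrow> r' < n \<Longrightarrow> arccos (NA (\<sigma> r)) \<le> arccos (NA (\<sigma> r'))"
proof -
  assume r: "r \<le> r'" "r' < n"
  have "NA (\<sigma> r') \<le> NA (\<sigma> r)"
  proof (cases "r = r'")
    case False
    then show ?thesis using rank_antimono[of n NA "\<sigma> r" "\<sigma> r'"] \<sigma> r by (simp add: \<rho>_def)
  qed simp
  then show ?thesis using arccos_NA(5)[OF \<sigma>(1)] r by (subst arccos_le_mono) auto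
qed

lemma sorted_lines_axioms: "sorted_lines (lines ls) n \<theta> UC"
proof
  show "\<theta> i \<le> \<theta> j" if "i \<le> j" "j \<le> 2 * n" for i j
  proof (cases "i div n = j div n")
    case True
    have "i mod n \<le> j mod n" using that(1) True by (metis add_le_cancel_left mult_div_mod_eq)
    then show ?thesis using arccos_mono[of "i mod n" "j mod n"] n_pos True by (simp add: \<theta>_def)
  next
    case False
    then have "i div n + 1 \<le> j div n" using div_le_mono[OF that(1), of n] by simp
    then have "pi * real (i div n + 1) \<le> pi * real (j div n)" by (intro mult_left_mono of_nat_mono) simp_all
    moreover have "arccos (NA (\<sigma> (i mod n))) < pi" "0 \<le> arccos (NA (\<sigma> (j mod n)))"
      using arccos_NA(1,2)[OF \<sigma>(1)] n_pos by simp_all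
    ultimately show ?thesis by (simp add: \<theta>_def algebra_simps)
  qed
  show "\<theta> (i + n) = \<theta> i + pi" for i using n_pos by (simp add: \<theta>_def algebra_simps)
  show "UC (i + n) = - UC i" if "i \<le> n" for i
  proof (cases "i = n")
    case True
    then show ?thesis using sorted_dirs(8,9)[of 0] n_pos by (simp add: mult_2)
  next
    case False
    then show ?thesis using sorted_dirs(7,8)[of i] that by simp
  qed
  have "bij_betw (Lk \<circ> \<sigma>) {..<n} (lines ls)" using \<sigma>_bij bij_Lk by (rule bij_betw_trans)
  moreover have "(Lk \<circ> \<sigma>) i = {z. dir (\<theta> i) \<bullet> z = UC i}" if "i \<in> {..<n}" for i
    using that dir_\<theta>[of i] sorted_dirs[of i] normals(1)[OF \<sigma>(1)[of i]] by simp
  ultimately show "bij_betw (\<lambda>i. {z. dir (\<theta> i) \<bullet> z = UC i}) {..<n} (lines ls)"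
    using bij_betw_cong[of "{..<n}" "Lk \<circ> \<sigma>" "\<lambda>i. {z. dir (\<theta> i) \<bullet> z = UC i}" "lines ls"] by blast
  show "vertices (lines ls) \<noteq> {}" using vertices_eq crossings_nonempty by simp
  \<comment> \<open>Equal first and last angles would make all normals equal. The strict inequality
    is what keeps the gap from the last index of a block to the next block below
    \<open>pi\<close>.\<close>
  have strict: "arccos (NA (\<sigma> 0)) < arccos (NA (\<sigma> (n - 1)))"
  proof (rule ccontr)
    assume c: "\<not> ?thesis"
    have all: "NA k = NA (\<sigma> 0)" if "k < n" for k
    proof -
      have r: "\<rho> k < n" "\<sigma> (\<rho> k) = k" using bij_betwE[OF \<rho>_bij] bij_betw_inv_into_left[OF \<rho>_bij] that by (auto simp: \<sigma>_def)
      have "arccos (NA (\<sigma> 0)) \<le> arccos (NA k)" "arccos (NA k) \<le> arccos (NA (\<sigma> (n - 1)))"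
        using arccos_mono[of 0 "\<rho> k"] arccos_mono[of "\<rho> k" "n - 1"] r n_pos by simp_all
      then have "arccos (NA k) = arccos (NA (\<sigma> 0))" using c by linarith
      then show ?thesis using arccos_NA(3)[OF that] arccos_NA(3)[OF \<sigma>(1)[OF n_pos]] by metis
    qed
    have "NB k = NB (\<sigma> 0)" if "k < n" for k
      using all[OF that] arccos_NA(4)[OF that] arccos_NA(4)[OF \<sigma>(1)[OF n_pos]] by metis
    then show False using all ex_crossing by (auto simp: detf_def)
  qed
  show "\<theta> (Suc i) - \<theta> i < pi" if "i < 2 * n" for i
  proof (cases "Suc (i mod n) = n")
    case False
    then have "Suc i mod n = Suc (i mod n)" "Suc i div n = i div n" by (simp_all add: mod_Suc div_Suc)
    moreover have "Suc (i mod n) < n" using False n_pos by (metis Suc_lessI mod_less_divisor)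
    ultimately show ?thesis
      using arccos_NA(2)[OF \<sigma>(1), of "Suc (i mod n)"] arccos_NA(1)[OF \<sigma>(1), of "i mod n"] n_pos by (simp add: \<theta>_def)
  next
    case True
    then have "Suc i mod n = 0" "Suc i div n = Suc (i div n)" "i mod n = n - 1" by (simp_all add: mod_Suc div_Suc)
    then show ?thesis using strict by (simp add: \<theta>_def algebra_simps)
  qed
qed

interpretation sorted_lines "lines ls" n \<theta> UC
  by (rule sorted_lines_axioms)

lemma sdot_eq: "i \<le> 2 * n \<Longrightarrow> sdot sf i z = dir (\<theta> i) \<bullet> z"
  by (simp add: sdot_def dir_\<theta> inner_prod_def)

lemma smiss_eq: "i \<le> 2 * n \<Longrightarrow> smiss sf i k = miss i (p k)"
  by (simp add: smiss_def miss_def sdot_eq)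

section \<open>Table cells and routes\<close>

definition "trs = {(i, v, u). i < 2 * n \<and> v < N \<and> u < N \<and> trans_ok sf i v u}"

lemma dp_table: "\<exists>l. dp_inv N (\<lambda>u v. D u v) (smiss sf) (relaxed n N trs) l sf"
proof -
  define L where "L = triples (trans_ok sf) (2 * n) N"
  have t7: "trans_ok s7 = trans_ok sf" by (simp add: fun_eq_iff trans_ok_def sdot_def frames_final)
  have "holds_triples s8 L" using run_make_triples[of s7] unfolding s8_def[symmetric] by (simp add: t7 L_def n0 N_def)
  then have h: "holds_triples s9 L" by (simp add: holds_triples_def frames_final)
  have sm: "smiss s9 = smiss sf" by (simp add: fun_eq_iff smiss_def sdot_def frames_final)
  have zP: "nats s8 aP = (\<lambda>_. 0)" using zero[of aP] by (simp add: s_defs run_nats)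
  have i9: "dp_inv N (\<lambda>u v. D u v) (smiss sf) {} 0 s9" unfolding s9_def by (rule run_dp_init) (simp_all add: zP n0 N_def)
  have len: "length L \<le> N * N + 2 * n * N" unfolding L_def
  proof (rule length_triples_le)
    fix i j v u assume *: "i < j" "j < 2 * n" "v \<noteq> u" "trans_ok sf i v u" "trans_ok sf j v u"
    then show False using upcrossing_unique[OF *(1,2), of "p u - p v"]
      by (simp add: trans_ok_def sdot_eq)
  qed
  have vN: "v < N" if "(i, v, u) \<in> set L" for i v u using that by (simp add: L_def set_triples)
  have "\<exists>l. dp_inv N (\<lambda>u v. D u v) (smiss sf) (relaxed n N (set L)) l sf"
    using run_dp_loop[of s9 L] h i9 vN len sorted_triples[of "trans_ok sf" "2 * n" N]
    unfolding sf_def[symmetric] by (simp add: n0 N_def[symmetric] sm frames_final L_def)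
  moreover have "set L = trs" by (simp add: L_def set_triples trs_def)
  ultimately show ?thesis by simp
qed

abbreviation "P \<equiv> truncated_union (lines ls) lo hi"
abbreviation "cell a m \<equiv> a < N \<and> m < 2 * n + 1 \<and> tP sf (2 * n) a a m > 0"
abbreviation "cost a m \<equiv> tT sf (2 * n) a a m"

text \<open>One half of optimality: the extreme vertices supplied by \<open>candidate\<close> change
  only along recorded transitions, so some closed state is at least as good as the route in length
  and in misses.\<close>

lemma cell_of_route:
  assumes "is_route P qs"
  shows "\<exists>a m. cell a m \<and> cost a m \<le> route_length qs \<and> m + num_visited (lines ls) qs \<le> n"
proof -
  have "qs \<noteq> []" "curve qs \<subseteq> \<Union>(lines ls)" using assms by (auto simp: is_route_def truncated_union_def)
  then obtain v where v: "\<And>i. i \<le> 2 * n \<Longrightarrow> v i \<in> vertices (lines ls)" "v (2 * n) = v 0"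
    "\<And>i. i < 2 * n \<Longrightarrow> v (Suc i) = v i \<or>
       dir (\<theta> i) \<bullet> (v (Suc i) - v i) \<le> 0 \<and> 0 < dir (\<theta> (Suc i)) \<bullet> (v (Suc i) - v i)"
    "\<And>D. (\<And>xs. xs \<noteq> [] \<Longrightarrow> chain (lines ls) xs \<Longrightarrow> hd xs \<in> vertices (lines ls) \<Longrightarrow> last xs \<in> vertices (lines ls) \<Longrightarrow>
         D (hd xs) (last xs) \<le> plen xs) \<Longrightarrow> (\<Sum>i<2 * n. D (v i) (v (Suc i))) \<le> route_length qs"
    "(\<Sum>i<2 * n. miss (Suc i) (v (Suc i))) + num_visited (lines ls) qs \<le> n"
    by (rule candidate) blast
  obtain l where l: "dp_inv N (\<lambda>u v. D u v) (smiss sf) (relaxed n N trs) l sf" using dp_table by blast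
  define g where "g i = vid (v i)" for i
  have g: "g i < N" "p (g i) = v i" if "i \<le> 2 * n" for i using vid v(1)[OF that] by (simp_all add: g_def)
  have tr: "(i, g i, g (Suc i)) \<in> trs" if i: "i < 2 * n" for i
  proof -
    have "trans_ok sf i (g i) (g (Suc i))"
    proof (cases "v (Suc i) = v i")
      case True
      then show ?thesis by (simp add: trans_ok_def g_def)
    next
      case False
      then show ?thesis using v(3)[OF i] g[of i] g[of "Suc i"] i by (simp add: trans_ok_def sdot_eq not_less)
    qed
    then show ?thesis using g i by (simp add: trs_def)
  qed
  define m where "m = (\<Sum>i<2 * n. smiss sf (Suc i) (g (Suc i)))"
  have m: "m = (\<Sum>i<2 * n. miss (Suc i) (v (Suc i)))"
    unfolding m_def by (intro sum.cong refl) (simp add: smiss_eq g)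
  have sm1: "smiss sf i z \<le> 1" for i z by (simp add: smiss_def)
  have c: "tP sf (2 * n) (g 0) (g (2 * n)) m > 0 \<and> tT sf (2 * n) (g 0) (g (2 * n)) m \<le> (\<Sum>i<2 * n. D (g (Suc i)) (g i))"
    unfolding m_def by (rule dp_inv_complete[OF l _ tr sm1]) (use g in simp_all)
  have g2: "g (2 * n) = g 0" using v(2) by (simp add: g_def)
  \<comment> \<open>The table adds distances from the later to the earlier vertex, so chains are
    reversed before \<open>D_le_chain\<close> is applied.\<close>
  have "(\<Sum>i<2 * n. (\<lambda>x y. D (vid y) (vid x)) (v i) (v (Suc i))) \<le> route_length qs"
  proof (rule v(4))
    fix xs :: "(real \<times> real) list"
    assume xs: "xs \<noteq> []" "chain (lines ls) xs" "hd xs \<in> vertices (lines ls)" "last xs \<in> vertices (lines ls)"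
    have "chain (lines ls) (rev xs)" using xs(2) by (simp only: chain_rev)
    then have "D (vid (last xs)) (vid (hd xs)) \<le> plen (rev xs)"
      using xs by (intro D_le_chain) (simp_all add: vid hd_rev last_rev del: successively_rev)
    then show "D (vid (last xs)) (vid (hd xs)) \<le> plen xs" by (simp add: plen_rev)
  qed
  then have "cost (g 0) m \<le> route_length qs" using c g2 by (simp add: g_def)
  moreover have "m \<le> n" using v(5) m by simp
  ultimately show ?thesis using c g2 g(1)[of 0] v(5) m by (intro exI[of _ "g 0"] exI[of _ m]) simp
qed

text \<open>Crossings lie in the box, which is convex, so segments between crossings on a common
  line survive the truncation.\<close>

lemma pcurve_in_P:
  assumes "chain (lines ls) zs" "set zs \<subseteq> vertices (lines ls)"
  shows "pcurve zs \<subseteq> P"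
  using assms
proof (induction zs rule: induct_list012)
  case (2 z)
  then have z: "z \<in> vertices (lines ls)" by simp
  then obtain L where "L \<in> lines ls" "z \<in> L" unfolding vertices_def by blast
  then show ?case using vertices_in_box z by (auto simp: truncated_union_def)
next
  case (3 x y zs)
  obtain L where L: "L \<in> lines ls" "x \<in> L" "y \<in> L" using 3(3) by (auto simp: share_def)
  have "convex (L \<inter> cbox lo hi)" using convex_lines L(1) by (simp add: convex_Int)
  moreover have "x \<in> cbox lo hi" "y \<in> cbox lo hi" using 3(4) vertices_in_box by auto
  ultimately have "closed_segment x y \<subseteq> L \<inter> cbox lo hi" using L by (intro closed_segment_subset) auto
  then have "closed_segment x y \<subseteq> P" using L(1) unfolding truncated_union_def by blast
  then show ?case using 3(2-4) by simp
qed simp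

text \<open>The other half: the vertices of an arbitrary cell need not be extreme, but by
  \<open>visited_ge\<close> the table count still bounds the lines that the printed route
  misses.\<close>

lemma route_of_cell:
  assumes c: "cell a m" and t: "nats t fnd 0 = 1" "nats t bs 0 = a" "nats t bm 0 = m"
    and fr: "frame {xi, xj, bs, bm, fnd} {best} sf t"
  defines "rs \<equiv> answer (run output_route t)"
  shows "is_route P rs \<and> route_length rs \<le> cost a m \<and> n \<le> num_visited (lines ls) rs + m"
proof -
  note fr = frame_nats[OF fr] frame_reals[OF fr]
  obtain l where l: "dp_inv N (\<lambda>u v. D u v) (smiss sf) (relaxed n N trs) l sf" using dp_table by blast
  have sm: "smiss t = smiss sf" by (simp add: fun_eq_iff smiss_def sdot_def fr)
  have l': "dp_inv N (\<lambda>u v. reals t aD (pr u v)) (smiss t) (relaxed n N trs) l t"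
    using l dp_inv_cong[of t sf] by (simp add: sm fr)
  have ok: "hops_ok (lines ls) N t" using hops by (simp add: hops_ok_def fr)
  have "rs \<noteq> [] \<and> chain (lines ls) rs \<and> hd rs = last rs \<and> set rs \<subseteq> pt t ` {..<N} \<and>
    plen rs \<le> tT t (2 * n) a a m \<and>
    (\<exists>v. (\<forall>i<2 * n. v (Suc i) < N \<and> pt t (v (Suc i)) \<in> set rs) \<and> (\<Sum>i<2 * n. smiss t (Suc i) (v (Suc i))) = m)"
    unfolding rs_def using run_output_route[of "lines ls" t "relaxed n N trs" l a m] ok l' t c
    by (simp add: n0 N_def[symmetric] fr)
  then obtain v where o: "rs \<noteq> []" "chain (lines ls) rs" "hd rs = last rs" "set rs \<subseteq> p ` {..<N}" "plen rs \<le> cost a m"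
    "\<And>i. i < 2 * n \<Longrightarrow> v (Suc i) < N \<and> p (v (Suc i)) \<in> set rs" "(\<Sum>i<2 * n. smiss sf (Suc i) (v (Suc i))) = m"
    unfolding sm by (auto simp: fr)
  have V: "set rs \<subseteq> vertices (lines ls)" using o(4) pt_image by simp
  have "hd rs \<in> vertices (lines ls)" using V o(1) hd_in_set by blast
  then have "share (lines ls) (last rs) (hd rs)" using o(3) by (auto simp: share_def vertices_def)
  then have ch: "chain (lines ls) (rs @ [hd rs])" using o(1,2) by (simp add: successively_append_iff)
  have "curve rs = pcurve (rs @ [hd rs])" using o(1) by (rule curve_eq)
  also have "\<dots> \<subseteq> P" using pcurve_in_P[OF ch] V \<open>hd rs \<in> vertices (lines ls)\<close> by simp
  finally have "is_route P rs" using o(1) by (simp add: is_route_def)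
  moreover have "route_length rs \<le> cost a m"
    using route_length_eq[OF o(1)] dsum_snoc[OF o(1), of dist "hd rs"] o(3,5) by (simp add: cyc_def)
  moreover have "n \<le> num_visited (lines ls) rs + (\<Sum>i<2 * n. miss (Suc i) ((p \<circ> v) (Suc i)))"
    by (rule visited_ge) (use o in simp_all)
  moreover have "(\<Sum>i<2 * n. miss (Suc i) ((p \<circ> v) (Suc i))) = m"
    unfolding o(7)[symmetric] by (intro sum.cong refl) (simp add: smiss_eq)
  ultimately show ?thesis by simp
qed

end

section \<open>The two algorithms\<close>

text \<open>The strict test \<open>m + Q < n + 1\<close> expresses \<open>m + Q \<le> n\<close>: the
  quota is met with at most \<open>n - Q\<close> misses.\<close>

definition qwrp_prog :: fprog where
  "qwrp_prog = core 0 ;; select (NLess (NAdd (V xj) (NCell 0 (NConst 1))) (NAdd nn (NConst 1)))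
     (RLess (RCell aT eS) (RV best)) ;; output_route"

text \<open>The offset is 1 because the budget occupies real cell 0.\<close>

definition bwrp_prog :: fprog where
  "bwrp_prog = core (Suc 0) ;; select (BNot (RLess (RCell 0 (NConst 0)) (RCell aT eS))) (NLess (V xj) (V bm)) ;; output_route"

lemmas prog_defs = qwrp_prog_def bwrp_prog_def core_def normalise_def sort_lines_def rank_loop_def find_base_def
  make_vertices_def init_dist_def floyd_warshall_def next_hops_def make_triples_def push_triple_def dp_init_def dp_loop_def
  dp_row_def dp_relax_def select_def select_body_def output_route_def leg_def hop_def push_def

lemma wf_progs: "wf_prog qwrp_prog" "wf_prog bwrp_prog"
  by (simp_all add: prog_defs Let_def)

text \<open>The maximum is attained in the dynamic program: degree 4 for transitions, 2 for start
  vertices, 1 for miss counts. The cubic loops over the quadratically many vertices have degree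
  6.\<close>

lemma deg_progs: "deg qwrp_prog \<le> 7" "deg bwrp_prog \<le> 7"
  by (simp_all add: prog_defs Let_def)

lemma coeffs_nth:
  "k < length ls \<Longrightarrow> ls ! k = (cells (xs @ coeffs ls) (length xs + 3 * k), cells (xs @ coeffs ls) (Suc (length xs + 3 * k)),
     cells (xs @ coeffs ls) (Suc (Suc (length xs + 3 * k))))"
proof -
  have len: "length (coeffs ls) = 3 * length ls" for ls by (induction ls) (auto simp: coeffs_def)
  have "ls ! k = (coeffs ls ! (3 * k), coeffs ls ! Suc (3 * k), coeffs ls ! Suc (Suc (3 * k)))" if "k < length ls" for k
    using that
  proof (induction ls arbitrary: k)
    case (Cons l ls)
    obtain a b c where l: "l = (a, b, c)" by (metis prod_cases3)
    show ?case
    proof (cases k)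
      case 0
      then show ?thesis by (simp add: coeffs_def l)
    next
      case (Suc j)
      then show ?thesis using Cons.IH[of j] Cons.prems by (simp add: coeffs_def l)
    qed
  qed simp
  then show "k < length ls \<Longrightarrow> ls ! k = (cells (xs @ coeffs ls) (length xs + 3 * k), cells (xs @ coeffs ls) (Suc (length xs + 3 * k)),
     cells (xs @ coeffs ls) (Suc (Suc (length xs + 3 * k))))"
    using len[of ls] by (simp add: cells_def nth_append)
qed

lemma qwrp_correct:
  assumes "line_arrangement ls lo hi"
  shows "qwrp_answer (lines ls) (truncated_union (lines ls) lo hi) Q (answer (run qwrp_prog (qwrp_input ls lo hi Q)))"
proof -
  define s where "s = qwrp_input ls lo hi Q"
  interpret A: arrangement_input ls lo hi 0 s
  proof
    show "ls ! k = (reals s 0 (0 + 4 + 3 * k), reals s 0 (Suc (0 + 4 + 3 * k)), reals s 0 (Suc (Suc (0 + 4 + 3 * k))))"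
      if "k < length ls" for k
    proof -
      have e: "0 + 4 + 3 * k = length [fst lo, snd lo, fst hi, snd hi] + 3 * k" by simp
      show ?thesis unfolding e
        using coeffs_nth[OF that, of "[fst lo, snd lo, fst hi, snd hi]"] by (simp add: s_def qwrp_input_def initial_def)
    qed
  qed (use assms in \<open>simp_all add: s_def qwrp_input_def initial_def cells_def\<close>)
  let ?c = "NLess (NAdd (V xj) (NCell 0 (NConst 1))) (NAdd nn (NConst 1))" and ?q = "RLess (RCell aT eS) (RV best)"
  define t where "t = run (select ?c ?q) A.sf"
  have run: "answer (run qwrp_prog s) = answer (run output_route t)"
    by (simp add: qwrp_prog_def t_def A.run_core)
  have fr: "frame {xi, xj, bs, bm, fnd} {best} A.sf t" by (simp add: frame_def t_def run_nats run_reals)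
  have Q: "nats s 0 (Suc 0) = Q" by (simp add: s_def qwrp_input_def initial_def cells_def)
  have sel: "nats t fnd 0 = 0 \<and> (\<forall>a m. \<not> (A.cell a m \<and> m + Q < A.n + 1)) \<or>
    nats t fnd 0 = 1 \<and> (A.cell (nats t bs 0) (nats t bm 0) \<and> nats t bm 0 + Q < A.n + 1) \<and>
    (\<forall>a m. A.cell a m \<and> m + Q < A.n + 1 \<longrightarrow> A.cost (nats t bs 0) (nats t bm 0) \<le> A.cost a m)"
    using run_select[of A.sf ?c "\<lambda>a m. m + Q < A.n + 1" ?q "\<lambda>a m. A.cost a m"]
    unfolding t_def[symmetric] by (simp add: A.n0 A.N_def frame_nats frame_reals Q)
  let ?L = "lines ls" and ?P = "truncated_union (lines ls) lo hi"
  have cand: "\<exists>a m. A.cell a m \<and> m + Q < A.n + 1 \<and> A.cost a m \<le> route_length qs" if "qwrp_feasible ?L ?P Q qs" for qs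
  proof -
    have "is_route ?P qs" "Q \<le> num_visited ?L qs" using that by (simp_all add: qwrp_feasible_def)
    moreover from this(1) obtain a m where "A.cell a m" "A.cost a m \<le> route_length qs" "m + num_visited ?L qs \<le> A.n"
      using A.cell_of_route by blast
    ultimately show ?thesis by (intro exI[of _ a] exI[of _ m]) simp
  qed
  show ?thesis
  proof (cases "nats t fnd 0 = 0")
    case True
    then have "\<not> (\<exists>qs. qwrp_feasible ?L ?P Q qs)" using sel cand by fastforce
    then show ?thesis using run_output_none[OF True] run by (simp add: qwrp_answer_def s_def)
  next
    case False
    define a m where "a = nats t bs 0" and "m = nats t bm 0"
    have f: "nats t fnd 0 = 1" "A.cell a m" "m + Q < A.n + 1"
      "\<And>a' m'. A.cell a' m' \<Longrightarrow> m' + Q < A.n + 1 \<Longrightarrow> A.cost a m \<le> A.cost a' m'"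
      using sel False by (auto simp: a_def m_def)
    have r: "is_route ?P (answer (run qwrp_prog s))" "route_length (answer (run qwrp_prog s)) \<le> A.cost a m"
      "A.n \<le> num_visited ?L (answer (run qwrp_prog s)) + m"
      using A.route_of_cell[OF f(2,1) _ _ fr] unfolding run by (simp_all add: a_def m_def)
    have "qwrp_feasible ?L ?P Q (answer (run qwrp_prog s))" using r(1,3) f(3) by (simp add: qwrp_feasible_def)
    moreover have "route_length (answer (run qwrp_prog s)) \<le> route_length qs" if "qwrp_feasible ?L ?P Q qs" for qs
      using cand[OF that] f(4) r(2) by (meson order_trans)
    ultimately show ?thesis unfolding qwrp_answer_def qwrp_optimal_def s_def by auto
  qed
qed

text \<open>Fewest misses within the budget means most visits: a competing route has a cell with
  some \<open>m' \<ge> m\<close> and visits at most \<open>n - m'\<close> lines, while the printed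
  route visits at least \<open>n - m\<close>.\<close>

lemma bwrp_correct:
  assumes "line_arrangement ls lo hi"
  shows "bwrp_answer (lines ls) (truncated_union (lines ls) lo hi) B (answer (run bwrp_prog (bwrp_input ls lo hi B)))"
proof -
  define s where "s = bwrp_input ls lo hi B"
  interpret A: arrangement_input ls lo hi "Suc 0" s
  proof
    show "ls ! k = (reals s 0 (Suc 0 + 4 + 3 * k), reals s 0 (Suc (Suc 0 + 4 + 3 * k)), reals s 0 (Suc (Suc (Suc 0 + 4 + 3 * k))))"
      if "k < length ls" for k
    proof -
      have e: "Suc 0 + 4 + 3 * k = length [B, fst lo, snd lo, fst hi, snd hi] + 3 * k" by simp
      show ?thesis unfolding e
        using coeffs_nth[OF that, of "[B, fst lo, snd lo, fst hi, snd hi]"] by (simp add: s_def bwrp_input_def initial_def)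
    qed
  qed (use assms in \<open>simp_all add: s_def bwrp_input_def initial_def cells_def\<close>)
  let ?c = "BNot (RLess (RCell 0 (NConst 0)) (RCell aT eS))" and ?q = "NLess (V xj) (V bm)"
  define t where "t = run (select ?c ?q) A.sf"
  have run: "answer (run bwrp_prog s) = answer (run output_route t)"
    by (simp add: bwrp_prog_def t_def A.run_core)
  have fr: "frame {xi, xj, bs, bm, fnd} {best} A.sf t" by (simp add: frame_def t_def run_nats run_reals)
  have "reals A.sf 0 = reals s 0" by (simp add: A.s_defs run_reals)
  then have B: "reals A.sf 0 0 = B" by (simp add: s_def bwrp_input_def initial_def cells_def)
  have sel: "nats t fnd 0 = 0 \<and> (\<forall>a m. \<not> (A.cell a m \<and> A.cost a m \<le> B)) \<or>
    nats t fnd 0 = 1 \<and> (A.cell (nats t bs 0) (nats t bm 0) \<and> A.cost (nats t bs 0) (nats t bm 0) \<le> B) \<and>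
    (\<forall>a m. A.cell a m \<and> A.cost a m \<le> B \<longrightarrow> nats t bm 0 \<le> m)"
    using run_select[of A.sf ?c "\<lambda>a m. A.cost a m \<le> B" ?q "\<lambda>a m. real m"]
    unfolding t_def[symmetric] by (simp add: A.n0 A.N_def frame_nats frame_reals B not_less)
  let ?L = "lines ls" and ?P = "truncated_union (lines ls) lo hi"
  have cand: "\<exists>a m. A.cell a m \<and> A.cost a m \<le> B \<and> m + num_visited ?L qs \<le> A.n" if "bwrp_feasible ?P B qs" for qs
    using A.cell_of_route[of qs] that unfolding bwrp_feasible_def by (meson order_trans)
  show ?thesis
  proof (cases "nats t fnd 0 = 0")
    case True
    then have "\<not> (\<exists>qs. bwrp_feasible ?P B qs)" using sel cand by fastforce
    then show ?thesis using run_output_none[OF True] run by (simp add: bwrp_answer_def s_def)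
  next
    case False
    define a m where "a = nats t bs 0" and "m = nats t bm 0"
    have f: "nats t fnd 0 = 1" "A.cell a m" "A.cost a m \<le> B" "\<And>a' m'. A.cell a' m' \<Longrightarrow> A.cost a' m' \<le> B \<Longrightarrow> m \<le> m'"
      using sel False by (auto simp: a_def m_def)
    have r: "is_route ?P (answer (run bwrp_prog s))" "route_length (answer (run bwrp_prog s)) \<le> A.cost a m"
      "A.n \<le> num_visited ?L (answer (run bwrp_prog s)) + m"
      using A.route_of_cell[OF f(2,1) _ _ fr] unfolding run by (simp_all add: a_def m_def)
    have "bwrp_feasible ?P B (answer (run bwrp_prog s))" using r(1,2) f(3) by (simp add: bwrp_feasible_def)
    moreover have "num_visited ?L qs \<le> num_visited ?L (answer (run bwrp_prog s))" if feas: "bwrp_feasible ?P B qs" for qs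
    proof -
      obtain a' m' where "A.cell a' m'" "A.cost a' m' \<le> B" "m' + num_visited ?L qs \<le> A.n" using cand[OF feas] by blast
      moreover from this(1,2) have "m \<le> m'" by (rule f(4))
      ultimately show ?thesis using r(3) by linarith
    qed
    ultimately show ?thesis unfolding bwrp_answer_def bwrp_optimal_def s_def by auto
  qed
qed

theorem theorem16:
  shows "(\<exists>p T. solves_qwrp_in_time p T \<and> (\<lambda>n. real (T n)) \<in> O(\<lambda>n. real n ^ 7)) \<and>
         (\<exists>p T. solves_bwrp_in_time p T \<and> (\<lambda>n. real (T n)) \<in> O(\<lambda>n. real n ^ 7))"
proof -
  have "solves_qwrp_in_time (compile qwrp_prog) (\<lambda>n. time_bound n qwrp_prog)"
    unfolding solves_qwrp_in_time_def
  proof (intro allI impI)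
    fix ls lo hi Q assume "line_arrangement ls lo hi"
    moreover have "nats (qwrp_input ls lo hi Q) 0 0 = length ls" by (simp add: qwrp_input_def initial_def cells_def)
    ultimately show "\<exists>t s. exec (compile qwrp_prog) (qwrp_input ls lo hi Q) t s \<and> t \<le> time_bound (length ls) qwrp_prog \<and>
        qwrp_answer (lines ls) (truncated_union (lines ls) lo hi) Q (answer s)"
      using exec_compile[OF wf_progs(1), of "qwrp_input ls lo hi Q"] qwrp_correct by metis
  qed
  moreover have "solves_bwrp_in_time (compile bwrp_prog) (\<lambda>n. time_bound n bwrp_prog)"
    unfolding solves_bwrp_in_time_def
  proof (intro allI impI)
    fix ls lo hi B assume "line_arrangement ls lo hi"
    moreover have "nats (bwrp_input ls lo hi B) 0 0 = length ls" by (simp add: bwrp_input_def initial_def cells_def)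
    ultimately show "\<exists>t s. exec (compile bwrp_prog) (bwrp_input ls lo hi B) t s \<and> t \<le> time_bound (length ls) bwrp_prog \<and>
        bwrp_answer (lines ls) (truncated_union (lines ls) lo hi) B (answer s)"
      using exec_compile[OF wf_progs(2), of "bwrp_input ls lo hi B"] bwrp_correct by metis
  qed
  ultimately show ?thesis using time_bound_bigo[OF deg_progs(1)] time_bound_bigo[OF deg_progs(2)] by blast
qed

end
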